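(* Let $l>2$, $c,\alpha\in\mathbb Z$ and $\gamma\ge0$ with $\alpha l+c>\gamma l$, and put $N=\alpha l+c$. For $\mathbf k\in\mathbb Z^{N}_{+,\gamma}$, the vector $\Psi^{\mathbf k}\in\wedge^NV(z)$ is a simultaneous eigenvector for the actions of $K_i^\pm(z)$ for all $i\in\{0,1,\dots,l-1\}$ (i.e. of all coefficients of these series).
   Context: **Coefficients.** $\mathcal{R}=\mathbb{C}(s^{1/2},t^{1/2})$, $p=t^l$, $q=s^{1/2}t^{1/2}$, $r=s^{-1/2}t^{1/2}$. For a rational function $g(z)$, $g^+$ (resp. $g^-$) is its expansion in powers of $z^{-1}$ (resp. $z$). **q-wedge space.** $\mathbf H_N$ is the $\mathcal R$-algebra generated by $T_1^{\pm1},\dots,T_{N-1}^{\pm1}$ with $(T_a+1)(T_a-q^2)=0$ and the braid relations of type $A$. Let $V=\bigoplus_{j=0}^{l-1}\mathcal R v_j$. $\mathbf H_N$ acts on the left on $V^{\otimes N}$, $T_a$ acting on factors $a,a+1$ by $v_i\otimes v_i\mapsto q^2v_i\otimes v_i$; $v_i\otimes v_{i'}\mapsto qv_{i'}\otimes v_i$ if $i<i'$; $v_i\otimes v_{i'}\mapsto qv_{i'}\otimes v_i+(q^2-1)v_i\otimes v_{i'}$ if $i>i'$. It acts on the right on $P_N=\mathcal R[z_1^{\pm1},\dots,z_N^{\pm1}]$ by $T_a\mapsto(q^2-1)-q\,g_{a,a+1}$, where $g_{ab}=\frac{q^{-1}z_a-qz_b}{z_a-z_b}(\sigma_{ab}-1)+q$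 and $\sigma_{ab}$ exchanges $z_a,z_b$. Put $\wedge^NV(z)=P_N\otimes_{\mathbf H_N}V^{\otimes N}$. For $\mathbf k\in\mathbb Z^N$ write $k_a=j_a-l(m_a+1)$, $j_a\in\{0,\dots,l-1\}$, $m_a\in\mathbb Z$, and $u_{\mathbf k}=z^{\mathbf m}\otimes v_{\mathbf j}$, with $z^{\mathbf m}=\prod z_a^{m_a}$, $v_{\mathbf j}=v_{j_1}\otimes\cdots\otimes v_{j_N}$. **Operators.** The Dunkl–Cherednik operators are $Y_a^{(N)}=g_{a,a+1}^{-1}\sigma_{a,a+1}\cdots g_{a,N}^{-1}\sigma_{a,N}\,p^{D_a}\,\sigma_{1,a}g_{1,a}\cdots\sigma_{a-1,a}g_{a-1,a}$ (composition of operators on $P_N$), $p^{D_a}$ replacing $z_a$ by $pz_a$; put $Y_a=q^{1-N}Y_a^{(N)}$ and $\theta_m(z)=\frac{q^mz-1}{z-q^m}$. For $i=1,\dots,l-1$ the action of $K_i^\pm(z)$ on $\wedge^NV(z)$ is given, for $\mathbf j$ non-decreasing and $h\in P_N$ (operators acting on $h$ from the right), by $$K_i^\pm(z)(h\otimes v_{\mathbf j})=h\prod_{j_a=i-1}\theta_1^\pm(q^{l-i+1}r^{l-i}Y_az)\prod_{j_b=i}\theta_{-1}^\pm(q^{l-i-1}r^{l-i}Y_bz)\otimes v_{\mathbf j}.$$ Let $\rho$ be the (well-defined) automorphism of $\wedge^NV(z)$ with $\rho(u_{(k_1,\dots,k_N)})=u_{(k_1-1,\dots,k_N-1)}$ for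 all $\mathbf k\in\mathbb Z^N$; then $K_0^\pm(z)=\rho\circ K_1^\pm(qrz)\circ\rho^{-1}$. **Index sets.** $\mathbb Z^N_{+,\gamma}$ is the set of $\mathbf k\in\mathbb Z^N$ with $k_1>\cdots>k_N$, $m_a\le m_a^c$ for all $a$, and $\sum_a(m_a^c-m_a)=\gamma$, where $(m_a^c)_a$ is the $\mathbf m$-sequence of $(c-1,c-2,\dots,c-N)$. **The vectors $\Psi^{\mathbf k}$.** The Bruhat order $\prec$ on $\mathbb Z^N$ is the transitive closure of: $\mathbf x\succ\sigma_{ij}\mathbf x$ if $i<j$, $x_i>x_j$; and $\sigma_{ij}\mathbf x\succ\mathbf x-\mathbf e_i+\mathbf e_j$ if $i<j$, $x_i-x_j>1$. For $\mathbf m\in\mathbb Z^N$ let $\sigma_{\mathbf m}(a)=\#\{b\le a:m_b\ge m_a\}+\#\{b>a:m_b>m_a\}$ and $\zeta_a(\mathbf m)=p^{m_a}q^{2\sigma_{\mathbf m}(a)-N-1}$. The nonsymmetric Macdonald polynomial $\Phi^{\mathbf m}\in P_N$ is characterized by $\Phi^{\mathbf m}\in z^{\mathbf m}+\sum_{\mathbf n\prec\mathbf m}\mathcal Rz^{\mathbf n}$ and $\Phi^{\mathbf m}Y_a^{(N)}=\zeta_a(\mathbf m)\Phi^{\mathbf m}$ for all $a$. For $\mathbf k\in\mathbb Z^N$ with $k_1>\cdots>k_N$ let $\tau\in\mathfrak S_N$ be the unique permutation such that $(j_{\tau(a)})_a$ is non-decreasing and $m_{\tau(a)}<m_{\tau(b)}$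 whenever $a<b$, $j_{\tau(a)}=j_{\tau(b)}$. Put $\underline{\mathbf m}=(m_{\tau(a)})_a$, $\underline{\mathbf j}=(j_{\tau(a)})_a$ and $\Psi^{\mathbf k}=\Phi^{\underline{\mathbf m}}\otimes v_{\underline{\mathbf j}}$. *)

theory Defs
  imports
    "HOL-Library.Poly_Mapping"
    "HOL-Library.FuncSet"
    "HOL-Library.Set_Algebras"
    "HOL-Computational_Algebra.Computational_Algebra"
    "HOL-Combinatorics.Permutations"
begin

text \<open>
  Conventions. The tensor factors and the variables \<open>z\<^sub>1, \<dots>, z\<^sub>N\<close> are indexed by \<open>{1..N}\<close>. An element
  of \<open>\<int>\<^sup>N\<close> is given by a function \<open>nat \<Rightarrow> int\<close> of which only the values on \<open>{1..N}\<close> are ever used.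
\<close>

section \<open>Coefficients\<close>

text \<open>The field \<open>\<complex>(s\<^sup>1\<^sup>/\<^sup>2, t\<^sup>1\<^sup>/\<^sup>2)\<close>; the inner polynomial variable is \<open>s\<^sup>1\<^sup>/\<^sup>2\<close>, the outer one \<open>t\<^sup>1\<^sup>/\<^sup>2\<close>.\<close>

type_synonym coef = "complex poly poly fract"

definition s_half :: coef where
  "s_half = Fract [:[:0, 1:]:] 1"

definition t_half :: coef where
  "t_half = Fract [:0, 1:] 1"

definition p_par :: "nat \<Rightarrow> coef" where
  "p_par l = (t_half ^ 2) ^ l"

definition q_par :: coef where
  "q_par = s_half * t_half"

definition r_par :: coef where
  "r_par = inverse s_half * t_half"

section \<open>Laurent polynomials and the right Hecke action\<close>

text \<open>
  Finitely supported coefficient functions on finitely supported exponent vectors, with the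
  convolution product: Laurent polynomials in the variables \<open>z\<^sub>a\<close>, \<open>a :: nat\<close>. The operators below are
  defined on this whole ring and preserve \<open>laurent_polys N\<close>, the variables outside \<open>{1..N}\<close> being
  spectators.
\<close>

type_synonym laurent = "(nat \<Rightarrow>\<^sub>0 int) \<Rightarrow>\<^sub>0 coef"

definition laurent_polys :: "nat \<Rightarrow> laurent set" where
  "laurent_polys N = {f. \<forall>e\<in>Poly_Mapping.keys f. Poly_Mapping.keys e \<subseteq> {1..N}}"

definition const_L :: "coef \<Rightarrow> laurent" where
  "const_L c = Poly_Mapping.single 0 c"

definition var_z :: "nat \<Rightarrow> laurent" where
  "var_z a = Poly_Mapping.single (Poly_Mapping.single a 1) 1"

definition exponent :: "nat \<Rightarrow> (nat \<Rightarrow> int) \<Rightarrow> (nat \<Rightarrow>\<^sub>0 int)" where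
  "exponent N m = (\<Sum>a\<in>{1..N}. Poly_Mapping.single a (m a))"

definition z_monom :: "nat \<Rightarrow> (nat \<Rightarrow> int) \<Rightarrow> laurent" where
  "z_monom N m = Poly_Mapping.single (exponent N m) 1"

definition swap_z :: "nat \<Rightarrow> nat \<Rightarrow> laurent \<Rightarrow> laurent" where
  "swap_z a b f = (\<Sum>e\<in>Poly_Mapping.keys f.
     Poly_Mapping.single (Poly_Mapping.map_key (transpose a b) e) (Poly_Mapping.lookup f e))"

definition p_shift :: "nat \<Rightarrow> nat \<Rightarrow> laurent \<Rightarrow> laurent" where
  "p_shift l a f = (\<Sum>e\<in>Poly_Mapping.keys f.
     Poly_Mapping.single e (p_par l powi (Poly_Mapping.lookup e a) * Poly_Mapping.lookup f e))"

text \<open>\<open>(\<sigma>\<^sub>a\<^sub>b f - f) / (z\<^sub>a - z\<^sub>b)\<close>, the division being exact.\<close>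

definition div_diff :: "nat \<Rightarrow> nat \<Rightarrow> laurent \<Rightarrow> laurent" where
  "div_diff a b f = (THE h. (var_z a - var_z b) * h = swap_z a b f - f)"

definition g_op :: "nat \<Rightarrow> nat \<Rightarrow> laurent \<Rightarrow> laurent" where
  "g_op a b f =
     (const_L (inverse q_par) * var_z a - const_L q_par * var_z b) * div_diff a b f + const_L q_par * f"

text \<open>The right action of the generator \<open>T\<^sub>a\<close> on Laurent polynomials.\<close>

definition T_poly :: "nat \<Rightarrow> laurent \<Rightarrow> laurent" where
  "T_poly a f = const_L (q_par ^ 2 - 1) * f - const_L q_par * g_op a (a + 1) f"

section \<open>The tensor power of V and the left Hecke action\<close>

text \<open>
  \<open>V\<^sup>\<otimes>\<^sup>N\<close> is the free module on the basis \<open>v\<^sub>j = v\<^bsub>j 1\<^esub> \<otimes> \<dots> \<otimes> v\<^bsub>j N\<^esub>\<close>, \<open>j \<in> letters N l\<close>.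
\<close>

definition letters :: "nat \<Rightarrow> nat \<Rightarrow> (nat \<Rightarrow> nat) set" where
  "letters N l = {1..N} \<rightarrow>\<^sub>E {..<l}"

type_synonym vtensor = "(nat \<Rightarrow> nat) \<Rightarrow>\<^sub>0 coef"

definition V_tensors :: "nat \<Rightarrow> nat \<Rightarrow> vtensor set" where
  "V_tensors N l = {w. Poly_Mapping.keys w \<subseteq> letters N l}"

definition v_basis :: "(nat \<Rightarrow> nat) \<Rightarrow> vtensor" where
  "v_basis j = Poly_Mapping.single j 1"

definition T_basis :: "nat \<Rightarrow> (nat \<Rightarrow> nat) \<Rightarrow> vtensor" where
  "T_basis a j =
     (if j a = j (a + 1) then Poly_Mapping.single j (q_par ^ 2)
      else if j a < j (a + 1) then Poly_Mapping.single (j \<circ> transpose a (a + 1)) q_par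
      else Poly_Mapping.single (j \<circ> transpose a (a + 1)) q_par + Poly_Mapping.single j (q_par ^ 2 - 1))"

definition T_V :: "nat \<Rightarrow> vtensor \<Rightarrow> vtensor" where
  "T_V a w = (\<Sum>j\<in>Poly_Mapping.keys w.
     Poly_Mapping.map ((*) (Poly_Mapping.lookup w j)) (T_basis a j))"

section \<open>The wedge space\<close>

text \<open>
  Elements of \<open>P\<^sub>N \<otimes> V\<^sup>\<otimes>\<^sup>N\<close> (tensor product over the field) are written \<open>\<Sum>\<^sub>j h\<^sub>j \<otimes> v\<^sub>j\<close> and stored as \<open>j \<mapsto> h\<^sub>j\<close>.
\<close>

type_synonym tensor = "(nat \<Rightarrow> nat) \<Rightarrow>\<^sub>0 laurent"

definition tensors :: "nat \<Rightarrow> nat \<Rightarrow> tensor set" where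
  "tensors N l = {x. Poly_Mapping.keys x \<subseteq> letters N l \<and> (\<forall>j. Poly_Mapping.lookup x j \<in> laurent_polys N)}"

definition tens :: "laurent \<Rightarrow> vtensor \<Rightarrow> tensor" where
  "tens f w = Poly_Mapping.map (\<lambda>c. const_L c * f) w"

definition scale_T :: "coef \<Rightarrow> tensor \<Rightarrow> tensor" where
  "scale_T c x = Poly_Mapping.map ((*) (const_L c)) x"

text \<open>
  The subspace by which \<open>P\<^sub>N \<otimes> V\<^sup>\<otimes>\<^sup>N\<close> is divided to form the tensor product over the Hecke algebra. It is
  enough to impose \<open>f T\<^sub>a \<otimes> w = f \<otimes> T\<^sub>a w\<close>: the \<open>T\<^sub>a\<close> generate the Hecke algebra, because
  \<open>(T\<^sub>a + 1)(T\<^sub>a - q\<^sup>2) = 0\<close> expresses \<open>T\<^sub>a\<^sup>-\<^sup>1\<close> through \<open>T\<^sub>a\<close>.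
\<close>

definition hecke_rel :: "nat \<Rightarrow> nat \<Rightarrow> tensor set" where
  "hecke_rel N l = module.span scale_T
     {tens (T_poly a f) w - tens f (T_V a w) | a f w.
        1 \<le> a \<and> a < N \<and> f \<in> laurent_polys N \<and> w \<in> V_tensors N l}"

text \<open>
  The quotient consists of cosets; the sum of two cosets is the elementwise sum of sets, and the zero
  vector is \<open>hecke_rel N l\<close>. In \<open>scale_W\<close> the summand \<open>hecke_rel N l\<close> matters only for \<open>c = 0\<close>.
\<close>

definition wcoset :: "nat \<Rightarrow> nat \<Rightarrow> tensor \<Rightarrow> tensor set" where
  "wcoset N l x = x +o hecke_rel N l"

definition wedge :: "nat \<Rightarrow> nat \<Rightarrow> tensor set set" where
  "wedge N l = wcoset N l ` tensors N l"

definition scale_W :: "nat \<Rightarrow> nat \<Rightarrow> coef \<Rightarrow> tensor set \<Rightarrow> tensor set" where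
  "scale_W N l c X = scale_T c ` X + hecke_rel N l"

definition wedge_endo :: "nat \<Rightarrow> nat \<Rightarrow> (tensor set \<Rightarrow> tensor set) \<Rightarrow> bool" where
  "wedge_endo N l F \<longleftrightarrow>
     F \<in> wedge N l \<rightarrow>\<^sub>E wedge N l \<and>
     (\<forall>X\<in>wedge N l. \<forall>Y\<in>wedge N l. F (X + Y) = F X + F Y) \<and>
     (\<forall>c. \<forall>X\<in>wedge N l. F (scale_W N l c X) = scale_W N l c (F X))"

text \<open>The image of \<open>h \<otimes> v\<^sub>j\<close> in the wedge space; only the values of \<open>j\<close> on \<open>{1..N}\<close> matter.\<close>

definition wtens :: "nat \<Rightarrow> nat \<Rightarrow> laurent \<Rightarrow> (nat \<Rightarrow> nat) \<Rightarrow> tensor set" where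
  "wtens N l h j = wcoset N l (tens h (v_basis (restrict j {1..N})))"

text \<open>The decomposition \<open>k = j - l (m + 1)\<close> with \<open>0 \<le> j < l\<close>.\<close>

definition j_part :: "nat \<Rightarrow> int \<Rightarrow> nat" where
  "j_part l k = nat (k mod int l)"

definition m_part :: "nat \<Rightarrow> int \<Rightarrow> int" where
  "m_part l k = - (k div int l) - 1"

lemma j_part_m_part:
  assumes "l > 0"
  shows "j_part l k < l" and "k = int (j_part l k) - int l * (m_part l k + 1)"
proof -
  show "j_part l k < l"
    using assms by (simp add: j_part_def nat_less_iff)
  have "int (j_part l k) = k mod int l"
    using assms by (simp add: j_part_def)
  then show "k = int (j_part l k) - int l * (m_part l k + 1)"
    by (simp add: m_part_def)
qed

definition u_vec :: "nat \<Rightarrow> nat \<Rightarrow> (nat \<Rightarrow> int) \<Rightarrow> tensor set" where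
  "u_vec N l k = wtens N l (z_monom N (\<lambda>a. m_part l (k a))) (\<lambda>a. j_part l (k a))"

section \<open>Dunkl--Cherednik operators\<close>

text \<open>
  The products are compositions of maps acting on a Laurent polynomial written to their right, so the
  rightmost factor is applied first.
\<close>

definition Y_N :: "nat \<Rightarrow> nat \<Rightarrow> nat \<Rightarrow> laurent \<Rightarrow> laurent" where
  "Y_N N l a =
     foldr (\<lambda>b F. inv (g_op a b) \<circ> swap_z a b \<circ> F) [a + 1..<N + 1] id
     \<circ> p_shift l a
     \<circ> foldr (\<lambda>b F. swap_z b a \<circ> g_op b a \<circ> F) [1..<a] id"

definition Y_op :: "nat \<Rightarrow> nat \<Rightarrow> nat \<Rightarrow> laurent \<Rightarrow> laurent" where
  "Y_op N l a f = const_L (q_par powi (1 - int N)) * Y_N N l a f"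

section \<open>The operators \<open>K\<^sub>i\<^sup>\<plusminus>(z)\<close>\<close>

text \<open>
  A series in \<open>z\<^sup>-\<^sup>1\<close> (sign \<open>Plus\<close>) or in \<open>z\<close> (sign \<open>Minus\<close>) is a formal power series whose
  \<open>n\<close>-th coefficient is that of \<open>z\<^sup>-\<^sup>n\<close>, respectively \<open>z\<^sup>n\<close>.
\<close>

datatype sgn_pm = Plus | Minus

text \<open>
  The expansions of \<open>\<theta>\<^sub>m(z) = (q\<^sup>m z - 1) / (z - q\<^sup>m)\<close>; with \<open>z = x\<^sup>-\<^sup>1\<close> this is
  \<open>(q\<^sup>m - x) / (1 - q\<^sup>m x)\<close>.
\<close>

fun theta :: "sgn_pm \<Rightarrow> int \<Rightarrow> coef fps" where
  "theta Minus m =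
     (fps_const (q_par powi m) * fps_X - 1) / (fps_X - fps_const (q_par powi m))"
| "theta Plus m =
     (fps_const (q_par powi m) - fps_X) / (1 - fps_const (q_par powi m) * fps_X)"

text \<open>Action of the operator-valued series \<open>\<Sum>\<^sub>n \<phi>\<^sub>n A\<^sup>n x\<^sup>n\<close> on a series with Laurent polynomial coefficients.\<close>

definition act_series :: "coef fps \<Rightarrow> (laurent \<Rightarrow> laurent) \<Rightarrow> laurent fps \<Rightarrow> laurent fps" where
  "act_series \<phi> A H =
     Abs_fps (\<lambda>n. \<Sum>k\<le>n. const_L (fps_nth \<phi> k) * (A ^^ k) (fps_nth H (n - k)))"

text \<open>Action of \<open>\<theta>\<^sub>m\<^sup>\<plusminus>(\<kappa> Y\<^sub>a z)\<close>; the expansion in \<open>z\<^sup>-\<^sup>1\<close> involves powers of \<open>(\<kappa> Y\<^sub>a)\<^sup>-\<^sup>1\<close>.\<close>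

definition theta_Y ::
  "nat \<Rightarrow> nat \<Rightarrow> sgn_pm \<Rightarrow> int \<Rightarrow> coef \<Rightarrow> nat \<Rightarrow> laurent fps \<Rightarrow> laurent fps" where
  "theta_Y N l \<epsilon> m \<kappa> a =
     (let A = (\<lambda>f. const_L \<kappa> * Y_op N l a f)
      in act_series (theta \<epsilon> m) (case \<epsilon> of Plus \<Rightarrow> inv A | Minus \<Rightarrow> A))"

text \<open>
  The series \<open>h \<Prod>\<^bsub>j\<^sub>a=i-1\<^esub> \<theta>\<^sub>1\<^sup>\<plusminus>(\<dots>) \<Prod>\<^bsub>j\<^sub>b=i\<^esub> \<theta>\<^sub>-\<^sub>1\<^sup>\<plusminus>(\<dots>)\<close>, the factors acting from the right. The
  operators \<open>Y\<^sub>a\<close> commute; the factors are applied in the order in which they are written, with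
  increasing indices.
\<close>

definition K_series :: "nat \<Rightarrow> nat \<Rightarrow> nat \<Rightarrow> sgn_pm \<Rightarrow> (nat \<Rightarrow> nat) \<Rightarrow> laurent \<Rightarrow> laurent fps" where
  "K_series N l i \<epsilon> j h =
     fold (theta_Y N l \<epsilon> (-1) (q_par ^ (l - i - 1) * r_par ^ (l - i))) (filter (\<lambda>b. j b = i) [1..<N + 1])
       (fold (theta_Y N l \<epsilon> 1 (q_par ^ (l - i + 1) * r_par ^ (l - i))) (filter (\<lambda>a. j a = i - 1) [1..<N + 1])
         (fps_const h))"

text \<open>The \<open>n\<close>-th coefficient of \<open>K\<^sub>i\<^sup>\<plusminus>(z)\<close> for \<open>1 \<le> i < l\<close>.\<close>

definition K_finite :: "nat \<Rightarrow> nat \<Rightarrow> nat \<Rightarrow> sgn_pm \<Rightarrow> nat \<Rightarrow> tensor set \<Rightarrow> tensor set" where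
  "K_finite N l i \<epsilon> n = (THE F. wedge_endo N l F \<and>
     (\<forall>j\<in>letters N l. mono_on {1..N} j \<longrightarrow>
        (\<forall>h\<in>laurent_polys N.
           F (wtens N l h j) = wtens N l (fps_nth (K_series N l i \<epsilon> j h) n) j)))"

definition rho :: "nat \<Rightarrow> nat \<Rightarrow> tensor set \<Rightarrow> tensor set" where
  "rho N l = (THE F. wedge_endo N l F \<and> bij_betw F (wedge N l) (wedge N l) \<and>
     (\<forall>k. F (u_vec N l k) = u_vec N l (\<lambda>a. k a - 1)))"

text \<open>
  The \<open>n\<close>-th coefficient of \<open>K\<^sub>i\<^sup>\<plusminus>(z)\<close> for \<open>0 \<le> i < l\<close>. The power of \<open>q r\<close> comes from the argument
  of \<open>K\<^sub>0\<^sup>\<plusminus>(z) = \<rho> \<circ> K\<^sub>1\<^sup>\<plusminus>(q r z) \<circ> \<rho>\<^sup>-\<^sup>1\<close>.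
\<close>

definition K_coeff :: "nat \<Rightarrow> nat \<Rightarrow> nat \<Rightarrow> sgn_pm \<Rightarrow> nat \<Rightarrow> tensor set \<Rightarrow> tensor set" where
  "K_coeff N l i \<epsilon> n X =
     (if i = 0 then
        rho N l (scale_W N l ((q_par * r_par) powi (case \<epsilon> of Plus \<Rightarrow> - int n | Minus \<Rightarrow> int n))
          (K_finite N l 1 \<epsilon> n (inv_into (wedge N l) (rho N l) X)))
      else K_finite N l i \<epsilon> n X)"

definition simultaneous_K_eigenvector :: "nat \<Rightarrow> nat \<Rightarrow> tensor set \<Rightarrow> bool" where
  "simultaneous_K_eigenvector N l X \<longleftrightarrow>
     X \<in> wedge N l \<and> X \<noteq> hecke_rel N l \<and>
     (\<forall>i<l. \<forall>\<epsilon> n. \<exists>c. K_coeff N l i \<epsilon> n X = scale_W N l c X)"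

section \<open>Index sets\<close>

definition Z_plus :: "nat \<Rightarrow> nat \<Rightarrow> int \<Rightarrow> int \<Rightarrow> (nat \<Rightarrow> int) set" where
  "Z_plus N l c \<gamma> = {k.
     (\<forall>a\<in>{1..N}. \<forall>b\<in>{1..N}. a < b \<longrightarrow> k a > k b) \<and>
     (\<forall>a\<in>{1..N}. m_part l (k a) \<le> m_part l (c - int a)) \<and>
     (\<Sum>a\<in>{1..N}. m_part l (c - int a) - m_part l (k a)) = \<gamma>}"

section \<open>Nonsymmetric Macdonald polynomials and the vectors \<open>\<Psi>\<close>\<close>

text \<open>\<open>bruhat_step N x y\<close> is one of the generating relations \<open>x \<prec> y\<close> of the Bruhat order.\<close>

inductive bruhat_step :: "nat \<Rightarrow> (nat \<Rightarrow> int) \<Rightarrow> (nat \<Rightarrow> int) \<Rightarrow> bool" for N where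
  exchange: "1 \<le> i \<Longrightarrow> i < j \<Longrightarrow> j \<le> N \<Longrightarrow> x i > x j \<Longrightarrow>
     bruhat_step N (x \<circ> transpose i j) x"
| squeeze: "1 \<le> i \<Longrightarrow> i < j \<Longrightarrow> j \<le> N \<Longrightarrow> x i - x j > 1 \<Longrightarrow>
     bruhat_step N (x(i := x i - 1, j := x j + 1)) (x \<circ> transpose i j)"

definition bruhat_less :: "nat \<Rightarrow> (nat \<Rightarrow> int) \<Rightarrow> (nat \<Rightarrow> int) \<Rightarrow> bool" where
  "bruhat_less N = (bruhat_step N)\<^sup>+\<^sup>+"

definition sigma_rank :: "nat \<Rightarrow> (nat \<Rightarrow> int) \<Rightarrow> nat \<Rightarrow> nat" where
  "sigma_rank N m a =
     card {b \<in> {1..N}. b \<le> a \<and> m b \<ge> m a} + card {b \<in> {1..N}. b > a \<and> m b > m a}"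

definition zeta :: "nat \<Rightarrow> nat \<Rightarrow> (nat \<Rightarrow> int) \<Rightarrow> nat \<Rightarrow> coef" where
  "zeta N l m a =
     p_par l powi (m a) * q_par powi (2 * int (sigma_rank N m a) - int N - 1)"

definition macdonald :: "nat \<Rightarrow> nat \<Rightarrow> (nat \<Rightarrow> int) \<Rightarrow> laurent" where
  "macdonald N l m = (THE f.
     f \<in> laurent_polys N \<and>
     Poly_Mapping.keys (f - z_monom N m) \<subseteq> exponent N ` {n. bruhat_less N n m} \<and>
     (\<forall>a\<in>{1..N}. Y_N N l a f = const_L (zeta N l m a) * f))"

definition sort_perm :: "nat \<Rightarrow> nat \<Rightarrow> (nat \<Rightarrow> int) \<Rightarrow> nat \<Rightarrow> nat" where
  "sort_perm N l k = (THE \<tau>. \<tau> permutes {1..N} \<and>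
     mono_on {1..N} (\<lambda>a. j_part l (k (\<tau> a))) \<and>
     (\<forall>a\<in>{1..N}. \<forall>b\<in>{1..N}. a < b \<and> j_part l (k (\<tau> a)) = j_part l (k (\<tau> b)) \<longrightarrow>
        m_part l (k (\<tau> a)) < m_part l (k (\<tau> b))))"

definition Psi :: "nat \<Rightarrow> nat \<Rightarrow> (nat \<Rightarrow> int) \<Rightarrow> tensor set" where
  "Psi N l k =
     (let \<tau> = sort_perm N l k
      in wtens N l (macdonald N l (\<lambda>a. m_part l (k (\<tau> a)))) (\<lambda>a. j_part l (k (\<tau> a))))"

end

theory Submission
  imports Defs
begin

text \<open>The vector \<open>\<Psi>\<close> is the class of a sorted tensor: its letters are non-decreasing, and its coefficient is a
Macdonald polynomial, hence a joint eigenvector of the commuting operators \<open>Y\<^sub>a\<close>. On sorted tensors the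
coefficients of \<open>K\<^sub>i\<^sup>\<plusminus>(z)\<close>, \<open>1 \<le> i < l\<close>, act through polynomials in the \<open>Y\<^sub>a\<close> or their inverses, so they act on
\<open>\<Psi>\<close> by scalars. For \<open>i = 0\<close> it suffices that \<open>\<rho>\<^sup>-\<^sup>1 \<Psi>\<close> is, up to a scalar, again the class of a sorted tensor
whose coefficient is a joint eigenvector (\<open>rho_preimage\<close>), because \<open>K\<^sub>1\<^sup>\<plusminus>\<close> acts on it by scalars for the same
reason (\<open>sorted_eigen_K\<close>). The remaining work is to show that the Macdonald polynomials, the operators \<open>K\<^sub>i\<close> and
the automorphism \<open>\<rho>\<close> are determined by their descriptions, and that \<open>\<Psi>\<close> is not zero.

Algebra of the operators. Put \<open>G\<^sub>a = g\<^bsub>a,a+1\<^esub>\<close>; then \<open>T\<^sub>a\<close> acts as \<open>- q G\<^sub>a\<^sup>-\<^sup>1\<close>. The \<open>G\<^sub>a\<close> satisfy quadratic and braid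
relations, \<open>Y\<^bsub>a+1\<^esub> = G\<^sub>a Y\<^sub>a G\<^sub>a\<close>, and \<open>Y\<^sub>1 = G\<^sub>1\<^sup>-\<^sup>1 \<dots> G\<^bsub>N-1\<^esub>\<^sup>-\<^sup>1 w\<close> where \<open>w\<close> rotates the variables and shifts one of
them by \<open>p\<close>. These relations (\<open>hecke_interp\<close>) formally imply that the \<open>Y\<^sub>a\<close> commute, that symmetric functions of
\<open>Y\<^sub>a\<close> and \<open>Y\<^bsub>a+1\<^esub>\<close> commute with \<open>G\<^sub>a\<close>, and that \<open>z\<^sub>1\<^sup>-\<^sup>1 G\<^sub>1 \<dots> G\<^bsub>N-1\<^esub>\<close> permutes the \<open>Y\<^sub>a\<close> cyclically up to a power of
\<open>p\<close> (\<open>affine_hecke_cyclic\<close>).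

Macdonald polynomials. Each factor \<open>g\<^sub>a\<^sub>b\<^sup>-\<^sup>1 \<sigma>\<^sub>a\<^sub>b\<close> and \<open>\<sigma>\<^sub>a\<^sub>b g\<^sub>a\<^sub>b\<close>, \<open>a < b\<close>, is triangular for the Bruhat order on monomials,
and the product of the diagonal entries is \<open>\<zeta>\<close> (\<open>tri_Yop\<close>). Since \<open>\<zeta>\<close> separates exponents, a product of factors
\<open>Y\<^sub>a - \<zeta>\<^sub>a(n)\<close> annihilates any given finite set of lower terms. Applied to \<open>z\<^sup>m\<close> it yields the eigenvector, and applied
to the difference of two candidates it shows uniqueness (\<open>macdonald_unique_existence\<close>).

The wedge space. The image of \<open>T\<^sub>a - q\<^sup>2\<close> consists exactly of the polynomials symmetric in \<open>z\<^sub>a, z\<^bsub>a+1\<^esub>\<close>. Hence the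
Hecke relations are generated by tensors with equal letters at \<open>a, a+1\<close> and symmetric coefficient, together with
the rules that exchange a descent (\<open>hecke_rel_presentation\<close>). By the braid relation these exchanges are confluent,
so that every tensor has a straightened form, and straightening maps all relations to relations between sorted
tensors (\<open>Straighten_hecke\<close>). An operator on sorted tensors that commutes with \<open>G\<^sub>a\<close> wherever the letters at \<open>a, a+1\<close>
agree therefore descends to the wedge space, which gives \<open>K\<^sub>i\<close> (\<open>K_finite_eq\<close>). Moreover, an ordinary alternating sum
of coefficients over the stabilizer of the letters vanishes on the relations, whereas it is \<open>1\<close> on the Macdonald
polynomial: its exponent is increasing on each block of equal letters, so that no other exponent of its orbit is
lower (\<open>alt_leading\<close>). This shows \<open>\<Psi> \<noteq> 0\<close>.

The automorphism \<open>\<rho>\<close>. It is induced by lowering all letters, where a letter \<open>0\<close> at \<open>a\<close> becomes \<open>l - 1\<close> with a factor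
\<open>z\<^sub>a\<close>; the presentation of the relations makes it easy to check that this is compatible with them (\<open>rho_eq\<close>). If \<open>b\<close>
letters of \<open>\<Psi>\<close> equal \<open>l - 1\<close>, then moving them to the front costs operators that combine with the factors \<open>z\<^sub>a\<^sup>-\<^sup>1\<close>
to the \<open>b\<close>-th power of the cyclic element above (\<open>rotate\<close>), and this power maps joint eigenvectors of the \<open>Y\<^sub>a\<close>
to joint eigenvectors.\<close>

abbreviation "single \<equiv> Poly_Mapping.single"
abbreviation "lookup \<equiv> Poly_Mapping.lookup"
abbreviation "keys \<equiv> Poly_Mapping.keys"
abbreviation "map_key \<equiv> Poly_Mapping.map_key"

section \<open>The coefficient field\<close>

lemma Fract_power: "Fract a 1 ^ n = Fract (a ^ n) (1 :: 'a :: idom)"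
  by (induction n) (auto simp: One_fract_def)

lemma s_half_t_half_power:
  "s_half ^ i * t_half ^ j = Fract (monom (monom 1 i) j) 1"
proof -
  have "[:[:0, 1:]:] ^ i * [:0, 1:] ^ j = monom (monom (1::complex) i) j"
    by (simp add: monom_altdef poly_const_pow)
  then show ?thesis
    by (simp add: s_half_def t_half_def Fract_power)
qed

lemma s_half_neq_0 [simp]: "s_half \<noteq> 0" and t_half_neq_0 [simp]: "t_half \<noteq> 0"
  by (simp_all add: s_half_def t_half_def eq_fract Zero_fract_def)

lemma monomials_distinct_nat:
  assumes "s_half ^ i * t_half ^ j = s_half ^ i' * t_half ^ j'"
  shows "i = i' \<and> j = j'"
proof -
  have "monom (monom (1::complex) i) j = monom (monom 1 i') j'"
    using assms by (simp add: s_half_t_half_power eq_fract)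
  then show ?thesis
    by (metis degree_monom_eq lead_coeff_monom monom_eq_0_iff zero_neq_one)
qed

text \<open>Negative exponents are removed by multiplying with a common power, so that the claim becomes one about monomials of a
polynomial ring.\<close>

lemma half_monomials_distinct:
  assumes "s_half powi i * t_half powi j = s_half powi i' * t_half powi j'"
  shows "i = i' \<and> j = j'"
proof -
  define n where "n = \<bar>i\<bar> + \<bar>j\<bar> + \<bar>i'\<bar> + \<bar>j'\<bar>"
  have shift: "s_half powi (x + n) * t_half powi (y + n) = s_half ^ nat (x + n) * t_half ^ nat (y + n)"
    if "x + n \<ge> 0" "y + n \<ge> 0" for x y
    using that by (simp add: power_int_def)
  have nonneg: "i + n \<ge> 0" "j + n \<ge> 0" "i' + n \<ge> 0" "j' + n \<ge> 0"
    by (auto simp: n_def)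
  have "s_half powi (i + n) * t_half powi (j + n) = s_half powi n * t_half powi n * (s_half powi i * t_half powi j)"
    for i j by (simp only: power_int_add s_half_neq_0 t_half_neq_0 simp_thms) (simp only: mult_ac)
  then have "s_half powi (i + n) * t_half powi (j + n) = s_half powi (i' + n) * t_half powi (j' + n)"
    using assms by metis
  then have "nat (i + n) = nat (i' + n) \<and> nat (j + n) = nat (j' + n)"
    using shift nonneg monomials_distinct_nat by metis
  then show ?thesis using nonneg by auto
qed

lemma q_par_neq_0 [simp]: "q_par \<noteq> 0" by (simp add: q_par_def)
lemma r_par_neq_0 [simp]: "r_par \<noteq> 0" by (simp add: r_par_def)
lemma p_par_neq_0 [simp]: "p_par l \<noteq> 0" by (simp add: p_par_def)

lemma one_plus_q2_neq_0: "1 + q_par ^ 2 \<noteq> 0"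
proof
  assume "1 + q_par ^ 2 = 0"
  then have "q_par ^ 2 = - 1" by (simp add: add_eq_0_iff)
  then have "q_par ^ 4 = 1"
    by (metis (no_types) power2_minus one_power2 power_mult num_double numeral_times_numeral)
  then have "s_half ^ 4 * t_half ^ 4 = s_half ^ 0 * t_half ^ 0"
    by (simp add: q_par_def power_mult_distrib)
  then show False using monomials_distinct_nat by fastforce
qed

lemma two_neq_0_coef: "(2 :: coef) \<noteq> 0"
proof -
  have "(2 :: coef) = Fract 2 1"
    by (metis One_fract_def add_fract mult_1 numeral_One one_add_one zero_neq_one)
  moreover have "Fract (2 :: complex poly poly) 1 \<noteq> Fract 0 1"
    by (subst eq_fract(1)) simp_all
  ultimately show ?thesis by (simp only: Zero_fract_def) simp
qed

lemma p_q_monomial: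
  "p_par l powi m * q_par powi e = s_half powi e * t_half powi (2 * int l * m + e)"
proof -
  have "p_par l = t_half powi (2 * int l)"
    by (simp add: p_par_def power_int_def nat_mult_distrib power_mult)
  then have "p_par l powi m = t_half powi (2 * int l * m)"
    by (simp add: power_int_mult)
  then show ?thesis
    by (simp add: q_par_def power_int_mult_distrib power_int_add)
qed

text \<open>The exponent of \<open>s\<^sup>1\<^sup>/\<^sup>2\<close> in \<open>p\<^sup>m q\<^sup>e\<close> is \<open>e\<close>, which leaves \<open>2 l m\<close> for that of \<open>t\<^sup>1\<^sup>/\<^sup>2\<close>. This is what separates the
eigenvalues of the Cherednik operators.\<close>

lemma p_q_monomials_distinct:
  assumes "l > 0" "p_par l powi m * q_par powi e = p_par l powi m' * q_par powi e'"
  shows "m = m'"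
  using half_monomials_distinct[OF assms(2)[unfolded p_q_monomial]] assms(1) by auto

section \<open>Linear extension from monomials\<close>

lemma poly_mapping_single_induct [case_names single add]:
  fixes x :: "'i \<Rightarrow>\<^sub>0 'v :: comm_monoid_add"
  assumes single: "\<And>i a. P (single i a)"
    and add: "\<And>x y. P x \<Longrightarrow> P y \<Longrightarrow> P (x + y)"
  shows "P x"
proof -
  have "P (\<Sum>i\<in>A. single i (lookup x i))" if "finite A" for A
    using that
  proof induction
    case empty
    show ?case using single[of undefined 0] by simp
  qed (simp add: add single)
  moreover have "x = (\<Sum>i\<in>keys x. single i (lookup x i))"
    by (rule poly_mapping_eqI)
      (simp add: lookup_sum lookup_single when_def sum.delta' in_keys_iff)
  ultimately show ?thesis by (metis finite_keys)
qed

lemma additive_eqI: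
  fixes \<phi> \<psi> :: "('i \<Rightarrow>\<^sub>0 'v :: comm_monoid_add) \<Rightarrow> 'w :: comm_monoid_add"
  assumes "\<And>x y. \<phi> (x + y) = \<phi> x + \<phi> y" "\<And>x y. \<psi> (x + y) = \<psi> x + \<psi> y"
    and "\<And>i a. \<phi> (single i a) = \<psi> (single i a)"
  shows "\<phi> x = \<psi> x"
  by (induction x rule: poly_mapping_single_induct) (simp_all add: assms)

definition lin_ext :: "('i \<Rightarrow> 'v \<Rightarrow> 'w) \<Rightarrow> ('i \<Rightarrow>\<^sub>0 'v :: comm_monoid_add) \<Rightarrow> 'w :: comm_monoid_add" where
  "lin_ext F x = (\<Sum>i\<in>keys x. F i (lookup x i))"

lemma lin_ext_add:
  assumes "\<And>i. F i 0 = 0" "\<And>i a b. F i (a + b) = F i a + F i b"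
  shows "lin_ext F (x + y) = lin_ext F x + lin_ext F y"
  unfolding lin_ext_def by (rule setsum_keys_plus_distrib) (simp_all add: assms)

lemma lin_ext_single [simp]: "F i 0 = 0 \<Longrightarrow> lin_ext F (single i a) = F i a"
  by (simp add: lin_ext_def)

lemma const_L_simps [simp]:
  "const_L 0 = 0" "const_L 1 = 1"
  by (simp_all add: const_L_def)

lemma const_L_add: "const_L (a + b) = const_L a + const_L b"
  and const_L_diff: "const_L (a - b) = const_L a - const_L b"
  and const_L_uminus: "const_L (- a) = - const_L a"
  and const_L_mult: "const_L (a * b) = const_L a * const_L b"
  by (simp_all add: const_L_def single_add single_diff single_uminus mult_single)

lemma const_L_times_single: "const_L c * single e d = single e (c * d)"
  by (simp add: const_L_def mult_single)

lemma lookup_const_L_times: "lookup (const_L c * f) e = c * lookup f e"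
proof -
  have "const_L c * f = Poly_Mapping.map ((*) c) f"
    by (simp add: const_L_def mult_map_scale_conv_mult)
  then show ?thesis by (simp add: map.rep_eq when_def)
qed

lemma const_L_eq_0_iff [simp]: "const_L c = 0 \<longleftrightarrow> c = 0"
  by (metis const_L_simps(1) const_L_def lookup_single_eq)

section \<open>The ring of linear operators\<close>

text \<open>Operators on Laurent polynomials form a ring under composition. Working in this ring, the relations between the
Cherednik operators become computations with words in a noncommutative ring, and powers and power series of operators
come from the library.\<close>

typedef lop = "{F :: laurent \<Rightarrow> laurent. (\<forall>x y. F (x + y) = F x + F y) \<and> (\<forall>c x. F (const_L c * x) = const_L c * F x)}"
  morphisms app Lop
  by (rule exI[of _ id]) simp

setup_lifting type_definition_lop

instantiation lop :: ring_1
begin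
lift_definition zero_lop :: lop is "\<lambda>_. 0" by simp
lift_definition one_lop :: lop is "\<lambda>x. x" by simp
lift_definition plus_lop :: "lop \<Rightarrow> lop \<Rightarrow> lop" is "\<lambda>F G x. F x + G x" by (simp add: algebra_simps)
lift_definition minus_lop :: "lop \<Rightarrow> lop \<Rightarrow> lop" is "\<lambda>F G x. F x - G x" by (simp add: algebra_simps)
lift_definition uminus_lop :: "lop \<Rightarrow> lop" is "\<lambda>F x. - F x" by (simp add: algebra_simps)
lift_definition times_lop :: "lop \<Rightarrow> lop \<Rightarrow> lop" is "\<lambda>F G x. F (G x)" by simp
instance
proof
  show "(0 :: lop) \<noteq> 1" by transfer (metis one_neq_zero)
qed (transfer; simp add: algebra_simps)+
end

lemma app_zero [simp]: "app 0 x = 0" by transfer simp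
lemma app_one [simp]: "app 1 x = x" by transfer simp
lemma app_plus [simp]: "app (F + G) x = app F x + app G x" by transfer simp
lemma app_minus [simp]: "app (F - G) x = app F x - app G x" by transfer simp
lemma app_uminus [simp]: "app (- F) x = - app F x" by transfer simp
lemma app_times [simp]: "app (F * G) x = app F (app G x)" by transfer simp
lemma app_add [simp]: "app F (x + y) = app F x + app F y" by transfer simp
lemma app_const [simp]: "app F (const_L c * x) = const_L c * app F x" by transfer simp
lemma app_0 [simp]: "app F 0 = 0" using app_const[of F 0 0] by simp
lemma app_neg [simp]: "app F (- x) = - app F x"
  using app_add[of F x "- x"] by (simp add: eq_neg_iff_add_eq_0 add.commute)
lemma app_diff [simp]: "app F (x - y) = app F x - app F y"
  using app_add[of F x "- y"] by simp
lemma app_sum: "app F (sum f A) = (\<Sum>i\<in>A. app F (f i))"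
  by (induction A rule: infinite_finite_induct) auto
lemma app_sum_left: "app (sum F A) x = (\<Sum>i\<in>A. app (F i) x)"
  by (induction A rule: infinite_finite_induct) auto
lemma app_power: "app (F ^ n) x = (app F ^^ n) x"
  by (induction n arbitrary: x) (simp_all add: funpow_swap1 power_Suc2 del: power_Suc)
lemma lop_eqI: "(\<And>x. app F x = app G x) \<Longrightarrow> F = G" by transfer (simp add: fun_eq_iff)
lemma app_comp: "app (F * G) = app F \<circ> app G" by (simp add: fun_eq_iff)

lemma app_Lop:
  assumes "\<And>x y. F (x + y) = F x + F y" "\<And>c x. F (const_L c * x) = const_L c * F x"
  shows "app (Lop F) = F"
  using assms by (simp add: Lop_inverse)

lemma lop_eq_on_singles:
  assumes "\<And>e. app F (single e 1) = app G (single e 1)"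
  shows "F = G"
proof (rule lop_eqI, rule additive_eqI[where \<phi> = "app F" and \<psi> = "app G"])
  show "app F (single e c) = app G (single e c)" for e c
    using assms[of e] app_const[of F c "single e 1"] app_const[of G c "single e 1"]
    by (simp add: const_L_times_single)
qed simp_all

definition mulop :: "laurent \<Rightarrow> lop" where
  "mulop h = Lop ((*) h)"

lemma app_mulop [simp]: "app (mulop h) f = h * f"
  unfolding mulop_def by (subst app_Lop) (simp_all add: algebra_simps)

lemma mulop_mult: "mulop (f * g) = mulop f * mulop g"
  and mulop_1 [simp]: "mulop 1 = 1"
  and mulop_0 [simp]: "mulop 0 = 0"
  and mulop_add: "mulop (f + g) = mulop f + mulop g"
  and mulop_diff: "mulop (f - g) = mulop f - mulop g"
  by (rule lop_eqI; simp add: algebra_simps)+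

abbreviation scal :: "coef \<Rightarrow> lop" where "scal c \<equiv> mulop (const_L c)"

lemma scal_commute: "scal c * F = F * scal c"
  by (rule lop_eqI) simp

lemma scal_simps [simp]: "scal a * scal b = scal (a * b)" "scal a + scal b = scal (a + b)"
    "scal a - scal b = scal (a - b)"
  by (simp_all add: const_L_mult const_L_add const_L_diff mulop_mult mulop_add mulop_diff)

section \<open>Monomial substitutions\<close>

definition alg_hom :: "lop \<Rightarrow> bool" where
  "alg_hom \<phi> \<longleftrightarrow> app \<phi> 1 = 1 \<and> (\<forall>f g. app \<phi> (f * g) = app \<phi> f * app \<phi> g)"

lemma alg_hom_mult: "alg_hom \<phi> \<Longrightarrow> app \<phi> (f * g) = app \<phi> f * app \<phi> g"
  by (simp add: alg_hom_def)

lemma alg_hom_const: "alg_hom \<phi> \<Longrightarrow> app \<phi> (const_L c) = const_L c"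
  using app_const[of \<phi> c 1] by (simp add: alg_hom_def)

lemma alg_hom_mulop: "alg_hom \<phi> \<Longrightarrow> \<phi> * mulop f = mulop (app \<phi> f) * \<phi>"
  by (rule lop_eqI) (simp add: alg_hom_mult)

lemma alg_hom_comp: "alg_hom \<phi> \<Longrightarrow> alg_hom \<psi> \<Longrightarrow> alg_hom (\<phi> * \<psi>)"
  by (simp add: alg_hom_def)

lemma alg_hom_one: "alg_hom 1"
  by (simp add: alg_hom_def)

definition msub :: "((nat \<Rightarrow>\<^sub>0 int) \<Rightarrow> (nat \<Rightarrow>\<^sub>0 int)) \<Rightarrow> ((nat \<Rightarrow>\<^sub>0 int) \<Rightarrow> coef) \<Rightarrow> laurent \<Rightarrow> laurent" where
  "msub \<pi> \<chi> = lin_ext (\<lambda>e c. single (\<pi> e) (\<chi> e * c))"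

lemma msub_add: "msub \<pi> \<chi> (f + g) = msub \<pi> \<chi> f + msub \<pi> \<chi> g"
  unfolding msub_def by (rule lin_ext_add) (simp_all add: algebra_simps single_add)

lemma msub_single: "msub \<pi> \<chi> (single e c) = single (\<pi> e) (\<chi> e * c)"
  by (simp add: msub_def)

lemma msub_const: "msub \<pi> \<chi> (const_L c * f) = const_L c * msub \<pi> \<chi> f"
  by (rule additive_eqI[where \<phi> = "\<lambda>f. msub \<pi> \<chi> (const_L c * f)" and \<psi> = "\<lambda>f. const_L c * msub \<pi> \<chi> f"])
    (simp_all add: msub_add distrib_left const_L_times_single msub_single mult_ac)

definition subop :: "((nat \<Rightarrow>\<^sub>0 int) \<Rightarrow> (nat \<Rightarrow>\<^sub>0 int)) \<Rightarrow> ((nat \<Rightarrow>\<^sub>0 int) \<Rightarrow> coef) \<Rightarrow> lop" where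
  "subop \<pi> \<chi> = Lop (msub \<pi> \<chi>)"

lemma app_subop: "app (subop \<pi> \<chi>) = msub \<pi> \<chi>"
  unfolding subop_def by (rule app_Lop) (simp_all add: msub_add msub_const)

lemma subop_single [simp]: "app (subop \<pi> \<chi>) (single e c) = single (\<pi> e) (\<chi> e * c)"
  by (simp add: app_subop msub_single)

text \<open>Swapping variables and rescaling a variable are both substitutions of monomials, \<open>\<chi>\<close> being the scalar picked up.\<close>

lemma alg_hom_subop:
  assumes "\<And>e e'. \<pi> (e + e') = \<pi> e + \<pi> e'" "\<And>e e'. \<chi> (e + e') = \<chi> e * \<chi> e'" "\<pi> 0 = 0" "\<chi> 0 = 1"
  shows "alg_hom (subop \<pi> \<chi>)"
proof -
  have ss: "app (subop \<pi> \<chi>) (single e c * g) = app (subop \<pi> \<chi>) (single e c) * app (subop \<pi> \<chi>) g" for e c g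
    by (rule additive_eqI[where \<phi> = "\<lambda>g. app (subop \<pi> \<chi>) (single e c * g)"
          and \<psi> = "\<lambda>g. app (subop \<pi> \<chi>) (single e c) * app (subop \<pi> \<chi>) g"])
      (simp_all add: distrib_left distrib_right mult_single assms mult_ac)
  have "app (subop \<pi> \<chi>) (f * g) = app (subop \<pi> \<chi>) f * app (subop \<pi> \<chi>) g" for f g
    by (rule additive_eqI[where \<phi> = "\<lambda>f. app (subop \<pi> \<chi>) (f * g)"
          and \<psi> = "\<lambda>f. app (subop \<pi> \<chi>) f * app (subop \<pi> \<chi>) g"])
      (simp_all only: distrib_right app_add ss)
  moreover have "app (subop \<pi> \<chi>) (single 0 1) = single 0 1"
    using assms by (simp only: subop_single) simp
  ultimately show ?thesis by (simp add: alg_hom_def)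
qed

definition swp :: "nat \<Rightarrow> nat \<Rightarrow> lop" where
  "swp a b = subop (map_key (transpose a b)) (\<lambda>_. 1)"

definition psh :: "nat \<Rightarrow> nat \<Rightarrow> lop" where
  "psh l a = subop id (\<lambda>e. p_par l powi (lookup e a))"

definition pshi :: "nat \<Rightarrow> nat \<Rightarrow> lop" where
  "pshi l a = subop id (\<lambda>e. p_par l powi (- lookup e a))"

lemma app_swp: "app (swp a b) = swap_z a b"
  by (simp add: fun_eq_iff swp_def app_subop msub_def lin_ext_def swap_z_def)

lemma app_psh: "app (psh l a) = p_shift l a"
  by (simp add: fun_eq_iff psh_def app_subop msub_def lin_ext_def p_shift_def)

lemma lookup_map_key_transpose [simp]:
  "lookup (map_key (transpose a b) e) x = lookup e (transpose a b x)"
  by (simp add: map_key.rep_eq)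

lemma map_key_transpose_twice [simp]:
  "map_key (transpose a b) (map_key (transpose a b) e) = e"
  by (rule poly_mapping_eqI) simp

lemma map_key_transpose_single [simp]:
  "map_key (transpose a b) (single c x) = single (transpose a b c) x"
  by (rule poly_mapping_eqI) (auto simp: lookup_single when_def transpose_def)

lemma alg_hom_swp: "alg_hom (swp a b)"
  unfolding swp_def by (rule alg_hom_subop) (auto intro!: poly_mapping_eqI simp: lookup_add)

lemma alg_hom_psh: "alg_hom (psh l a)"
  unfolding psh_def by (rule alg_hom_subop) (auto simp: lookup_add power_int_add)

lemma psh_pshi: "psh l a * pshi l a = 1" and pshi_psh: "pshi l a * psh l a = 1"
  by (rule lop_eq_on_singles; simp add: psh_def pshi_def power_int_minus)+

lemma swp_var [simp]: "app (swp a b) (var_z c) = var_z (transpose a b c)"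
  by (simp add: swp_def var_z_def)

lemma psh_var: "app (psh l a) (var_z b) = const_L (if a = b then p_par l else 1) * var_z b"
  by (simp add: psh_def var_z_def const_L_times_single lookup_single when_def)

lemma swp_swp: "swp a b * swp a b = 1"
  by (rule lop_eq_on_singles) (simp add: swp_def)

lemma swp_swp_app [simp]: "app (swp a b) (app (swp a b) f) = f"
  by (metis swp_swp app_times app_one)

text \<open>All conjugations by a swap are instances of the same identity between transpositions.\<close>

lemma swp_conj: "swp a b * swp c d = swp (transpose a b c) (transpose a b d) * swp a b"
proof -
  have "transpose c d (transpose a b x) = transpose a b (transpose (transpose a b c) (transpose a b d) x)" for x
    by (auto simp: transpose_def)
  then show ?thesis
    by (intro lop_eq_on_singles)
      (simp add: swp_def, intro arg_cong2[of _ _ _ _ single] poly_mapping_eqI refl, simp)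
qed

lemma swp_psh: "swp a b * psh l c = psh l (transpose a b c) * swp a b"
  by (rule lop_eq_on_singles) (simp add: swp_def psh_def)

section \<open>Divided differences\<close>

definition zinv :: "nat \<Rightarrow> laurent" where
  "zinv a = single (single a (-1)) 1"

lemma var_zinv [simp]: "var_z a * zinv a = 1" "zinv a * var_z a = 1"
  by (simp_all add: var_z_def zinv_def mult_single flip: single_add)

lemma var_z_diff_neq_0: "a \<noteq> b \<Longrightarrow> var_z a - var_z b \<noteq> 0"
  by (simp add: var_z_def) (metis lookup_single_eq lookup_single_not_eq zero_neq_one)

text \<open>The monomial \<open>z\<^sub>b / z\<^sub>a\<close>. A swap multiplies a monomial by a power of it, so that divided differences become geometric
sums.\<close>

definition uab :: "nat \<Rightarrow> nat \<Rightarrow> laurent" where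
  "uab a b = zinv a * var_z b"

lemma uab_power: "uab a b ^ n = single (single b (int n) - single a (int n)) 1"
proof (induction n)
  case (Suc n)
  then show ?case
    by (simp add: uab_def zinv_def var_z_def mult_single)
      (intro arg_cong2[of _ _ _ _ single] poly_mapping_eqI refl;
        simp add: lookup_add lookup_minus lookup_single when_def)
qed simp

lemma swp_monomial:
  assumes "a \<noteq> b" "lookup e a \<ge> lookup e b"
  shows "app (swp a b) (single e 1) =
     single e 1 * uab a b ^ nat (lookup e a - lookup e b)"
proof -
  have "map_key (transpose a b) e =
     e + (single b (int (nat (lookup e a - lookup e b)))
        - single a (int (nat (lookup e a - lookup e b))))"
    by (rule poly_mapping_eqI)
      (use assms in \<open>simp add: lookup_add lookup_minus lookup_single when_def transpose_def split: if_split\<close>)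
  then show ?thesis
    by (simp add: swp_def uab_power mult_single)
qed

text \<open>The divided difference of a monomial. The two cases differ by exchanging the roles of the monomial and its image
under the swap, which changes the sign of the difference.\<close>

definition ddmon :: "nat \<Rightarrow> nat \<Rightarrow> (nat \<Rightarrow>\<^sub>0 int) \<Rightarrow> laurent" where
  "ddmon a b e = (let x = lookup e a; y = lookup e b; M = single e 1 in
     if y \<le> x then - (M * zinv a * (\<Sum>i<nat (x - y). uab a b ^ i))
     else app (swp a b) M * zinv a * (\<Sum>i<nat (y - x). uab a b ^ i))"

lemma telescope_uab: "(var_z a - var_z b) * (M * zinv a * (\<Sum>i<n. uab a b ^ i)) = M - M * uab a b ^ n"
proof -
  have "(var_z a - var_z b) * (M * zinv a * S) = M * ((1 - uab a b) * S)" for S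
    using var_zinv(1)[of a] unfolding uab_def by algebra
  moreover have "(1 - uab a b) * (\<Sum>i<n. uab a b ^ i) = 1 - uab a b ^ n"
    by (rule one_diff_power_eq[symmetric])
  ultimately show ?thesis
    by (simp only: right_diff_distrib mult_1_right)
qed

lemma ddmon: "a \<noteq> b \<Longrightarrow> (var_z a - var_z b) * ddmon a b e = app (swp a b) (single e 1) - single e 1"
proof (cases "lookup e b \<le> lookup e a")
  case True
  assume "a \<noteq> b"
  with True show ?thesis
    by (simp add: ddmon_def swp_monomial telescope_uab del: minus_mult_right flip: minus_mult_right)
next
  case False
  assume ab: "a \<noteq> b"
  define e' where "e' = map_key (transpose a b) e"
  have M': "app (swp a b) (single e 1) = single e' 1"
    by (simp add: swp_def e'_def)
  then have "app (swp a b) (single e' 1) = single e 1"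
    by (metis swp_swp_app)
  moreover have "lookup e' a = lookup e b" "lookup e' b = lookup e a"
    by (simp_all add: e'_def)
  ultimately show ?thesis
    using False swp_monomial[of a b e'] ab by (simp add: ddmon_def M' telescope_uab)
qed

lemma div_diff_exists:
  assumes "a \<noteq> b"
  shows "\<exists>h. (var_z a - var_z b) * h = swap_z a b f - f"
proof (induction f rule: poly_mapping_single_induct)
  case (single e c)
  have "(var_z a - var_z b) * (const_L c * ddmon a b e) = const_L c * (app (swp a b) (single e 1) - single e 1)"
    using ddmon[OF assms, of e] by (simp add: mult.left_commute)
  also have "\<dots> = app (swp a b) (const_L c * single e 1) - const_L c * single e 1"
    by (simp only: app_const right_diff_distrib)
  also have "const_L c * single e 1 = single e c"
    by (simp add: const_L_times_single)
  finally show ?case unfolding app_swp by blast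
next
  case (add f g)
  then obtain h k where "(var_z a - var_z b) * h = swap_z a b f - f" "(var_z a - var_z b) * k = swap_z a b g - g"
    by blast
  then have "(var_z a - var_z b) * (h + k) = swap_z a b (f + g) - (f + g)"
    by (simp add: distrib_left flip: app_swp)
  then show ?case by blast
qed

lemma div_diff: "a \<noteq> b \<Longrightarrow> (var_z a - var_z b) * div_diff a b f = swap_z a b f - f"
  unfolding div_diff_def
  by (rule theI') (use div_diff_exists var_z_diff_neq_0 mult_left_cancel in metis)

lemma div_diff_eqI: "a \<noteq> b \<Longrightarrow> (var_z a - var_z b) * h = swap_z a b f - f \<Longrightarrow> div_diff a b f = h"
  using div_diff var_z_diff_neq_0 mult_left_cancel by metis

section \<open>The operators g\<close>

definition gop :: "nat \<Rightarrow> nat \<Rightarrow> lop" where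
  "gop a b = Lop (g_op a b)"

abbreviation "QL \<equiv> const_L q_par"
abbreviation "RL \<equiv> const_L (inverse q_par)"

lemma QL_RL [simp]: "QL * RL = 1" "RL * QL = 1" by (simp_all flip: const_L_mult)

lemma g_op_clear:
  assumes "a \<noteq> b"
  shows "(var_z a - var_z b) * g_op a b f
     = (QL - RL) * var_z a * f + (RL * var_z a - QL * var_z b) * swap_z a b f"
  using div_diff[OF assms, of f] unfolding g_op_def by algebra

lemma app_gop: assumes "a \<noteq> b" shows "app (gop a b) = g_op a b"
  unfolding gop_def
proof (rule app_Lop)
  have "(var_z a - var_z b) * g_op a b (x + y) = (var_z a - var_z b) * (g_op a b x + g_op a b y)" for x y
    by (simp add: g_op_clear assms distrib_left flip: app_swp)
  then show "g_op a b (x + y) = g_op a b x + g_op a b y" for x y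
    using var_z_diff_neq_0[OF assms] by simp
  have "(var_z a - var_z b) * g_op a b (const_L c * x) = (var_z a - var_z b) * (const_L c * g_op a b x)" for c x
    by (simp add: g_op_clear assms mult.left_commute[of _ "const_L c"] flip: app_swp) (simp add: algebra_simps)
  then show "g_op a b (const_L c * x) = const_L c * g_op a b x" for c x
    using var_z_diff_neq_0[OF assms] by simp
qed

text \<open>The definition of \<open>g\<close> with the denominator cleared. All identities between such operators are derived from this one
by cancelling \<open>z\<^sub>a - z\<^sub>b\<close> in an integral domain.\<close>

lemma gop_clear:
  assumes "a \<noteq> b"
  shows "(var_z a - var_z b) * app (gop a b) f
     = (QL - RL) * var_z a * f + (RL * var_z a - QL * var_z b) * app (swp a b) f"
  using g_op_clear[OF assms] by (simp add: app_gop[OF assms] app_swp)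

lemma gop_eqI:
  assumes "a \<noteq> b"
    and "(var_z a - var_z b) * h = (QL - RL) * var_z a * f + (RL * var_z a - QL * var_z b) * app (swp a b) f"
  shows "app (gop a b) f = h"
  using assms gop_clear[OF assms(1)] var_z_diff_neq_0[OF assms(1)] mult_left_cancel by metis

definition gin :: "nat \<Rightarrow> nat \<Rightarrow> lop" where
  "gin a b = gop a b - scal (q_par - inverse q_par)"

text \<open>Equivalently \<open>(g - q) (g + q\<^sup>-\<^sup>1) = 0\<close>; the inverse of \<open>g\<close> is therefore the operator \<open>gin\<close>.\<close>

lemma gop_quadratic:
  assumes "a \<noteq> b"
  shows "app (gop a b) (app (gop a b) f) = (QL - RL) * app (gop a b) f + f"
proof (rule gop_eqI[OF assms])
  define F where "F = app (gop a b) f"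
  have 1: "(var_z a - var_z b) * F = (QL - RL) * var_z a * f + (RL * var_z a - QL * var_z b) * app (swp a b) f"
    unfolding F_def by (rule gop_clear[OF assms])
  have 2: "(var_z b - var_z a) * app (swp a b) F = (QL - RL) * var_z b * app (swp a b) f + (RL * var_z b - QL * var_z a) * f"
    using arg_cong[OF 1, of "app (swp a b)"]
    by (simp add: alg_hom_mult[OF alg_hom_swp] alg_hom_const[OF alg_hom_swp])
  have "(var_z a - var_z b) * ((var_z a - var_z b) * ((QL - RL) * F + f))
    = (var_z a - var_z b) * ((QL - RL) * var_z a * F + (RL * var_z a - QL * var_z b) * app (swp a b) F)"
    using 1 2 QL_RL by algebra
  then show "(var_z a - var_z b) * ((QL - RL) * app (gop a b) f + f) = (QL - RL) * var_z a * app (gop a b) f +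
    (RL * var_z a - QL * var_z b) * app (swp a b) (app (gop a b) f)"
    using var_z_diff_neq_0[OF assms] unfolding F_def[symmetric] by simp
qed

lemma gop_gin: "a \<noteq> b \<Longrightarrow> gop a b * gin a b = 1" and gin_gop: "a \<noteq> b \<Longrightarrow> gin a b * gop a b = 1"
  by (rule lop_eqI; simp add: gin_def gop_quadratic flip: const_L_diff)+

lemma gop_var: 
  assumes "a \<noteq> b"
  shows "gop a b * mulop (var_z b) = mulop (var_z a) * gin a b"
proof (rule lop_eqI)
  fix f
  have 1: "(var_z a - var_z b) * app (gop a b) f = (QL - RL) * var_z a * f + (RL * var_z a - QL * var_z b) * app (swp a b) f"
    by (rule gop_clear[OF assms])
  have "app (gop a b) (var_z b * f) = var_z a * (app (gop a b) f - (QL - RL) * f)"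
    by (rule gop_eqI[OF assms], simp add: alg_hom_mult[OF alg_hom_swp]) (use 1 in algebra)
  then show "app (gop a b * mulop (var_z b)) f = app (mulop (var_z a) * gin a b) f"
    by (simp add: gin_def const_L_diff right_diff_distrib)
qed

text \<open>Clearing denominators, a homomorphism that rescales both variables by the same scalar carries one defining equation into
the other. The scalar matters for the rotation, which multiplies a variable by \<open>p\<close>.\<close>

lemma gop_conj:
  assumes "a \<noteq> b" "a' \<noteq> b'" "c \<noteq> 0" and hom: "alg_hom \<phi>"
    and "app \<phi> (var_z a) = const_L c * var_z a'" "app \<phi> (var_z b) = const_L c * var_z b'"
    and "\<phi> * swp a b = swp a' b' * \<phi>"
  shows "\<phi> * gop a b = gop a' b' * \<phi>"
proof (rule lop_eqI)
  fix f
  have sw: "app \<phi> (app (swp a b) f) = app (swp a' b') (app \<phi> f)"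
    using assms(7) by (metis app_times)
  have "const_L c * ((var_z a' - var_z b') * app \<phi> (app (gop a b) f))
     = const_L c * ((QL - RL) * var_z a' * app \<phi> f + (RL * var_z a' - QL * var_z b') * app (swp a' b') (app \<phi> f))"
    using arg_cong[OF gop_clear[OF assms(1), of f], of "app \<phi>"]
    by (simp add: alg_hom_mult[OF hom] alg_hom_const[OF hom] assms sw algebra_simps)
  then have "app (gop a' b') (app \<phi> f) = app \<phi> (app (gop a b) f)"
    using assms(2,3) by (intro gop_eqI) auto
  then show "app (\<phi> * gop a b) f = app (gop a' b' * \<phi>) f" by simp
qed

lemma swp_gop:
  assumes "c \<noteq> d"
  shows "swp a b * gop c d = gop (transpose a b c) (transpose a b d) * swp a b"
  by (rule gop_conj[where c = 1, OF _ _ _ alg_hom_swp _ _ swp_conj]) (use assms in \<open>auto dest: arg_cong[where f = "transpose a b"]\<close>)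

lemma gop_gop_commute:
  assumes "a \<noteq> b" "c \<noteq> d" "{a,b} \<inter> {c,d} = {}"
  shows "gop a b * gop c d = gop c d * gop a b"
proof (rule lop_eqI)
  fix f
  have sw: "app (swp a b) (app (gop c d) f) = app (gop c d) (app (swp a b) f)"
    using swp_gop[OF assms(2), of a b] assms by (metis app_times disjoint_insert(2) insertCI transpose_apply_other)
  have mul: "app (gop c d) (h * f) = h * app (gop c d) f" if "app (swp c d) h = h" for h f
    by (rule gop_eqI[OF assms(2)]) (use gop_clear[OF assms(2), of f] that in \<open>simp add: alg_hom_mult[OF alg_hom_swp], algebra\<close>)
  have t: "transpose c d a = a" "transpose c d b = b"
    using assms(3) by (auto simp: transpose_def)
  have "(var_z a - var_z b) * app (gop c d) (app (gop a b) f) = app (gop c d) ((var_z a - var_z b) * app (gop a b) f)"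
    by (rule mul[symmetric]) (simp add: t)
  also have "\<dots> = app (gop c d) ((QL - RL) * var_z a * f + (RL * var_z a - QL * var_z b) * app (swp a b) f)"
    by (simp add: gop_clear[OF assms(1)])
  also have "\<dots> = (QL - RL) * var_z a * app (gop c d) f + (RL * var_z a - QL * var_z b) * app (gop c d) (app (swp a b) f)"
    by (simp only: app_add, subst (1 2) mul)
      (simp_all add: alg_hom_mult[OF alg_hom_swp] alg_hom_const[OF alg_hom_swp] t)
  finally show "app (gop a b * gop c d) f = app (gop c d * gop a b) f"
    using gop_eqI[OF assms(1)] by (simp add: sw)
qed

text \<open>The polynomial identity behind the braid relation. The hypotheses define the three-fold compositions on both sides
after clearing denominators; \<open>f1, f2, f12, f21, f0\<close> are the images of \<open>f\<close> under the nontrivial permutations. Multiplied by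
all denominators, the two sides have the same coefficients at these images (collected in \<open>W\<close> up to a factor), and only
the coefficient of \<open>f\<close> itself needs a computation.\<close>

lemma clear_denominators_braid:
  fixes x y z :: "'a :: idom"
  assumes ne: "x - y \<noteq> 0" "y - z \<noteq> 0" "x - z \<noteq> 0"
    and a1: "(x-y)*F = (Q-R)*x*f + (R*x - Q*y)*f1"
    and a2: "(y-z)*H = (Q-R)*y*F + (R*y - Q*z)*F2"
    and a3: "(x-y)*K = (Q-R)*x*H + (R*x - Q*y)*H1"
    and a4: "(x-z)*F2 = (Q-R)*x*f2 + (R*x - Q*z)*f21"
    and a5: "(x-z)*H1 = (Q-R)*x*F1 + (R*x - Q*z)*F12"
    and a6: "(y-x)*F1 = (Q-R)*y*f1 + (R*y - Q*x)*f"
    and a7: "(y-z)*F12 = (Q-R)*y*f12 + (R*y - Q*z)*f0"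
    and b1: "(y-z)*F' = (Q-R)*y*f + (R*y - Q*z)*f2"
    and b2: "(x-y)*H' = (Q-R)*x*F' + (R*x - Q*y)*F1'"
    and b3: "(y-z)*K' = (Q-R)*y*H' + (R*y - Q*z)*H2'"
    and b4: "(x-z)*F1' = (Q-R)*x*f1 + (R*x - Q*z)*f12"
    and b5: "(x-z)*H2' = (Q-R)*x*F2' + (R*x - Q*z)*F21'"
    and b6: "(z-y)*F2' = (Q-R)*z*f2 + (R*z - Q*y)*f"
    and b7: "(x-y)*F21' = (Q-R)*x*f21 + (R*x - Q*y)*f0"
  shows "K = K'"
proof -
  define c d e g where "c = Q - R" and "d = x - y" and "e = y - z" and "g = x - z"
  define A B C A' B' where "A = R*x - Q*y" and "B = R*y - Q*z" and "C = R*x - Q*z"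
     and "A' = R*y - Q*x" and "B' = R*z - Q*y"
  note defs = c_def d_def e_def g_def A_def B_def C_def A'_def B'_def
  have F1: "d*F1 = -(c*y*f1 + A'*f)" using a6 unfolding defs by (simp add: algebra_simps)
  have F2': "e*F2' = -(c*z*f2 + B'*f)" using b6 unfolding defs by (simp add: algebra_simps)
  note a = a1[folded defs] a2[folded defs] a3[folded defs] a4[folded defs] a5[folded defs] F1 a7[folded defs]
  note b = b1[folded defs] b2[folded defs] b3[folded defs] b4[folded defs] b5[folded defs] F2' b7[folded defs]
  define W where "W = c*c*x*y*A*f1 + c*c*x*x*B*f2 + c*x*B*C*f21 + c*y*A*C*f12 + A*C*B*f0"
  have 1: "d*e*g*(d*K) = c*x*(d*g*(e*H)) + A*(d*e*(g*H1))"
    unfolding a(3) by (simp add: distrib_left mult_ac)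
  have 2: "d*g*(e*H) = c*y*g*(d*F) + B*d*(g*F2)"
    unfolding a(2) by (simp add: distrib_left mult_ac)
  have 3: "d*e*(g*H1) = c*x*e*(d*F1) + C*d*(e*F12)"
    unfolding a(5) by (simp add: distrib_left mult_ac)
  have 4: "d*e*g*(e*K') = c*y*(e*g*(d*H')) + B*(d*e*(g*H2'))"
    unfolding b(3) by (simp add: distrib_left mult_ac)
  have 5: "e*g*(d*H') = c*x*g*(e*F') + A*e*(g*F1')"
    unfolding b(2) by (simp add: distrib_left mult_ac)
  have 6: "d*e*(g*H2') = c*x*d*(e*F2') + C*e*(d*F21')"
    unfolding b(5) by (simp add: distrib_left mult_ac)
  (* the coefficients of f1 and of f2 agree on both sides by these two linear relations *)
  have g: "g = d + e" and z: "y * g - z * d - x * e = 0" unfolding defs by (simp_all add: algebra_simps)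
  have "d*e*g*(d*K) = d*W + c*c*x*y*A*f1*(g - e - d) + (c*c*c*x*y*x*g - c*x*e*A*A')*f"
    unfolding 1 2 3 a(1) a(4) a(6) a(7) W_def by (simp add: algebra_simps)
  then have X: "d*e*g*(d*K) = d*W + (c*c*c*x*y*x*g - c*x*e*A*A')*f"
    unfolding g by simp
  have "d*e*g*(e*K') = e*W + c*c*x*B*f2*(y*g - z*d - x*e) + (c*c*c*x*y*y*g - c*x*d*B*B')*f"
    unfolding 4 5 6 b(1) b(4) b(6) b(7) W_def by (simp add: algebra_simps)
  then have Y: "d*e*g*(e*K') = e*W + (c*c*c*x*y*y*g - c*x*d*B*B')*f"
    unfolding z by simp
  have "e*(c*c*y*x*g - e*A*A') = d*(c*c*y*y*g - d*B*B')"
    unfolding defs by algebra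
  then have "c*x*(e*(c*c*y*x*g - e*A*A')) = c*x*(d*(c*c*y*y*g - d*B*B'))"
    by simp
  then have Z: "e*(c*c*c*x*y*x*g - c*x*e*A*A') = d*(c*c*c*x*y*y*g - c*x*d*B*B')"
    by (simp add: algebra_simps)
  have "e*(d*e*g*(d*K)) = d*(e*W) + e*(c*c*c*x*y*x*g - c*x*e*A*A')*f"
    unfolding X by (simp add: distrib_left mult_ac)
  also have "\<dots> = d*(d*e*g*(e*K'))"
    unfolding Z Y by (simp add: distrib_left mult_ac)
  finally have "(d*d*e*e*g)*K = (d*d*e*e*g)*K'"
    by (simp add: mult_ac)
  moreover have "d*d*e*e*g \<noteq> 0"
    using ne unfolding defs by simp
  ultimately show ?thesis by (rule mult_left_cancel[THEN iffD1, rotated])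
qed

lemma gop_braid:
  assumes "a \<noteq> b" "b \<noteq> c" "a \<noteq> c"
  shows "gop a b * gop b c * gop a b = gop b c * gop a b * gop b c"
proof (rule lop_eqI)
  fix f
  define s1 s2 where "s1 = app (swp a b)" and "s2 = app (swp b c)"
  have hom: "s1 (f * g) = s1 f * s1 g" "s2 (f * g) = s2 f * s2 g" for f g
    by (simp_all add: s1_def s2_def alg_hom_mult[OF alg_hom_swp])
  have lin: "s1 (f + g) = s1 f + s1 g" "s2 (f + g) = s2 f + s2 g"
    "s1 (f - g) = s1 f - s1 g" "s2 (f - g) = s2 f - s2 g" for f g
    by (simp_all add: s1_def s2_def)
  have con: "s1 (const_L x) = const_L x" "s2 (const_L x) = const_L x" for x
    by (simp_all add: s1_def s2_def alg_hom_const[OF alg_hom_swp])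
  have var: "s1 (var_z a) = var_z b" "s1 (var_z b) = var_z a" "s1 (var_z c) = var_z c"
     "s2 (var_z a) = var_z a" "s2 (var_z b) = var_z c" "s2 (var_z c) = var_z b"
    using assms by (simp_all add: s1_def s2_def)
  have inv: "s1 (s1 f) = f" "s2 (s2 f) = f" for f by (simp_all add: s1_def s2_def)
  have "swp a b * (swp b c * swp a b) = swp b c * (swp a b * swp b c)"
    using swp_conj[of a b b c] swp_conj[of b c a b] assms swp_swp
    by (metis (no_types, opaque_lifting) transpose_apply_first transpose_apply_other transpose_apply_second mult.assoc mult_1_right)
  then have br: "s1 (s2 (s1 f)) = s2 (s1 (s2 f))" for f
    unfolding s1_def s2_def by (metis app_times)
  define F where "F = app (gop a b) f"
  define H where "H = app (gop b c) F"
  define K where "K = app (gop a b) H"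
  define F' where "F' = app (gop b c) f"
  define H' where "H' = app (gop a b) F'"
  define K' where "K' = app (gop b c) H'"
  note c1 = gop_clear[OF assms(1), folded s1_def] and c2 = gop_clear[OF assms(2), folded s2_def]
  note e1 = c1[of f, folded F_def] and e2 = c2[of F, folded H_def] and e3 = c1[of H, folded K_def]
  note e1' = c2[of f, folded F'_def] and e2' = c1[of F', folded H'_def] and e3' = c2[of H', folded K'_def]
  note simp = hom lin con var inv
  have "K = K'"
    using assms
    by (intro clear_denominators_braid[OF var_z_diff_neq_0 var_z_diff_neq_0 var_z_diff_neq_0 e1 e2 e3
        arg_cong[OF e1, of s2, unfolded simp] arg_cong[OF e2, of s1, unfolded simp]
        arg_cong[OF e1, of s1, unfolded simp] arg_cong[OF arg_cong[OF e1, of s2], of s1, unfolded simp]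
        e1' e2' e3'
        arg_cong[OF e1', of s1, unfolded simp] arg_cong[OF e2', of s2, unfolded simp]
        arg_cong[OF e1', of s2, unfolded simp] arg_cong[OF arg_cong[OF e1', of s1], of s2, unfolded simp, folded br]])
  then show "app (gop a b * gop b c * gop a b) f = app (gop b c * gop a b * gop b c) f"
    by (simp add: K_def H_def F_def K'_def H'_def F'_def)
qed

section \<open>Affine Hecke algebras in an abstract ring\<close>

text \<open>A relation \<open>x g = g' y\<close> can be read for the inverses, which is how every relation for the generators is transported
to their inverses.\<close>

lemma inverse_conj:
  fixes g :: "'a :: ring_1"
  assumes "g * gi = 1" "gi * g = 1" "g' * gi' = 1" "gi' * g' = 1" "x * g = g' * y"
  shows "gi' * x = y * gi"
proof -
  have "gi' * x = gi' * (x * g) * gi" using assms(1) by (simp add: mult.assoc)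
  also have "\<dots> = y * gi" using assms(4) unfolding assms(5) by (simp flip: mult.assoc)
  finally show ?thesis .
qed

lemma prod_list_commute:
  fixes y :: "'a :: monoid_mult"
  assumes "\<And>x. x \<in> set xs \<Longrightarrow> x * y = y * x"
  shows "prod_list xs * y = y * prod_list xs"
  using assms
proof (induction xs)
  case (Cons x xs)
  then have "prod_list xs * y = y * prod_list xs" "x * y = y * x" by auto
  then show ?case by (metis mult.assoc prod_list.Cons)
qed simp

lemma sandwich_commute:
  fixes y :: "'a :: monoid_mult"
  assumes "y * g = g * y" "y * x = x * y"
  shows "y * (g * x * g) = g * x * g * y"
  using assms by (metis mult.assoc)

lemma power_mult_commuting:
  fixes A B :: "'a :: monoid_mult"
  assumes "A * B = B * A"
  shows "(A * B) ^ n = A ^ n * B ^ n"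
proof (induction n)
  case (Suc n)
  have "(A * B) ^ Suc n = A * (B * A ^ n) * B ^ n" by (simp add: Suc mult.assoc)
  also have "B * A ^ n = A ^ n * B" using assms by (simp add: power_commuting_commutes)
  finally show ?case by (simp add: mult.assoc)
qed simp

text \<open>Newton's recursion \<open>A\<^bsup>d+2\<^esup> + B\<^bsup>d+2\<^esup> = (A + B) (A\<^bsup>d+1\<^esup> + B\<^bsup>d+1\<^esup>) - A B (A\<^sup>d + B\<^sup>d)\<close> reduces symmetrized monomials to the
elementary symmetric functions.\<close>

lemma symmetrized_monomial_commute:
  fixes A B g :: "'a :: ring_1"
  assumes AB: "A * B = B * A" and sum: "g * (A + B) = (A + B) * g" and prod: "g * (A * B) = A * B * g"
  shows "g * (A ^ i * B ^ j + A ^ j * B ^ i) = (A ^ i * B ^ j + A ^ j * B ^ i) * g"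
proof -
  have power_sum: "g * (A ^ d + B ^ d) = (A ^ d + B ^ d) * g" for d
  proof (induction d rule: induct_nat_012)
    case 0 show ?case by (simp add: mult_2 mult_2_right distrib_left distrib_right)
  next
    case 1 show ?case using sum by simp
  next
    case (ge2 d)
    have "A * (B * B ^ d) = B * (A * B ^ d)" "B * (A * A ^ d) = A * (B * A ^ d)"
      using AB by (metis mult.assoc)+
    then have rec: "A ^ Suc (Suc d) + B ^ Suc (Suc d) = (A + B) * (A ^ Suc d + B ^ Suc d) - A * B * (A ^ d + B ^ d)"
      using AB by (simp add: algebra_simps)
    have "g * ((A + B) * (A ^ Suc d + B ^ Suc d)) = (A + B) * (A ^ Suc d + B ^ Suc d) * g"
      by (metis sum ge2(2) mult.assoc)
    moreover have "g * (A * B * (A ^ d + B ^ d)) = A * B * (A ^ d + B ^ d) * g"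
      by (metis prod ge2(1) mult.assoc)
    ultimately show ?case unfolding rec right_diff_distrib left_diff_distrib by simp
  qed
  have wlog: "g * (A ^ i * B ^ (i + d) + A ^ (i + d) * B ^ i) = (A ^ i * B ^ (i + d) + A ^ (i + d) * B ^ i) * g" for i d
  proof -
    have c: "B ^ i * A ^ d = A ^ d * B ^ i"
      using AB by (metis power_commuting_commutes)
    have e: "A ^ i * B ^ (i + d) + A ^ (i + d) * B ^ i = (A * B) ^ i * (A ^ d + B ^ d)"
      by (simp add: power_mult_commuting[OF AB] power_add distrib_left mult.assoc c)
    have "g * (A * B) ^ i = (A * B) ^ i * g"
      using prod by (metis power_commuting_commutes)
    then show ?thesis unfolding e using power_sum[of d] by (metis mult.assoc)
  qed
  show ?thesis
  proof (cases "i \<le> j")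
    case True
    then show ?thesis using wlog[of i "j - i"] by simp
  next
    case False
    then show ?thesis using wlog[of j "i - j"] by (simp add: add.commute)
  qed
qed

text \<open>Generators and relations of an affine Hecke algebra of type \<open>GL\<^sub>N\<close>, with the elements \<open>Y\<^sub>a\<close> given recursively from the
rotation \<open>w\<close>. Keeping this part abstract shows that commutativity of the \<open>Y\<^sub>a\<close> depends on nothing but these relations.\<close>

locale affine_hecke =
  fixes N :: nat and G Gi :: "nat \<Rightarrow> 'a :: ring_1" and w h :: 'a and Y :: "nat \<Rightarrow> 'a"
  assumes G_Gi: "1 \<le> i \<Longrightarrow> i < N \<Longrightarrow> G i * Gi i = 1"
    and Gi_G: "1 \<le> i \<Longrightarrow> i < N \<Longrightarrow> Gi i * G i = 1"
    and quadratic: "1 \<le> i \<Longrightarrow> i < N \<Longrightarrow> G i * G i = h * G i + 1"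
    and h_central: "h * x = x * h"
    and braid: "1 \<le> i \<Longrightarrow> Suc i < N \<Longrightarrow> G i * G (Suc i) * G i = G (Suc i) * G i * G (Suc i)"
    and far: "1 \<le> i \<Longrightarrow> Suc i < j \<Longrightarrow> j < N \<Longrightarrow> G i * G j = G j * G i"
    and w_G: "1 \<le> i \<Longrightarrow> Suc i < N \<Longrightarrow> w * G (Suc i) = G i * w"
    and w2_G: "2 \<le> N \<Longrightarrow> w * w * G 1 = G (N - 1) * w * w"
    and Y_1: "Y 1 = prod_list (map Gi [1..<N]) * w"
    and Y_Suc: "1 \<le> a \<Longrightarrow> a < N \<Longrightarrow> Y (Suc a) = G a * Y a * G a"
begin

abbreviation "pr m n \<equiv> prod_list (map G [m..<n])"
abbreviation "pri m n \<equiv> prod_list (map Gi [m..<n])"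

lemma pr_split: "m \<le> k \<Longrightarrow> k \<le> n \<Longrightarrow> pr m n = pr m k * pr k n"
  using upt_add_eq_append[of m k "n - k"] by simp

lemma pri_split: "m \<le> k \<Longrightarrow> k \<le> n \<Longrightarrow> pri m n = pri m k * pri k n"
  using upt_add_eq_append[of m k "n - k"] by simp

lemma pr_first: "m < n \<Longrightarrow> pr m n = G m * pr (Suc m) n"
  and pri_first: "m < n \<Longrightarrow> pri m n = Gi m * pri (Suc m) n"
  by (simp_all add: upt_rec)

lemma pr_last: "m \<le> n \<Longrightarrow> pr m (Suc n) = pr m n * G n"
  and pri_last: "m \<le> n \<Longrightarrow> pri m (Suc n) = pri m n * Gi n"
  by simp_all

lemma Gi_commute:
  assumes "1 \<le> i" "i < N" "x * G i = G i * x"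
  shows "x * Gi i = Gi i * x"
  using inverse_conj[OF G_Gi[of i] Gi_G[of i] G_Gi[of i] Gi_G[of i] assms(3)] assms by simp

lemma far': "1 \<le> i \<Longrightarrow> i < N \<Longrightarrow> 1 \<le> j \<Longrightarrow> j < N \<Longrightarrow> Suc i < j \<or> Suc j < i \<Longrightarrow> G i * G j = G j * G i"
  using far by metis

lemma far_Gi: "1 \<le> i \<Longrightarrow> i < N \<Longrightarrow> 1 \<le> j \<Longrightarrow> j < N \<Longrightarrow> Suc i < j \<or> Suc j < i \<Longrightarrow> G i * Gi j = Gi j * G i"
  by (rule Gi_commute) (use far' in auto)

lemma pr_far: "1 \<le> m \<Longrightarrow> n \<le> N \<Longrightarrow> 1 \<le> k \<Longrightarrow> k < N \<Longrightarrow> n < k \<or> Suc k < m \<Longrightarrow> pr m n * G k = G k * pr m n"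
  by (rule prod_list_commute) (auto intro!: far')

lemma pri_far: "1 \<le> m \<Longrightarrow> n \<le> N \<Longrightarrow> 1 \<le> k \<Longrightarrow> k < N \<Longrightarrow> n < k \<or> Suc k < m \<Longrightarrow> pri m n * G k = G k * pri m n"
  by (rule prod_list_commute) (auto intro!: far_Gi[symmetric])

text \<open>The product \<open>G\<^sub>m \<dots> G\<^bsub>n-1\<^esub>\<close> is a lift of a cycle, and conjugation by it raises the indices.\<close>

lemma pr_shift:
  assumes "1 \<le> m" "m \<le> k" "Suc k < n" "n \<le> N"
  shows "pr m n * G k = G (Suc k) * pr m n"
proof -
  have e: "pr m n = pr m k * (G k * (G (Suc k) * pr (Suc (Suc k)) n))"
    using assms pr_split[of m k n] by (simp add: pr_first)
  have "pr m n * G k = pr m k * (G k * (G (Suc k) * (pr (Suc (Suc k)) n * G k)))"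
    unfolding e by (simp add: mult.assoc)
  also have "pr (Suc (Suc k)) n * G k = G k * pr (Suc (Suc k)) n"
    using assms by (intro pr_far) auto
  also have "pr m k * (G k * (G (Suc k) * (G k * pr (Suc (Suc k)) n))) = pr m k * (G k * G (Suc k) * G k) * pr (Suc (Suc k)) n"
    by (simp add: mult.assoc)
  also have "G k * G (Suc k) * G k = G (Suc k) * G k * G (Suc k)"
    using assms by (intro braid) auto
  also have "pr m k * (G (Suc k) * G k * G (Suc k)) * pr (Suc (Suc k)) n = (pr m k * G (Suc k)) * (G k * (G (Suc k) * pr (Suc (Suc k)) n))"
    by (simp add: mult.assoc)
  also have "pr m k * G (Suc k) = G (Suc k) * pr m k"
    using assms by (intro pr_far) auto
  finally show ?thesis unfolding e by (simp add: mult.assoc)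
qed

lemma braid_inverse:
  assumes "1 \<le> k" "Suc k < N"
  shows "Gi k * Gi (Suc k) * G k = G (Suc k) * Gi k * Gi (Suc k)"
proof -
  have "Gi (Suc k) * (G k * G (Suc k)) = G k * G (Suc k) * Gi k"
    by (rule inverse_conj[where g = "G k" and g' = "G (Suc k)"])
      (use assms G_Gi Gi_G braid[of k] in \<open>auto simp: mult.assoc\<close>)
  then have "Gi k * (Gi (Suc k) * (G k * G (Suc k))) * Gi (Suc k) = Gi k * (G k * G (Suc k) * Gi k) * Gi (Suc k)"
    by simp
  moreover have "Gi k * (Gi (Suc k) * (G k * G (Suc k))) * Gi (Suc k) = Gi k * Gi (Suc k) * G k"
    using assms G_Gi[of "Suc k"] by (simp add: mult.assoc)
  moreover have "Gi k * (G k * G (Suc k) * Gi k) * Gi (Suc k) = G (Suc k) * Gi k * Gi (Suc k)"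
    using assms Gi_G[of k] by (simp flip: mult.assoc)
  ultimately show ?thesis by simp
qed

lemma pri_shift:
  assumes "1 \<le> m" "m \<le> k" "Suc k < n" "n \<le> N"
  shows "pri m n * G k = G (Suc k) * pri m n"
proof -
  have e: "pri m n = pri m k * (Gi k * (Gi (Suc k) * pri (Suc (Suc k)) n))"
    using assms pri_split[of m k n] by (simp add: pri_first)
  have "pri m n * G k = pri m k * (Gi k * (Gi (Suc k) * (pri (Suc (Suc k)) n * G k)))"
    unfolding e by (simp add: mult.assoc)
  also have "pri (Suc (Suc k)) n * G k = G k * pri (Suc (Suc k)) n"
    using assms by (intro pri_far) auto
  also have "pri m k * (Gi k * (Gi (Suc k) * (G k * pri (Suc (Suc k)) n))) = pri m k * (Gi k * Gi (Suc k) * G k) * pri (Suc (Suc k)) n"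
    by (simp add: mult.assoc)
  also have "Gi k * Gi (Suc k) * G k = G (Suc k) * Gi k * Gi (Suc k)"
    using assms by (intro braid_inverse) auto
  also have "pri m k * (G (Suc k) * Gi k * Gi (Suc k)) * pri (Suc (Suc k)) n = (pri m k * G (Suc k)) * (Gi k * (Gi (Suc k) * pri (Suc (Suc k)) n))"
    by (simp add: mult.assoc)
  also have "pri m k * G (Suc k) = G (Suc k) * pri m k"
    using assms by (intro pri_far) auto
  finally show ?thesis unfolding e by (simp add: mult.assoc)
qed

lemma shift_Gi:
  assumes "1 \<le> k" "Suc k < N" "x * G k = G (Suc k) * x"
  shows "x * Gi k = Gi (Suc k) * x"
  using inverse_conj[OF G_Gi[of k] Gi_G[of k] G_Gi[of "Suc k"] Gi_G[of "Suc k"] assms(3)] assms by simp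

lemma w_Gi: "1 \<le> i \<Longrightarrow> Suc i < N \<Longrightarrow> w * Gi (Suc i) = Gi i * w"
  using inverse_conj[OF G_Gi[of "Suc i"] Gi_G[of "Suc i"] G_Gi[of i] Gi_G[of i] w_G[of i]] by simp

lemma w_pri: "1 \<le> m \<Longrightarrow> m \<le> n \<Longrightarrow> Suc n \<le> N \<Longrightarrow> w * pri (Suc m) (Suc n) = pri m n * w"
proof (induction n)
  case (Suc n)
  show ?case
  proof (cases "m \<le> n")
    case True
    have "w * pri (Suc m) (Suc (Suc n)) = (w * pri (Suc m) (Suc n)) * Gi (Suc n)"
      using True by (simp add: pri_last mult.assoc)
    also have "w * pri (Suc m) (Suc n) = pri m n * w"
      using Suc True by simp
    also have "pri m n * w * Gi (Suc n) = pri m n * (Gi n * w)"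
      using Suc.prems True by (simp add: mult.assoc w_Gi)
    finally show ?thesis using True by (simp add: pri_last mult.assoc)
  qed (use Suc.prems in \<open>simp add: le_Suc_eq\<close>)
qed simp

lemma w_pr: "1 \<le> m \<Longrightarrow> m \<le> n \<Longrightarrow> Suc n \<le> N \<Longrightarrow> w * pr (Suc m) (Suc n) = pr m n * w"
proof (induction n)
  case (Suc n)
  show ?case
  proof (cases "m \<le> n")
    case True
    have "w * pr (Suc m) (Suc (Suc n)) = (w * pr (Suc m) (Suc n)) * G (Suc n)"
      using True by (simp add: pr_last mult.assoc)
    also have "w * pr (Suc m) (Suc n) = pr m n * w"
      using Suc True by simp
    also have "pr m n * w * G (Suc n) = pr m n * (G n * w)"
      using Suc.prems True by (simp add: mult.assoc w_G)
    finally show ?thesis using True by (simp add: pr_last mult.assoc)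
  qed (use Suc.prems in \<open>simp add: le_Suc_eq\<close>)
qed simp

lemma shift_pri:
  assumes "\<And>k. 1 \<le> k \<Longrightarrow> Suc k < N \<Longrightarrow> x * G k = G (Suc k) * x" "1 \<le> n" "n < N"
  shows "x * pri 1 n = pri 2 (Suc n) * x"
  using assms(2,3)
proof (induction n rule: nat_induct_at_least)
  case (Suc n)
  have e: "pri 1 (Suc n) = pri 1 n * Gi n" "pri 2 (Suc (Suc n)) = pri 2 (Suc n) * Gi (Suc n)"
    using Suc by (simp_all only: pri_last)
  have "x * pri 1 (Suc n) = (x * pri 1 n) * Gi n"
    unfolding e by (simp only: mult.assoc)
  also have "x * pri 1 n = pri 2 (Suc n) * x"
    using Suc by simp
  also have "pri 2 (Suc n) * x * Gi n = pri 2 (Suc n) * (x * Gi n)"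
    by (simp only: mult.assoc)
  also have "x * Gi n = Gi (Suc n) * x"
    using Suc assms(1) by (intro shift_Gi) auto
  finally show ?case unfolding e by (simp only: mult.assoc)
qed simp

lemma Y_1_G: "1 \<le> i \<Longrightarrow> Suc i < N \<Longrightarrow> Y 1 * G (Suc i) = G (Suc i) * Y 1"
  unfolding Y_1 using pri_shift[of 1 i N] w_G[of i] by (metis le_refl mult.assoc)

lemma G_Y_above:
  assumes "1 \<le> j" "j < i" "i < N"
  shows "G i * Y j = Y j * G i"
  using assms
proof (induction j rule: nat_induct_at_least)
  case base
  then show ?case using Y_1_G[of "i - 1"] by simp
next
  case (Suc j)
  have "G i * G j = G j * G i" using Suc by (intro far') auto
  moreover have "G i * Y j = Y j * G i" using Suc by simp
  ultimately have "G i * (G j * Y j * G j) = G j * Y j * G j * G i" by (rule sandwich_commute)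
  then show ?case using Suc.hyps Suc.prems by (simp add: Y_Suc)
qed

lemma G_Y_below:
  assumes "1 \<le> i" "Suc i < j" "j \<le> N"
  shows "G i * Y j = Y j * G i"
proof -
  have "Suc (Suc i) \<le> j" using assms by simp
  then show ?thesis using assms(3)
  proof (induction j rule: nat_induct_at_least)
    case base
    have Y: "Y (Suc (Suc i)) = G (Suc i) * G i * Y i * G i * G (Suc i)"
      using base assms by (simp add: Y_Suc mult.assoc)
    have br: "G i * G (Suc i) * G i = G (Suc i) * G i * G (Suc i)"
      using base assms by (intro braid) auto
    have cm: "G (Suc i) * Y i = Y i * G (Suc i)"
      using base assms by (intro G_Y_above) auto
    have "G i * Y (Suc (Suc i)) = (G i * G (Suc i) * G i) * Y i * G i * G (Suc i)"
      unfolding Y by (simp add: mult.assoc)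
    also have "\<dots> = G (Suc i) * G i * (G (Suc i) * Y i) * G i * G (Suc i)"
      unfolding br by (simp add: mult.assoc)
    also have "\<dots> = G (Suc i) * G i * Y i * (G (Suc i) * G i * G (Suc i))"
      unfolding cm by (simp add: mult.assoc)
    also have "\<dots> = Y (Suc (Suc i)) * G i"
      unfolding Y br[symmetric] by (simp add: mult.assoc)
    finally show ?case .
  next
    case (Suc j)
    have "G i * G j = G j * G i" using Suc assms by (intro far') auto
    moreover have "G i * Y j = Y j * G i" using Suc by simp
    ultimately have "G i * (G j * Y j * G j) = G j * Y j * G j * G i" by (rule sandwich_commute)
    then show ?case using Suc.hyps Suc.prems assms by (simp add: Y_Suc)
  qed
qed

text \<open>With \<open>A = G\<^sub>2\<^sup>-\<^sup>1 \<dots> G\<^bsub>N-1\<^esub>\<^sup>-\<^sup>1\<close> and its shift \<open>B\<close>, both products are rewritten to \<open>A B w\<^sup>2\<close>; this is where the relation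
\<open>w\<^sup>2 G\<^sub>1 = G\<^bsub>N-1\<^esub> w\<^sup>2\<close>, which closes the cycle of generators, is used.\<close>

lemma Y_1_Y_2:
  assumes "2 \<le> N"
  shows "Y 1 * Y 2 = Y 2 * Y 1"
proof -
  define A B where "A = pri 2 N" and "B = pri 1 (N - 1)"
  have C1: "pri 1 N = Gi 1 * A" using assms by (simp add: A_def pri_first numeral_2_eq_2)
  have C2: "pri 1 N = B * Gi (N - 1)"
    using assms pri_last[of 1 "N - 1"] by (simp add: B_def)
  have wA: "w * A = B * w"
    using w_pri[of 1 "N - 1"] assms by (simp add: A_def B_def numeral_2_eq_2)
  have CB: "pri 1 N * B = A * pri 1 N"
    using shift_pri[of "pri 1 N" "N - 1"] pri_shift[of 1 _ N] assms by (simp add: A_def B_def)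
  have g: "G 1 * (Gi 1 * x) = x" for x using G_Gi[of 1] assms by (simp flip: mult.assoc)
  have g': "Gi (N - 1) * (G (N - 1) * x) = x" for x
    using Gi_G[of "N - 1"] assms by (simp flip: mult.assoc)
  have Y2: "Y 2 = A * w * G 1"
    using Y_Suc[of 1] assms unfolding Y_1 C1 by (simp add: numeral_2_eq_2 mult.assoc g[simplified])
  have Y1: "Y 1 = Gi 1 * A * w" unfolding Y_1 C1 ..
  have "Y 2 * Y 1 = A * (w * (G 1 * (Gi 1 * (A * w))))" unfolding Y1 Y2 by (simp add: mult.assoc)
  also have "\<dots> = A * (w * A) * w" unfolding g by (simp add: mult.assoc)
  finally have 21: "Y 2 * Y 1 = A * B * w * w" unfolding wA by (simp add: mult.assoc)
  have "Y 1 * Y 2 = pri 1 N * (w * A) * w * G 1" unfolding Y_1 Y2 by (simp add: mult.assoc)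
  also have "\<dots> = (pri 1 N * B) * (w * w * G 1)" unfolding wA by (simp add: mult.assoc)
  also have "\<dots> = A * pri 1 N * (G (N - 1) * w * w)" unfolding CB w2_G[OF assms] ..
  also have "\<dots> = A * B * w * w" unfolding C2 by (simp add: mult.assoc g'[simplified])
  finally show ?thesis using 21 by simp
qed

text \<open>Conjugation by generators transports the case of \<open>Y\<^sub>1, Y\<^sub>2\<close> to all pairs, because \<open>G\<^sub>b\<close> commutes with \<open>Y\<^sub>a\<close> unless \<open>a\<close> is \<open>b\<close>
or \<open>b + 1\<close>.\<close>

lemma Y_commute_less:
  assumes "1 \<le> a" "a < b" "b \<le> N"
  shows "Y a * Y b = Y b * Y a"
  using assms
proof (induction a arbitrary: b rule: nat_induct_at_least)
  case base
  from base(1) have "2 \<le> b" by simp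
  then show ?case using base(2)
  proof (induction b rule: nat_induct_at_least)
    case base then show ?case by (rule Y_1_Y_2)
  next
    case (Suc b)
    have "Y 1 * G b = G b * Y 1" using Suc by (intro G_Y_above[symmetric]) auto
    moreover have "Y 1 * Y b = Y b * Y 1" using Suc by simp
    ultimately have "Y 1 * (G b * Y b * G b) = G b * Y b * G b * Y 1" by (rule sandwich_commute)
    then show ?case using Suc.hyps Suc.prems by (simp add: Y_Suc)
  qed
next
  case (Suc a)
  have "Y b * G a = G a * Y b" using Suc by (intro G_Y_below[symmetric]) auto
  moreover have "Y b * Y a = Y a * Y b" using Suc by simp
  ultimately have "Y b * (G a * Y a * G a) = G a * Y a * G a * Y b" by (rule sandwich_commute)
  then show ?case using Suc.hyps Suc.prems by (simp add: Y_Suc)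
qed

lemma Y_commute: "1 \<le> a \<Longrightarrow> a \<le> N \<Longrightarrow> 1 \<le> b \<Longrightarrow> b \<le> N \<Longrightarrow> Y a * Y b = Y b * Y a"
  using Y_commute_less by (metis linorder_neqE_nat)

lemma G_Y: "1 \<le> i \<Longrightarrow> i < N \<Longrightarrow> 1 \<le> j \<Longrightarrow> j \<le> N \<Longrightarrow> j \<noteq> i \<Longrightarrow> j \<noteq> Suc i \<Longrightarrow> G i * Y j = Y j * G i"
  using G_Y_above G_Y_below by (metis linorder_neqE_nat not_less_eq)

lemma G_Y_sum:
  assumes "1 \<le> i" "i < N"
  shows "G i * (Y i + Y (Suc i)) = (Y i + Y (Suc i)) * G i"
proof -
  have "G i * (G i * x) = h * (G i * x) + x" for x
    using quadratic[OF assms] by (simp add: distrib_right flip: mult.assoc)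
  moreover have "x * (G i * G i) = h * (x * G i) + x" for x
    unfolding quadratic[OF assms] by (simp add: distrib_left) (metis h_central mult.assoc)
  ultimately show ?thesis
    using assms h_central[of "G i"]
    by (simp add: Y_Suc distrib_left distrib_right mult.assoc) (metis mult.assoc)
qed

lemma G_Y_prod:
  assumes "1 \<le> i" "i < N"
  shows "G i * (Y i * Y (Suc i)) = Y i * Y (Suc i) * G i"
proof -
  have "Y i * Y (Suc i) = Y (Suc i) * Y i" using assms by (intro Y_commute) auto
  then show ?thesis using assms by (simp add: Y_Suc mult.assoc)
qed

lemma Y_closed_form:
  assumes "1 \<le> j" "j \<le> N"
  shows "Y j = pri j N * w * pr 1 j"
  using assms
proof (induction j rule: nat_induct_at_least)
  case base show ?case using Y_1 by simp
next
  case (Suc j)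
  have "Y (Suc j) = G j * (Gi j * pri (Suc j) N) * w * pr 1 j * G j"
    using Suc by (simp add: Y_Suc pri_first mult.assoc)
  also have "G j * (Gi j * pri (Suc j) N) = pri (Suc j) N"
    using G_Gi[of j] Suc.hyps Suc.prems by (simp only: mult.assoc[symmetric]) simp
  finally show ?case using Suc by (simp add: mult.assoc)
qed

end

text \<open>The relations with multiplication by \<open>z\<^sub>a\<^sup>-\<^sup>1\<close> (the elements \<open>Zi a\<close>) that are needed to see that the second cyclic element
\<open>z\<^sub>1\<^sup>-\<^sup>1 G\<^sub>1 \<dots> G\<^bsub>N-1\<^esub>\<close> of the double affine Hecke algebra permutes the \<open>Y\<^sub>a\<close>.\<close>

locale affine_hecke_cyclic = affine_hecke +
  fixes Zi :: "nat \<Rightarrow> 'a" and \<kappa> :: 'a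
  assumes Zi_G: "2 \<le> i \<Longrightarrow> i < N \<Longrightarrow> Zi 1 * G i = G i * Zi 1"
    and Gi_Zi: "1 \<le> i \<Longrightarrow> i < N \<Longrightarrow> Gi i * Zi (Suc i) = Zi i * G i"
    and G_Zi: "2 \<le> N \<Longrightarrow> G 1 * Zi 1 = Zi 2 * Gi 1"
    and w_Zi: "2 \<le> N \<Longrightarrow> w * Zi 2 = Zi 1 * w" "w * Zi 1 = \<kappa> * Zi N * w"
    and \<kappa>_central: "\<kappa> * x = x * \<kappa>"
begin

definition cyc where "cyc = Zi 1 * pr 1 N"

lemma cyc_G: "1 \<le> i \<Longrightarrow> Suc i < N \<Longrightarrow> cyc * G i = G (Suc i) * cyc"
  unfolding cyc_def using pr_shift[of 1 i N] Zi_G[of "Suc i"] by (metis Suc_le_mono One_nat_def le_refl mult.assoc one_add_one plus_1_eq_Suc)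

lemma Y_2_cyc:
  assumes "2 \<le> N"
  shows "Y 2 * cyc = cyc * Y 1"
proof -
  define A where "A = pri 2 N"
  have C1: "pri 1 N = Gi 1 * A" using assms by (simp add: A_def pri_first numeral_2_eq_2)
  have g: "G 1 * (Gi 1 * x) = x" for x using G_Gi[of 1] assms by (simp flip: mult.assoc)
  have g': "Gi 1 * (G 1 * x) = x" for x using Gi_G[of 1] assms by (simp flip: mult.assoc)
  have Y2: "Y 2 = A * w * G 1"
    using Y_closed_form[of 2] assms pr_last[of 1 1] by (simp add: A_def numeral_2_eq_2)
  have P: "pr 1 N = G 1 * pr 2 N" using assms by (simp add: pr_first numeral_2_eq_2)
  have P': "pr 1 N = pr 1 (N - 1) * G (N - 1)" using pr_last[of 1 "N - 1"] assms by simp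
  have ZA: "Zi 1 * A = A * Zi 1"
    unfolding A_def by (rule prod_list_commute[symmetric]) (use Zi_G in \<open>auto intro!: Gi_commute[symmetric]\<close>)
  have "Y 2 * cyc = A * w * (G 1 * Zi 1) * pr 1 N"
    unfolding Y2 cyc_def by (simp add: mult.assoc)
  also have "\<dots> = A * (w * Zi 2) * pr 2 N"
    unfolding G_Zi[OF assms] P using g'[simplified] by (simp add: mult.assoc)
  also have "\<dots> = A * Zi 1 * (w * pr 2 N)"
    unfolding w_Zi(1)[OF assms] by (simp add: mult.assoc)
  also have "w * pr 2 N = pr 1 (N - 1) * w"
    using w_pr[of 1 "N - 1"] assms by (simp add: numeral_2_eq_2)
  finally have 1: "Y 2 * cyc = Zi 1 * A * (pr 1 (N - 1) * w)"
    unfolding ZA .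
  have "pr 1 N * pri 1 N = pr 1 N * pri 1 (N - 1) * Gi (N - 1)"
    using pri_last[of 1 "N - 1"] assms by (simp add: mult.assoc)
  also have "pr 1 N * pri 1 (N - 1) = A * pr 1 N"
    using shift_pri[of "pr 1 N" "N - 1"] pr_shift[of 1 _ N] assms by (simp add: A_def)
  also have "A * pr 1 N * Gi (N - 1) = A * pr 1 (N - 1) * (G (N - 1) * Gi (N - 1))"
    unfolding P' by (simp add: mult.assoc)
  also have "G (N - 1) * Gi (N - 1) = 1" using assms by (intro G_Gi) auto
  finally have "pr 1 N * pri 1 N = A * pr 1 (N - 1)" by simp
  then have "cyc * Y 1 = Zi 1 * (A * pr 1 (N - 1)) * w"
    unfolding cyc_def Y_1 by (metis mult.assoc)
  then show ?thesis using 1 by (simp add: mult.assoc)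
qed

text \<open>Only the case \<open>a = 1\<close> involves the rotation; the others follow by conjugating with generators.\<close>

lemma Y_cyc:
  assumes "1 \<le> a" "a < N"
  shows "Y (Suc a) * cyc = cyc * Y a"
  using assms
proof (induction a rule: nat_induct_at_least)
  case base then show ?case using Y_2_cyc by (simp add: numeral_2_eq_2)
next
  case (Suc a)
  have pg: "cyc * G a = G (Suc a) * cyc" using Suc by (intro cyc_G) auto
  have "Y (Suc (Suc a)) * cyc = G (Suc a) * Y (Suc a) * (G (Suc a) * cyc)"
    using Suc by (simp add: Y_Suc[of "Suc a"] mult.assoc)
  also have "\<dots> = G (Suc a) * (Y (Suc a) * cyc) * G a"
    unfolding pg[symmetric] by (simp add: mult.assoc)
  also have "\<dots> = (G (Suc a) * cyc) * Y a * G a"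
    using Suc by (simp add: mult.assoc)
  also have "\<dots> = cyc * Y (Suc a)"
    unfolding pg[symmetric] using Suc by (simp add: Y_Suc[of a] mult.assoc)
  finally show ?case .
qed

lemma pri_Zi: "1 \<le> m \<Longrightarrow> m \<le> N \<Longrightarrow> pri m N * Zi N = Zi m * pr m N"
proof (induction "N - m" arbitrary: m)
  case (Suc d)
  have "pri m N * Zi N = Gi m * (pri (Suc m) N * Zi N)"
    using Suc by (simp add: pri_first mult.assoc)
  also have "\<dots> = (Gi m * Zi (Suc m)) * pr (Suc m) N"
    using Suc by (simp add: mult.assoc)
  also have "Gi m * Zi (Suc m) = Zi m * G m" using Suc by (intro Gi_Zi) auto
  finally show ?case using Suc by (simp add: pr_first mult.assoc)
qed simp

lemma Y_1_cyc:
  assumes "1 \<le> N"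
  shows "Y 1 * cyc = \<kappa> * cyc * Y N"
proof -
  have "Y 1 * cyc = pri 1 N * (w * Zi 1) * pr 1 N"
    unfolding Y_1 cyc_def by (simp add: mult.assoc)
  also have "\<dots> = (pri 1 N * \<kappa>) * Zi N * w * pr 1 N"
    unfolding w_Zi(2) by (simp add: mult.assoc)
  also have "\<dots> = \<kappa> * (pri 1 N * Zi N) * w * pr 1 N"
    unfolding \<kappa>_central[symmetric] by (simp add: mult.assoc)
  also have "pri 1 N * Zi N = Zi 1 * pr 1 N"
    using assms by (intro pri_Zi) auto
  finally show ?thesis
    using Y_closed_form[of N] assms by (simp add: cyc_def mult.assoc)
qed

end

section \<open>The operators g acting on single variables\<close>

lemma gop_mulop_commute:
  assumes "c \<noteq> d" "app (swp c d) h = h"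
  shows "gop c d * mulop h = mulop h * gop c d"
proof (rule lop_eqI)
  fix f
  have "app (gop c d) (h * f) = h * app (gop c d) f"
    by (rule gop_eqI[OF assms(1)])
      (use gop_clear[OF assms(1), of f] assms(2) in \<open>simp add: alg_hom_mult[OF alg_hom_swp], algebra\<close>)
  then show "app (gop c d * mulop h) f = app (mulop h * gop c d) f" by simp
qed

lemma swp_zinv [simp]: "app (swp a b) (zinv c) = zinv (transpose a b c)"
  by (simp add: swp_def zinv_def)

lemma mulop_var_zinv [simp]: "mulop (var_z a) * mulop (zinv a) = 1" "mulop (zinv a) * mulop (var_z a) = 1"
  by (simp_all flip: mulop_mult)

lemma var_gop:
  assumes "a \<noteq> b"
  shows "mulop (var_z b) * gop a b = gin a b * mulop (var_z a)"
proof -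
  have "gin a b * (gop a b * mulop (var_z b)) * gop a b = gin a b * (mulop (var_z a) * gin a b) * gop a b"
    unfolding gop_var[OF assms] ..
  then show ?thesis
    using gop_gin[OF assms] gin_gop[OF assms] by (simp only: mult.assoc) (simp flip: mult.assoc)
qed

lemma gin_zinv:
  assumes "a \<noteq> b"
  shows "gin a b * mulop (zinv b) = mulop (zinv a) * gop a b"
  by (rule inverse_conj[symmetric, OF _ _ _ _ gop_var[OF assms], where gi' = "mulop (zinv a)"]) simp_all

lemma gop_zinv:
  assumes "a \<noteq> b"
  shows "gop a b * mulop (zinv a) = mulop (zinv b) * gin a b"
  by (rule inverse_conj[symmetric, OF _ _ _ _ var_gop[OF assms, symmetric], where gi' = "mulop (zinv b)", symmetric, THEN sym]) simp_all

lemma alg_hom_zinv: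
  assumes "alg_hom \<phi>" "app \<phi> (var_z a) = const_L c * var_z b" "c \<noteq> 0"
  shows "app \<phi> (zinv a) = const_L (inverse c) * zinv b"
proof -
  have 1: "app \<phi> (zinv a) * (const_L c * var_z b) = 1"
    using alg_hom_mult[OF assms(1), of "zinv a" "var_z a"] assms by (simp add: alg_hom_def)
  have 2: "(const_L c * var_z b) * (const_L (inverse c) * zinv b) = 1"
    using assms(3) by (simp add: mult.assoc mult.left_commute[of "var_z b"] flip: const_L_mult mult.assoc[of "const_L c"])
  have "app \<phi> (zinv a) = app \<phi> (zinv a) * ((const_L c * var_z b) * (const_L (inverse c) * zinv b))"
    unfolding 2 by simp
  also have "\<dots> = app \<phi> (zinv a) * (const_L c * var_z b) * (const_L (inverse c) * zinv b)"
    by (simp only: mult.assoc)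
  finally show ?thesis unfolding 1 by simp
qed

section \<open>Cherednik operators in the ring of linear operators\<close>

definition Lpart :: "nat \<Rightarrow> nat \<Rightarrow> lop" where
  "Lpart N a = prod_list (map (\<lambda>b. gin a b * swp a b) [a + 1..<N + 1])"

definition Rpart :: "nat \<Rightarrow> lop" where
  "Rpart a = prod_list (map (\<lambda>b. swp b a * gop b a) [1..<a])"

definition Yop :: "nat \<Rightarrow> nat \<Rightarrow> nat \<Rightarrow> lop" where
  "Yop N l a = Lpart N a * psh l a * Rpart a"

lemma inv_app:
  assumes "A * B = 1" "B * A = 1"
  shows "inv (app A) = app B"
  by (rule inv_unique_comp) (use assms in \<open>simp_all flip: app_comp add: fun_eq_iff\<close>)

lemma app_foldr:
  assumes "\<And>b. b \<in> set xs \<Longrightarrow> h b = app (F b)"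
  shows "foldr (\<lambda>b H. h b \<circ> H) xs id = app (prod_list (map F xs))"
  using assms by (induction xs) (auto simp: fun_eq_iff)

lemma Y_N_eq: "Y_N N l a = app (Yop N l a)"
proof -
  have "foldr (\<lambda>b F. (inv (g_op a b) \<circ> swap_z a b) \<circ> F) [a + 1..<N + 1] id = app (Lpart N a)"
    unfolding Lpart_def
  proof (rule app_foldr)
    fix b assume "b \<in> set [a + 1..<N + 1]"
    then have "a \<noteq> b" by auto
    then have "inv (g_op a b) = app (gin a b)"
      using inv_app[OF gop_gin gin_gop] app_gop by metis
    then show "inv (g_op a b) \<circ> swap_z a b = app (gin a b * swp a b)"
      by (simp add: app_comp app_swp)
  qed
  moreover have "foldr (\<lambda>b F. (swap_z b a \<circ> g_op b a) \<circ> F) [1..<a] id = app (Rpart a)"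
    unfolding Rpart_def
    by (rule app_foldr) (simp add: app_comp app_swp app_gop[symmetric])
  ultimately show ?thesis
    by (simp add: Y_N_def Yop_def app_comp app_psh comp_assoc)
qed

lemma swp_gin:
  assumes "c \<noteq> d"
  shows "swp a b * gin c d = gin (transpose a b c) (transpose a b d) * swp a b"
  using swp_gop[OF assms, of a b] by (simp add: gin_def right_diff_distrib left_diff_distrib scal_commute)

lemma conj_prod_list:
  fixes s :: "'a :: monoid_mult"
  assumes "s * s = 1" "\<And>x. x \<in> set xs \<Longrightarrow> s * f x = h x * s"
  shows "s * prod_list (map f xs) = prod_list (map h xs) * s"
  using assms(2)
proof (induction xs)
  case (Cons x xs)
  have "s * (f x * prod_list (map f xs)) = s * f x * prod_list (map f xs)" by (simp add: mult.assoc)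
  also have "\<dots> = h x * (s * prod_list (map f xs))" using Cons.prems by (simp add: mult.assoc)
  finally show ?case using Cons by (simp add: mult.assoc)
qed simp

text \<open>Conjugation by \<open>\<sigma>\<^bsub>a,a+1\<^esub>\<close> turns the factors of index \<open>a\<close> into those of index \<open>a + 1\<close>, which makes the products in the
definition of \<open>Y\<^sub>a\<close> recursive.\<close>

lemma Lpart_rec:
  assumes "a < N"
  shows "Lpart N a = gin a (Suc a) * Lpart N (Suc a) * swp a (Suc a)"
proof -
  let ?s = "swp a (Suc a)"
  have "?s * prod_list (map (\<lambda>b. gin (Suc a) b * swp (Suc a) b) [Suc a + 1..<N + 1])
      = prod_list (map (\<lambda>b. gin a b * swp a b) [Suc a + 1..<N + 1]) * ?s"
  proof (rule conj_prod_list[OF swp_swp])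
    fix b assume "b \<in> set [Suc a + 1..<N + 1]"
    then have "b \<noteq> a" "b \<noteq> Suc a" by auto
    then have "?s * gin (Suc a) b = gin a b * ?s" "?s * swp (Suc a) b = swp a b * ?s"
      using swp_gin[of "Suc a" b a "Suc a"] swp_conj[of a "Suc a" "Suc a" b] by simp_all
    then show "?s * (gin (Suc a) b * swp (Suc a) b) = gin a b * swp a b * ?s"
      by (metis mult.assoc)
  qed
  then have 1: "?s * Lpart N (Suc a) = prod_list (map (\<lambda>b. gin a b * swp a b) [Suc a + 1..<N + 1]) * ?s"
    unfolding Lpart_def .
  have "[a + 1..<N + 1] = Suc a # [Suc a + 1..<N + 1]"
    using assms by (simp add: upt_rec)
  then have "Lpart N a = gin a (Suc a) * ?s * prod_list (map (\<lambda>b. gin a b * swp a b) [Suc a + 1..<N + 1])"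
    by (simp add: Lpart_def)
  also have "\<dots> = gin a (Suc a) * ?s * (prod_list (map (\<lambda>b. gin a b * swp a b) [Suc a + 1..<N + 1]) * ?s) * ?s"
    by (simp only: mult.assoc swp_swp mult_1_right)
  also have "\<dots> = gin a (Suc a) * (?s * ?s) * Lpart N (Suc a) * ?s"
    unfolding 1[symmetric] by (simp only: mult.assoc)
  finally show ?thesis by (simp add: swp_swp)
qed

lemma Rpart_rec:
  assumes "1 \<le> a"
  shows "Rpart (Suc a) = swp a (Suc a) * Rpart a * gop a (Suc a)"
proof -
  let ?s = "swp a (Suc a)"
  have 1: "?s * Rpart a = prod_list (map (\<lambda>b. swp b (Suc a) * gop b (Suc a)) [1..<a]) * ?s"
    unfolding Rpart_def
  proof (rule conj_prod_list[OF swp_swp])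
    fix b assume "b \<in> set [1..<a]"
    then have "b \<noteq> a" "b \<noteq> Suc a" by auto
    then have "?s * gop b a = gop b (Suc a) * ?s" "?s * swp b a = swp b (Suc a) * ?s"
      using swp_gop[of b a a "Suc a"] swp_conj[of a "Suc a" b a] by simp_all
    then show "?s * (swp b a * gop b a) = swp b (Suc a) * gop b (Suc a) * ?s"
      by (metis mult.assoc)
  qed
  have "Rpart (Suc a) = prod_list (map (\<lambda>b. swp b (Suc a) * gop b (Suc a)) [1..<a]) * ?s * gop a (Suc a)"
    using assms by (simp add: Rpart_def mult.assoc)
  then show ?thesis using 1 by simp
qed

text \<open>The three parts of \<open>Y\<^bsub>a+1\<^esub>\<close> are those of \<open>Y\<^sub>a\<close> conjugated by \<open>\<sigma>\<^bsub>a,a+1\<^esub>\<close>, up to factors \<open>G\<^sub>a\<close> on the outside; the inner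
swaps cancel.\<close>

lemma Yop_Suc:
  assumes "1 \<le> a" "a < N"
  shows "Yop N l (Suc a) = gop a (Suc a) * Yop N l a * gop a (Suc a)"
proof -
  let ?s = "swp a (Suc a)"
  have ps: "psh l (Suc a) * ?s = ?s * psh l a"
    using swp_psh[of a "Suc a" l a] by simp
  have "gop a (Suc a) * Lpart N a = (gop a (Suc a) * gin a (Suc a)) * Lpart N (Suc a) * ?s"
    unfolding Lpart_rec[OF assms(2)] by (simp only: mult.assoc)
  then have "gop a (Suc a) * Yop N l a * gop a (Suc a) = Lpart N (Suc a) * (?s * psh l a) * Rpart a * gop a (Suc a)"
    by (simp add: Yop_def gop_gin mult.assoc flip: mult.assoc[of "gop a (Suc a)"])
  also have "\<dots> = Lpart N (Suc a) * psh l (Suc a) * Rpart (Suc a)"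
    unfolding ps[symmetric] Rpart_rec[OF assms(1)] by (simp only: mult.assoc)
  finally show ?thesis by (simp add: Yop_def)
qed

definition rot :: "nat \<Rightarrow> lop" where
  "rot N = prod_list (map (\<lambda>a. swp a (Suc a)) (rev [1..<N]))"

definition wop :: "nat \<Rightarrow> nat \<Rightarrow> lop" where
  "wop N l = rot N * psh l 1"

text \<open>The effect of the rotation on the indices of the variables: \<open>1\<close> goes to \<open>N\<close>, the others are lowered by one.\<close>

definition rotf :: "nat \<Rightarrow> nat \<Rightarrow> nat" where
  "rotf N x = (if N = 0 then x else if x = 1 then N else if 2 \<le> x \<and> x \<le> N then x - 1 else x)"

lemma rot_Suc: "1 \<le> N \<Longrightarrow> rot (Suc N) = swp N (Suc N) * rot N"
  by (simp add: rot_def)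

lemma rotf_Suc: "1 \<le> N \<Longrightarrow> rotf (Suc N) x = transpose N (Suc N) (rotf N x)"
  by (auto simp: rotf_def transpose_def)

lemma alg_hom_rot: "alg_hom (rot N)"
proof (cases "1 \<le> N")
  case True
  then show ?thesis
    by (induction N rule: nat_induct_at_least)
      (simp_all add: rot_Suc alg_hom_comp alg_hom_swp alg_hom_one, simp add: rot_def alg_hom_one)
qed (simp add: rot_def alg_hom_one)

lemma rot_intertwine:
  assumes "1 \<le> N"
  shows "app (rot N) (var_z c) = var_z (rotf N c)"
    and "rot N * swp c d = swp (rotf N c) (rotf N d) * rot N"
    and "rot N * psh l c = psh l (rotf N c) * rot N"
  using assms
proof (induction N rule: nat_induct_at_least)
  case base
  have rotf: "rotf 1 x = x" for x by (auto simp: rotf_def)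
  have rot: "rot 1 = 1" by (simp add: rot_def)
  case 1 show ?case by (simp only: rot rotf app_one)
  case 2 show ?case by (simp only: rot rotf mult_1_left mult_1_right)
  case 3 show ?case by (simp only: rot rotf mult_1_left mult_1_right)
next
  case (Suc N)
  case 1 show ?case using Suc by (simp add: rot_Suc rotf_Suc)
  case 2 
  have "rot (Suc N) * swp c d = swp N (Suc N) * (rot N * swp c d)"
    using Suc by (simp add: rot_Suc mult.assoc)
  also have "\<dots> = (swp N (Suc N) * swp (rotf N c) (rotf N d)) * rot N"
    using Suc by (simp add: mult.assoc)
  finally show ?case using Suc by (simp only: swp_conj[of N] rot_Suc rotf_Suc mult.assoc)
  case 3
  have "rot (Suc N) * psh l c = swp N (Suc N) * (rot N * psh l c)"
    using Suc by (simp add: rot_Suc mult.assoc)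
  also have "\<dots> = (swp N (Suc N) * psh l (rotf N c)) * rot N"
    using Suc by (simp add: mult.assoc)
  finally show ?case using Suc by (simp only: swp_psh[of N] rot_Suc rotf_Suc mult.assoc)
qed

lemma alg_hom_wop: "alg_hom (wop N l)"
  by (simp add: wop_def alg_hom_comp alg_hom_rot alg_hom_psh)

lemma wop_var:
  assumes "1 \<le> N"
  shows "app (wop N l) (var_z c) = const_L (if c = 1 then p_par l else 1) * var_z (rotf N c)"
  using assms by (cases "c = 1") (simp_all add: wop_def psh_var rot_intertwine(1))

lemma psh_commute: "psh l a * psh l b = psh l b * psh l a"
  by (rule lop_eq_on_singles) (simp add: psh_def mult_ac)

lemma wop_gop:
  assumes "1 \<le> i" "Suc i < N"
  shows "wop N l * gop (Suc i) (Suc (Suc i)) = gop i (Suc i) * wop N l"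
proof (rule gop_conj[where c = 1])
  have "psh l 1 * swp (Suc i) (Suc (Suc i)) = swp (Suc i) (Suc (Suc i)) * psh l 1"
    using swp_psh[of "Suc i" "Suc (Suc i)" l 1] assms by simp
  moreover have "rot N * swp (Suc i) (Suc (Suc i)) = swp i (Suc i) * rot N"
    using rot_intertwine(2)[of N "Suc i" "Suc (Suc i)"] assms by (simp add: rotf_def)
  ultimately show "wop N l * swp (Suc i) (Suc (Suc i)) = swp i (Suc i) * wop N l"
    unfolding wop_def by (metis mult.assoc)
qed (use assms in \<open>simp_all add: alg_hom_wop wop_var rotf_def\<close>)

text \<open>Both variables \<open>z\<^sub>1, z\<^sub>2\<close> pass through \<open>p\<close>-shifts once, so that the square of the rotation maps them to \<open>p z\<^bsub>N-1\<^esub>\<close> and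
\<open>p z\<^sub>N\<close>.\<close>

lemma wop_wop_gop:
  assumes "2 \<le> N"
  shows "wop N l * wop N l * gop 1 (Suc 1) = gop (N - 1) (Suc (N - 1)) * wop N l * wop N l"
proof -
  have "wop N l * wop N l * gop 1 2 = gop (N - 1) N * (wop N l * wop N l)"
  proof (rule gop_conj[where c = "p_par l"])
    have "psh l 1 * rot N = rot N * psh l 2"
      using rot_intertwine(3)[of N l 2] assms by (simp add: rotf_def)
    then have w2: "wop N l * wop N l = rot N * rot N * (psh l 2 * psh l 1)"
      unfolding wop_def by (metis mult.assoc)
    have "psh l 1 * swp 1 2 = swp 1 2 * psh l 2" "psh l 2 * swp 1 2 = swp 1 2 * psh l 1"
      using swp_psh[of 1 2 l 2] swp_psh[of 1 2 l 1] by simp_all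
    then have a: "psh l 2 * psh l 1 * swp 1 2 = swp 1 2 * (psh l 2 * psh l 1)"
      by (metis mult.assoc psh_commute)
    have "rot N * swp 1 2 = swp N 1 * rot N"
      using rot_intertwine(2)[of N 1 2] assms by (simp add: rotf_def)
    moreover have "rot N * swp N 1 = swp (N - 1) N * rot N"
      using rot_intertwine(2)[of N N 1] assms by (simp add: rotf_def)
    ultimately have "rot N * rot N * swp 1 2 = swp (N - 1) N * (rot N * rot N)"
      by (metis mult.assoc)
    then show "wop N l * wop N l * swp 1 2 = swp (N - 1) N * (wop N l * wop N l)"
      unfolding w2 using a by (metis mult.assoc)
    show "app (wop N l * wop N l) (var_z 1) = const_L (p_par l) * var_z (N - 1)"
      using assms by (simp add: wop_var rotf_def)
    show "app (wop N l * wop N l) (var_z 2) = const_L (p_par l) * var_z N"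
      using assms by (simp add: wop_var rotf_def)
  qed (use assms in \<open>auto simp: alg_hom_comp alg_hom_wop\<close>)
  then show ?thesis using assms by (simp add: mult.assoc numeral_2_eq_2)
qed

lemma Lpart_closed:
  assumes "a \<le> N"
  shows "Lpart N a = prod_list (map (\<lambda>i. gin i (Suc i)) [a..<N]) * prod_list (map (\<lambda>i. swp i (Suc i)) (rev [a..<N]))"
  using assms
proof (induction "N - a" arbitrary: a)
  case 0 then show ?case by (simp add: Lpart_def)
next
  case (Suc d)
  then have "[a..<N] = a # [Suc a..<N]" by (simp add: upt_rec)
  moreover have "Lpart N (Suc a) = prod_list (map (\<lambda>i. gin i (Suc i)) [Suc a..<N]) * prod_list (map (\<lambda>i. swp i (Suc i)) (rev [Suc a..<N]))"
    using Suc by simp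
  ultimately show ?case using Suc.hyps by (simp add: Lpart_rec mult.assoc)
qed

lemma Yop_1: "1 \<le> N \<Longrightarrow> Yop N l 1 = prod_list (map (\<lambda>i. gin i (Suc i)) [1..<N]) * wop N l"
  by (simp add: Yop_def Rpart_def Lpart_closed wop_def rot_def mult.assoc)

lemma gop_quad: "a \<noteq> b \<Longrightarrow> gop a b * gop a b = scal (q_par - inverse q_par) * gop a b + 1"
  by (rule lop_eqI) (simp add: gop_quadratic const_L_diff)

lemma hecke_interp:
  assumes N: "1 \<le> N"
  shows "affine_hecke_cyclic N (\<lambda>i. gop i (Suc i)) (\<lambda>i. gin i (Suc i)) (wop N l)
    (scal (q_par - inverse q_par)) (Yop N l) (\<lambda>i. mulop (zinv i)) (scal (inverse (p_par l)))"
proof (unfold_locales)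
  show "gop i (Suc i) * gin i (Suc i) = 1" "gin i (Suc i) * gop i (Suc i) = 1" for i
    by (simp_all add: gop_gin gin_gop)
  show "gop i (Suc i) * gop i (Suc i) = scal (q_par - inverse q_par) * gop i (Suc i) + 1" for i
    by (simp add: gop_quad)
  show "scal c * x = x * scal c" for c x by (rule scal_commute)
  then show "scal c * x = x * scal c" for c x .
  show "gop i (Suc i) * gop (Suc i) (Suc (Suc i)) * gop i (Suc i) = gop (Suc i) (Suc (Suc i)) * gop i (Suc i) * gop (Suc i) (Suc (Suc i))" for i
    by (rule gop_braid) auto
  show "gop i (Suc i) * gop j (Suc j) = gop j (Suc j) * gop i (Suc i)" if "Suc i < j" for i j
    using that by (intro gop_gop_commute) auto
  show "wop N l * gop (Suc i) (Suc (Suc i)) = gop i (Suc i) * wop N l" if "1 \<le> i" "Suc i < N" for i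
    using that by (rule wop_gop)
  show "wop N l * wop N l * gop 1 (Suc 1) = gop (N - 1) (Suc (N - 1)) * wop N l * wop N l" if "2 \<le> N"
    using that by (rule wop_wop_gop)
  show "Yop N l 1 = prod_list (map (\<lambda>i. gin i (Suc i)) [1..<N]) * wop N l"
    using N by (rule Yop_1)
  show "Yop N l (Suc a) = gop a (Suc a) * Yop N l a * gop a (Suc a)" if "1 \<le> a" "a < N" for a
    using that by (rule Yop_Suc)
  show "mulop (zinv 1) * gop i (Suc i) = gop i (Suc i) * mulop (zinv 1)" if "2 \<le> i" "i < N" for i
    using that by (intro gop_mulop_commute[symmetric]) auto
  show "gin i (Suc i) * mulop (zinv (Suc i)) = mulop (zinv i) * gop i (Suc i)" for i
    by (rule gin_zinv) simp
  show "gop 1 (Suc 1) * mulop (zinv 1) = mulop (zinv 2) * gin 1 (Suc 1)"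
    using gop_zinv[of 1 2] by (simp add: numeral_2_eq_2)
  show "wop N l * mulop (zinv 2) = mulop (zinv 1) * wop N l" if "2 \<le> N"
    using alg_hom_zinv[OF alg_hom_wop, of N l 2 1 1] wop_var[of N l 2] that
    by (simp add: alg_hom_mulop[OF alg_hom_wop] rotf_def)
  show "wop N l * mulop (zinv 1) = scal (inverse (p_par l)) * mulop (zinv N) * wop N l"
    using alg_hom_zinv[OF alg_hom_wop, of N l 1 "p_par l" N] wop_var[of N l 1] N
    by (simp add: alg_hom_mulop[OF alg_hom_wop] rotf_def mulop_mult)
qed

section \<open>Invariance of the Laurent polynomials in N variables\<close>

abbreviation "LP \<equiv> laurent_polys"

lemma LP_0 [simp]: "0 \<in> LP N" by (simp add: laurent_polys_def)

lemma LP_add: "f \<in> LP N \<Longrightarrow> g \<in> LP N \<Longrightarrow> f + g \<in> LP N"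
  using keys_add[of f g] by (auto simp: laurent_polys_def)

lemma LP_single: "keys e \<subseteq> {1..N} \<Longrightarrow> single e c \<in> LP N"
  by (simp add: laurent_polys_def)

lemma LP_mult:
  assumes "f \<in> LP N" "g \<in> LP N"
  shows "f * g \<in> LP N"
  unfolding laurent_polys_def
proof (intro CollectI ballI)
  fix e assume "e \<in> keys (f * g)"
  then obtain a b where "e = a + b" "a \<in> keys f" "b \<in> keys g"
    using keys_mult by blast
  then show "keys e \<subseteq> {1..N}"
    using assms keys_add[of a b] unfolding laurent_polys_def by blast
qed

lemma LP_const [simp]: "const_L c \<in> LP N"
  unfolding const_L_def by (rule LP_single) simp

lemma LP_1 [simp]: "1 \<in> LP N" using LP_const[of 1 N] by simp

lemma LP_const_mult: "f \<in> LP N \<Longrightarrow> const_L c * f \<in> LP N" by (simp add: LP_mult)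

lemma LP_uminus: "f \<in> LP N \<Longrightarrow> - f \<in> LP N" by (simp add: laurent_polys_def)

lemma LP_diff: "f \<in> LP N \<Longrightarrow> g \<in> LP N \<Longrightarrow> f - g \<in> LP N"
  using LP_add[of f N "- g"] LP_uminus by simp

lemma LP_sum: "(\<And>i. i \<in> A \<Longrightarrow> f i \<in> LP N) \<Longrightarrow> sum f A \<in> LP N"
  by (induction A rule: infinite_finite_induct) (auto intro: LP_add)

lemma LP_power: "f \<in> LP N \<Longrightarrow> f ^ n \<in> LP N"
  by (induction n) (auto intro: LP_mult)

lemma LP_prod: "(\<And>i. i \<in> A \<Longrightarrow> f i \<in> LP N) \<Longrightarrow> prod f A \<in> LP N"
  by (induction A rule: infinite_finite_induct) (auto intro: LP_mult)

lemma LP_var: "1 \<le> a \<Longrightarrow> a \<le> N \<Longrightarrow> var_z a \<in> LP N" "1 \<le> a \<Longrightarrow> a \<le> N \<Longrightarrow> zinv a \<in> LP N"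
  by (simp_all add: var_z_def zinv_def LP_single)

definition pres :: "nat \<Rightarrow> lop \<Rightarrow> bool" where
  "pres N F \<longleftrightarrow> (\<forall>f\<in>LP N. app F f \<in> LP N)"

lemma presD: "pres N F \<Longrightarrow> f \<in> LP N \<Longrightarrow> app F f \<in> LP N" by (simp add: pres_def)

lemma sum_of_singles: "f = (\<Sum>e\<in>keys f. const_L (lookup f e) * single e 1)"
  by (rule poly_mapping_eqI)
    (simp add: const_L_times_single lookup_sum lookup_single when_def sum.delta' in_keys_iff)

lemma pres_on_singles:
  assumes "\<And>e. keys e \<subseteq> {1..N} \<Longrightarrow> app F (single e 1) \<in> LP N"
  shows "pres N F"
  unfolding pres_def
proof
  fix f assume f: "f \<in> LP N"
  have "app F f = (\<Sum>e\<in>keys f. const_L (lookup f e) * app F (single e 1))"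
    using arg_cong[OF sum_of_singles[of f], of "app F"] by (simp add: app_sum)
  moreover have "keys e \<subseteq> {1..N}" if "e \<in> keys f" for e
    using f that unfolding laurent_polys_def by blast
  ultimately show "app F f \<in> LP N"
    using assms by (simp only: LP_sum LP_const_mult)
qed

text \<open>Invariance of \<open>laurent_polys N\<close> is also required from the inverse, because the series in \<open>z\<^sup>-\<^sup>1\<close> involve inverses of
Cherednik operators, taken on the ring in all variables.\<close>

definition unit_pres :: "nat \<Rightarrow> lop \<Rightarrow> bool" where
  "unit_pres N F \<longleftrightarrow> pres N F \<and> (\<exists>B. pres N B \<and> F * B = 1 \<and> B * F = 1)"

lemma unit_presI: "pres N F \<Longrightarrow> pres N B \<Longrightarrow> F * B = 1 \<Longrightarrow> B * F = 1 \<Longrightarrow> unit_pres N F"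
  by (auto simp: unit_pres_def)

lemma unit_pres_mult:
  assumes "unit_pres N F" "unit_pres N G"
  shows "unit_pres N (F * G)"
proof -
  obtain A B where "pres N A" "F * A = 1" "A * F = 1" "pres N B" "G * B = 1" "B * G = 1"
    using assms by (auto simp: unit_pres_def)
  then have "F * G * (B * A) = 1" "B * A * (F * G) = 1"
    by (metis mult.assoc mult_1_left)+
  then show ?thesis
    using assms \<open>pres N A\<close> \<open>pres N B\<close> by (intro unit_presI[where B = "B * A"]) (auto simp: pres_def unit_pres_def)
qed

lemma unit_pres_1: "unit_pres N 1"
  by (rule unit_presI[where B = 1]) (auto simp: pres_def)

lemma unit_pres_prod_list: "(\<And>x. x \<in> set xs \<Longrightarrow> unit_pres N x) \<Longrightarrow> unit_pres N (prod_list xs)"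
  by (induction xs) (auto intro: unit_pres_mult unit_pres_1)

lemma keys_map_key_transpose:
  "keys (map_key (transpose a b) e) = transpose a b ` keys e"
proof -
  have "x \<in> transpose a b ` keys e \<longleftrightarrow> transpose a b x \<in> keys e" for x
    by (metis image_iff transpose_involutory)
  then show ?thesis by (auto simp: in_keys_iff)
qed

lemma swp_LP:
  assumes "a \<in> {1..N}" "b \<in> {1..N}"
  shows "pres N (swp a b)"
  by (rule pres_on_singles, unfold swp_def subop_single, rule LP_single)
    (use assms in \<open>auto simp: keys_map_key_transpose transpose_def\<close>)

lemma app_gop_single:
  assumes "a \<noteq> b"
  shows "app (gop a b) (single e 1) = (RL * var_z a - QL * var_z b) * ddmon a b e + QL * single e 1"
  using div_diff_eqI[OF assms, of "ddmon a b e" "single e 1"] ddmon[OF assms, of e]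
  by (simp add: app_gop[OF assms] g_op_def app_swp)

lemma gop_LP:
  assumes "a \<noteq> b" "a \<in> {1..N}" "b \<in> {1..N}"
  shows "pres N (gop a b)"
proof (rule pres_on_singles)
  fix e :: "nat \<Rightarrow>\<^sub>0 int" assume "keys e \<subseteq> {1..N}"
  then have e: "single e 1 \<in> LP N" by (rule LP_single)
  have "ddmon a b e \<in> LP N"
    unfolding ddmon_def Let_def uab_def using assms e presD[OF swp_LP]
    by (auto intro!: LP_uminus LP_mult LP_sum LP_power LP_var)
  then show "app (gop a b) (single e 1) \<in> LP N"
    unfolding app_gop_single[OF assms(1)] using assms e
    by (auto intro!: LP_add LP_mult LP_diff LP_var)
qed

lemma gin_LP: "a \<noteq> b \<Longrightarrow> a \<in> {1..N} \<Longrightarrow> b \<in> {1..N} \<Longrightarrow> pres N (gin a b)"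
  using gop_LP by (auto simp: pres_def gin_def intro: LP_diff LP_const_mult)

lemma unit_pres_basic:
  assumes "a \<in> {1..N}" "b \<in> {1..N}"
  shows "unit_pres N (swp a b)" "unit_pres N (psh l a)"
    "a \<noteq> b \<Longrightarrow> unit_pres N (gop a b)" "a \<noteq> b \<Longrightarrow> unit_pres N (gin a b)"
    "unit_pres N (mulop (zinv a))" "unit_pres N (mulop (var_z a))"
proof -
  show "unit_pres N (swp a b)"
    using assms by (intro unit_presI[OF swp_LP swp_LP swp_swp swp_swp])
  have "pres N (psh l a)" "pres N (pshi l a)"
    by (rule pres_on_singles, simp add: psh_def pshi_def del: One_nat_def, rule LP_single, assumption)+
  then show "unit_pres N (psh l a)" by (rule unit_presI[OF _ _ psh_pshi pshi_psh])
  show "unit_pres N (gop a b)" if "a \<noteq> b"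
    by (rule unit_presI[OF gop_LP gin_LP gop_gin gin_gop]) (use assms that in auto)
  show "unit_pres N (gin a b)" if "a \<noteq> b"
    by (rule unit_presI[OF gin_LP gop_LP gin_gop gop_gin]) (use assms that in auto)
  have "pres N (mulop (zinv a))" "pres N (mulop (var_z a))"
    using assms by (auto simp: pres_def intro!: LP_mult LP_var)
  then show "unit_pres N (mulop (zinv a))" "unit_pres N (mulop (var_z a))"
    using unit_presI mulop_var_zinv by blast+
qed

lemma unit_pres_Yop:
  assumes "a \<in> {1..N}"
  shows "unit_pres N (Yop N l a)"
  unfolding Yop_def Lpart_def Rpart_def using assms
  by (intro unit_pres_mult unit_pres_prod_list unit_pres_basic(2)[OF assms assms])
    (auto intro!: unit_pres_mult unit_pres_basic)

section \<open>A rank function for the Bruhat order\<close>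

definition rank1 :: "nat \<Rightarrow> (nat \<Rightarrow> int) \<Rightarrow> int" where
  "rank1 N x = (\<Sum>a\<in>{1..N}. (x a)\<^sup>2)"

definition rank2 :: "nat \<Rightarrow> (nat \<Rightarrow> int) \<Rightarrow> int" where
  "rank2 N x = (\<Sum>a\<in>{1..N}. (x a - int a)\<^sup>2)"

text \<open>A squeeze lowers the sum of squares, and an exchange keeps it but moves the entries closer to the increasing vector
\<open>(1, \<dots>, N)\<close>. The Bruhat order is therefore contained in a well-founded lexicographic order that is easy to evaluate.\<close>

definition rank_less :: "nat \<Rightarrow> (nat \<Rightarrow> int) \<Rightarrow> (nat \<Rightarrow> int) \<Rightarrow> bool" where
  "rank_less N x y \<longleftrightarrow> rank1 N x < rank1 N y \<or> rank1 N x = rank1 N y \<and> rank2 N x < rank2 N y"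

lemma rank_nonneg: "rank1 N x \<ge> 0" "rank2 N x \<ge> 0"
  by (simp_all add: rank1_def rank2_def sum_nonneg)

lemma wfp_rank_less: "wfp (rank_less N)"
proof -
  have "rank_less N x y \<Longrightarrow> (x, y) \<in> measures [\<lambda>x. nat (rank1 N x), \<lambda>x. nat (rank2 N x)]" for x y
    using rank_nonneg[of N x] rank_nonneg[of N y] by (auto simp: rank_less_def)
  then have "{(x, y). rank_less N x y} \<subseteq> measures [\<lambda>x. nat (rank1 N x), \<lambda>x. nat (rank2 N x)]"
    by auto
  then show ?thesis
    unfolding wfp_def using wf_measures wf_subset by blast
qed

lemma sum_two:
  assumes "finite A" "i \<in> A" "j \<in> A" "i \<noteq> j"
  shows "sum f A = f i + f j + sum f (A - {i, j})"
proof -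
  have "A = insert i (insert j (A - {i, j}))" using assms by auto
  then have "sum f A = sum f (insert i (insert j (A - {i, j})))" by simp
  then show ?thesis using assms by (simp add: add.assoc)
qed

lemma rank_two:
  assumes "i \<in> {1..N}" "j \<in> {1..N}" "i \<noteq> j" "\<And>a. a \<noteq> i \<Longrightarrow> a \<noteq> j \<Longrightarrow> y a = x a"
  shows "rank1 N y - rank1 N x = (y i)\<^sup>2 + (y j)\<^sup>2 - (x i)\<^sup>2 - (x j)\<^sup>2"
    and "rank2 N y - rank2 N x = (y i - int i)\<^sup>2 + (y j - int j)\<^sup>2 - (x i - int i)\<^sup>2 - (x j - int j)\<^sup>2"
proof -
  have "(\<Sum>a\<in>{1..N} - {i, j}. (y a)\<^sup>2) = (\<Sum>a\<in>{1..N} - {i, j}. (x a)\<^sup>2)"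
    "(\<Sum>a\<in>{1..N} - {i, j}. (y a - int a)\<^sup>2) = (\<Sum>a\<in>{1..N} - {i, j}. (x a - int a)\<^sup>2)"
    using assms(4) by (auto intro!: sum.cong)
  then show "rank1 N y - rank1 N x = (y i)\<^sup>2 + (y j)\<^sup>2 - (x i)\<^sup>2 - (x j)\<^sup>2"
    "rank2 N y - rank2 N x = (y i - int i)\<^sup>2 + (y j - int j)\<^sup>2 - (x i - int i)\<^sup>2 - (x j - int j)\<^sup>2"
    unfolding rank1_def rank2_def
    using sum_two[OF _ assms(1-3), of "\<lambda>a. (y a)\<^sup>2"] sum_two[OF _ assms(1-3), of "\<lambda>a. (x a)\<^sup>2"]
      sum_two[OF _ assms(1-3), of "\<lambda>a. (y a - int a)\<^sup>2"] sum_two[OF _ assms(1-3), of "\<lambda>a. (x a - int a)\<^sup>2"]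
    by simp_all
qed

lemma rank_less_exchange:
  assumes "i \<in> {1..N}" "j \<in> {1..N}" "i < j" "x i > x j"
  shows "rank_less N (x \<circ> transpose i j) x"
proof -
  have 0: "(x i - x j) * (int j - int i) > 0" using assms by simp
  have "rank1 N (x \<circ> transpose i j) = rank1 N x"
    using rank_two(1)[of i N j "x \<circ> transpose i j" x] assms by (simp add: transpose_apply_other)
  moreover have "rank2 N (x \<circ> transpose i j) - rank2 N x = - 2 * ((x i - x j) * (int j - int i))"
    using rank_two(2)[of i N j "x \<circ> transpose i j" x] assms
    by (simp add: transpose_apply_other power2_eq_square algebra_simps)
  ultimately show ?thesis using 0 by (simp add: rank_less_def)
qed

lemma bruhat_step_rank_less: "bruhat_step N x y \<Longrightarrow> rank_less N x y"
proof (induction rule: bruhat_step.induct)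
  case (exchange i j x)
  then show ?case by (intro rank_less_exchange) auto
next
  case (squeeze i j x)
  have "rank1 N (x(i := x i - 1, j := x j + 1)) - rank1 N x = - 2 * (x i - x j - 1)"
    using squeeze rank_two(1)[of i N j "x(i := x i - 1, j := x j + 1)" x]
    by (simp add: power2_eq_square algebra_simps)
  moreover have "rank1 N (x \<circ> transpose i j) = rank1 N x"
    using rank_two(1)[of i N j "x \<circ> transpose i j" x] squeeze by (simp add: transpose_apply_other)
  ultimately have "rank1 N (x(i := x i - 1, j := x j + 1)) < rank1 N (x \<circ> transpose i j)"
  proof -
    assume 1: "rank1 N (x(i := x i - 1, j := x j + 1)) - rank1 N x = - 2 * (x i - x j - 1)"
      and 2: "rank1 N (x \<circ> transpose i j) = rank1 N x"
    have "rank1 N (x(i := x i - 1, j := x j + 1)) - rank1 N x < 0"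
      unfolding 1 using squeeze by simp
    then show ?thesis unfolding 2 by simp
  qed
  then show ?case unfolding rank_less_def ..
qed

lemma bruhat_rank_less: "bruhat_less N x y \<Longrightarrow> rank_less N x y"
  unfolding bruhat_less_def
proof (induction rule: tranclp_induct)
  case (base y) then show ?case by (rule bruhat_step_rank_less)
next
  case (step y z)
  then show ?case using bruhat_step_rank_less[of N y z] by (auto simp: rank_less_def)
qed

lemma rank_cong:
  assumes "\<And>a. a \<in> {1..N} \<Longrightarrow> x a = y a"
  shows "rank1 N x = rank1 N y" "rank2 N x = rank2 N y"
  unfolding rank1_def rank2_def using assms by (auto intro!: sum.cong)

lemma bruhat_trans: "bruhat_less N x y \<Longrightarrow> bruhat_less N y z \<Longrightarrow> bruhat_less N x z"
  unfolding bruhat_less_def by (rule tranclp_trans)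

subsection \<open>Changing two coordinates\<close>

lemma bruhat_exchange2:
  assumes "1 \<le> a" "a < b" "b \<le> N" "u > v"
  shows "bruhat_less N (m(a := v, b := u)) (m(a := u, b := v))"
proof -
  have "bruhat_step N (m(a := u, b := v) \<circ> transpose a b) (m(a := u, b := v))"
    using assms by (intro bruhat_step.exchange) auto
  moreover have "m(a := u, b := v) \<circ> transpose a b = m(a := v, b := u)"
    using assms by (auto simp: fun_eq_iff transpose_def)
  ultimately show ?thesis unfolding bruhat_less_def by auto
qed

lemma bruhat_squeeze2:
  assumes "1 \<le> a" "a < b" "b \<le> N" "u - v > 1"
  shows "bruhat_less N (m(a := u - 1, b := v + 1)) (m(a := v, b := u))"
proof -
  let ?x = "m(a := u, b := v)"
  have "bruhat_step N (?x(a := ?x a - 1, b := ?x b + 1)) (?x \<circ> transpose a b)"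
    using assms by (intro bruhat_step.squeeze) auto
  moreover have "?x \<circ> transpose a b = m(a := v, b := u)"
    using assms by (auto simp: fun_eq_iff transpose_def)
  moreover have "?x(a := ?x a - 1, b := ?x b + 1) = m(a := u - 1, b := v + 1)"
    using assms by (auto simp: fun_eq_iff)
  ultimately show ?thesis unfolding bruhat_less_def by auto
qed

text \<open>Squeezing the entries one step at a time, and exchanging them when needed, reaches every pair strictly between \<open>x\<close> and \<open>y\<close>
with the same sum.\<close>

lemma bruhat_between:
  assumes ab: "1 \<le> a" "a < b" "b \<le> N" and "x < u" "u < y" "u + v = x + y"
  shows "bruhat_less N (m(a := u, b := v)) (m(a := x, b := y))"
  using assms(4-6)
proof (induction "nat (y - x)" arbitrary: x y rule: less_induct)
  case less
  have first: "bruhat_less N (m(a := y - 1, b := x + 1)) (m(a := x, b := y))"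
    using less.prems by (intro bruhat_squeeze2[OF ab]) auto
  show ?case
  proof (cases "u = y - 1")
    case True
    then have "y - 1 = u" "x + 1 = v" using less.prems by auto
    then show ?thesis using first by (simp only:)
  next
    case False
    then have "x + 1 < y - 1" using less.prems by simp
    then have second: "bruhat_less N (m(a := x + 1, b := y - 1)) (m(a := x, b := y))"
      using bruhat_exchange2[OF ab, of "x + 1" "y - 1" m] first bruhat_trans by blast
    show ?thesis
    proof (cases "u = x + 1")
      case True
      then have "x + 1 = u" "y - 1 = v" using less.prems by auto
      then show ?thesis using second by (simp only:)
    next
      case False
      then have "bruhat_less N (m(a := u, b := v)) (m(a := x + 1, b := y - 1))"
        using less.prems \<open>u \<noteq> y - 1\<close> by (intro less.hyps) auto
      then show ?thesis using second bruhat_trans by blast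
    qed
  qed
qed

lemma bruhat_inside_asc:
  assumes "1 \<le> a" "a < b" "b \<le> N" "m a < u" "u < m b" "u + v = m a + m b"
  shows "bruhat_less N (m(a := u, b := v)) m"
  using bruhat_between[OF assms(1-3), of "m a" u "m b" v m] assms by simp

lemma bruhat_inside_desc:
  assumes "1 \<le> a" "a < b" "b \<le> N" "m b \<le> u" "u < m a" "u + v = m a + m b"
  shows "bruhat_less N (m(a := u, b := v)) m"
proof -
  have ex: "bruhat_less N (m(a := m b, b := m a)) m"
    using bruhat_exchange2[OF assms(1-3), of "m b" "m a" m] assms by simp
  show ?thesis
  proof (cases "u = m b")
    case True
    then show ?thesis using ex assms by simp
  next
    case False
    then show ?thesis
      using bruhat_between[OF assms(1-3), of "m b" u "m a" v m] ex assms bruhat_trans by auto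
  qed
qed

section \<open>Triangular operators\<close>

lemma lookup_exponent [simp]: "lookup (exponent N m) a = (if a \<in> {1..N} then m a else 0)"
  by (simp add: exponent_def lookup_sum lookup_single when_def sum.delta)

lemma exponent_eq_iff: "exponent N m = exponent N n \<longleftrightarrow> (\<forall>a\<in>{1..N}. m a = n a)"
  by (auto simp: poly_mapping_eq_iff fun_eq_iff)

lemma keys_exponent: "keys (exponent N m) \<subseteq> {1..N}"
  by (auto simp: in_keys_iff split: if_splits)

lemma z_monom_LP: "z_monom N m \<in> LP N"
  unfolding z_monom_def by (rule LP_single[OF keys_exponent])

definition lower :: "nat \<Rightarrow> (nat \<Rightarrow> int) \<Rightarrow> laurent set" where
  "lower N m = {f. keys f \<subseteq> exponent N ` {n. bruhat_less N n m}}"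

lemma low_0 [simp]: "0 \<in> lower N m" by (simp add: lower_def)
lemma low_add: "f \<in> lower N m \<Longrightarrow> g \<in> lower N m \<Longrightarrow> f + g \<in> lower N m"
  using keys_add[of f g] unfolding lower_def by blast
lemma low_const: "f \<in> lower N m \<Longrightarrow> const_L c * f \<in> lower N m"
  unfolding lower_def by (auto simp: in_keys_iff lookup_const_L_times subset_iff)
lemma low_uminus: "f \<in> lower N m \<Longrightarrow> - f \<in> lower N m"
  by (simp add: lower_def)
lemma low_diff: "f \<in> lower N m \<Longrightarrow> g \<in> lower N m \<Longrightarrow> f - g \<in> lower N m"
  using low_add[of f N m "- g"] low_uminus by simp
lemma low_sum: "(\<And>i. i \<in> A \<Longrightarrow> f i \<in> lower N m) \<Longrightarrow> sum f A \<in> lower N m"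
  by (induction A rule: infinite_finite_induct) (auto intro: low_add)
lemma low_monom: "bruhat_less N n m \<Longrightarrow> z_monom N n \<in> lower N m"
  by (auto simp: lower_def z_monom_def)
lemma low_mono: "f \<in> lower N n \<Longrightarrow> bruhat_less N n m \<Longrightarrow> f \<in> lower N m"
  using bruhat_trans unfolding lower_def by blast

text \<open>Triangularity with respect to the Bruhat order on monomials, with diagonal \<open>d\<close>; being closed under composition, it can be
checked on factors.\<close>

definition triangular :: "nat \<Rightarrow> lop \<Rightarrow> ((nat \<Rightarrow> int) \<Rightarrow> coef) \<Rightarrow> bool" where
  "triangular N L d \<longleftrightarrow> (\<forall>m. app L (z_monom N m) - const_L (d m) * z_monom N m \<in> lower N m)"

lemma tri_low:
  assumes "triangular N L d" "f \<in> lower N m"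
  shows "app L f \<in> lower N m"
proof -
  have "app L f = (\<Sum>e\<in>keys f. const_L (lookup f e) * app L (single e 1))"
    using arg_cong[OF sum_of_singles[of f], of "app L"] by (simp add: app_sum)
  moreover have "app L (single e 1) \<in> lower N m" if "e \<in> keys f" for e
  proof -
    obtain n where n: "e = exponent N n" "bruhat_less N n m"
      using assms(2) \<open>e \<in> keys f\<close> unfolding lower_def by blast
    have "app L (z_monom N n) - const_L (d n) * z_monom N n \<in> lower N m"
      using assms(1) n(2) low_mono unfolding triangular_def by blast
    then have "app L (z_monom N n) - const_L (d n) * z_monom N n + const_L (d n) * z_monom N n \<in> lower N m"
      by (rule low_add) (intro low_const low_monom n)
    then show ?thesis by (simp add: z_monom_def n)
  qed
  ultimately show ?thesis by (auto intro!: low_sum low_const)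
qed

lemma tri_1: "triangular N 1 (\<lambda>_. 1)" by (simp add: triangular_def)

lemma tri_mult:
  assumes "triangular N L d" "triangular N L' d'"
  shows "triangular N (L * L') (\<lambda>m. d m * d' m)"
  unfolding triangular_def
proof
  fix m :: "nat \<Rightarrow> int"
  have 1: "app L (app L' (z_monom N m) - const_L (d' m) * z_monom N m) \<in> lower N m"
    using assms tri_low unfolding triangular_def by blast
  have 2: "const_L (d' m) * (app L (z_monom N m) - const_L (d m) * z_monom N m) \<in> lower N m"
    using assms low_const unfolding triangular_def by blast
  show "app (L * L') (z_monom N m) - const_L (d m * d' m) * z_monom N m \<in> lower N m"
    using low_add[OF 1 2] by (simp add: const_L_mult right_diff_distrib mult.left_commute mult.assoc)
qed

lemma tri_prod_list:
  assumes "\<And>x. x \<in> set xs \<Longrightarrow> triangular N (F x) (d x)"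
  shows "triangular N (prod_list (map F xs)) (\<lambda>m. prod_list (map (\<lambda>x. d x m) xs))"
  using assms by (induction xs) (auto intro!: tri_1 tri_mult)

lemma tri_scal_diff: "triangular N L d \<Longrightarrow> triangular N (L - scal c) (\<lambda>m. d m - c)"
  unfolding triangular_def by (simp add: const_L_diff left_diff_distrib)

lemma tri_psh: "a \<in> {1..N} \<Longrightarrow> triangular N (psh l a) (\<lambda>m. p_par l powi m a)"
  unfolding triangular_def by (simp add: psh_def z_monom_def const_L_times_single)

subsection \<open>The two-variable factors\<close>

lemma z_monom_uab:
  assumes "a \<in> {1..N}" "b \<in> {1..N}" "a \<noteq> b"
  shows "z_monom N m * uab a b ^ i = z_monom N (m(a := m a - int i, b := m b + int i))"
proof -
  have "exponent N m + (single b (int i) - single a (int i))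
      = exponent N (m(a := m a - int i, b := m b + int i))"
    by (rule poly_mapping_eqI) (use assms in \<open>auto simp: lookup_add lookup_minus lookup_single when_def\<close>)
  then show ?thesis by (simp add: z_monom_def uab_power mult_single)
qed

lemma swp_z_monom:
  assumes "a \<in> {1..N}" "b \<in> {1..N}"
  shows "app (swp a b) (z_monom N m) = z_monom N (m \<circ> transpose a b)"
proof -
  have "map_key (transpose a b) (exponent N m) = exponent N (m \<circ> transpose a b)"
    by (rule poly_mapping_eqI) (use assms in \<open>auto simp: transpose_def\<close>)
  then show ?thesis by (simp add: z_monom_def swp_def)
qed

lemma uab_geometric: "uab a b * (\<Sum>i<n. uab a b ^ i) = (\<Sum>i<n. uab a b ^ i) + uab a b ^ n - 1"
  using one_diff_power_eq[of "uab a b" n] by (simp add: algebra_simps)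

lemma numerator_zinv: "(RL * var_z a - QL * var_z b) * (M * zinv a * S) = RL * M * S - QL * M * (uab a b * S)"
  using var_zinv(1)[of a] unfolding uab_def by algebra

text \<open>The formula is a geometric sum obtained from the explicit divided difference; the interior exponents form the segment
between the exponent and its swap.\<close>

lemma gop_z_monom_ge:
  assumes "a \<in> {1..N}" "b \<in> {1..N}" "a \<noteq> b" "m b \<le> m a"
  shows "app (gop a b) (z_monom N m) = (QL - RL) * (\<Sum>i<nat (m a - m b). z_monom N (m(a := m a - int i, b := m b + int i)))
     + QL * z_monom N (m \<circ> transpose a b)"
proof -
  define n M S where "n = nat (m a - m b)" and "M = z_monom N m" and "S = (\<Sum>i<n. uab a b ^ i)"
  have dd: "ddmon a b (exponent N m) = - (M * zinv a * S)"
    using assms unfolding ddmon_def Let_def by (simp add: n_def M_def S_def z_monom_def)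
  have Mn: "M * uab a b ^ n = z_monom N (m \<circ> transpose a b)"
    unfolding M_def z_monom_uab[OF assms(1-3)] using assms
    by (intro arg_cong[where f = "z_monom N"]) (auto simp: fun_eq_iff transpose_def n_def)
  have "app (gop a b) M = (RL * var_z a - QL * var_z b) * ddmon a b (exponent N m) + QL * M"
    using app_gop_single[OF assms(3), of "exponent N m"] unfolding M_def z_monom_def .
  also have "\<dots> = - ((RL * var_z a - QL * var_z b) * (M * zinv a * S)) + QL * M"
    unfolding dd by simp
  also have "\<dots> = (QL - RL) * (M * S) + QL * (M * uab a b ^ n)"
    unfolding numerator_zinv unfolding S_def uab_geometric by (simp add: algebra_simps)
  also have "M * S = (\<Sum>i<n. z_monom N (m(a := m a - int i, b := m b + int i)))"
    unfolding S_def sum_distrib_left M_def z_monom_uab[OF assms(1-3)] ..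
  finally show ?thesis unfolding Mn unfolding M_def n_def .
qed

lemma gop_z_monom_less:
  assumes "a \<in> {1..N}" "b \<in> {1..N}" "a \<noteq> b" "m a < m b"
  shows "app (gop a b) (z_monom N m) = (RL - QL) * (\<Sum>i<nat (m b - m a). z_monom N (m(a := m b - int i, b := m a + int i)))
     + QL * z_monom N (m \<circ> transpose a b)"
proof -
  define n M S where "n = nat (m b - m a)" and "M = z_monom N (m \<circ> transpose a b)" and "S = (\<Sum>i<n. uab a b ^ i)"
  have dd: "ddmon a b (exponent N m) = M * zinv a * S"
    using assms swp_z_monom[OF assms(1,2), of m] unfolding ddmon_def Let_def by (simp add: n_def M_def S_def z_monom_def)
  have upd: "(m \<circ> transpose a b)(a := (m \<circ> transpose a b) a - int i, b := (m \<circ> transpose a b) b + int i)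
      = m(a := m b - int i, b := m a + int i)" for i
    by (auto simp: fun_eq_iff transpose_def)
  have Mn: "M * uab a b ^ n = z_monom N m"
    unfolding M_def z_monom_uab[OF assms(1-3)] upd using assms
    by (intro arg_cong[where f = "z_monom N"]) (auto simp: fun_eq_iff n_def)
  have "app (gop a b) (z_monom N m) = (RL * var_z a - QL * var_z b) * ddmon a b (exponent N m) + QL * (M * uab a b ^ n)"
    using app_gop_single[OF assms(3), of "exponent N m"] unfolding Mn unfolding z_monom_def .
  also have "\<dots> = (RL * var_z a - QL * var_z b) * (M * zinv a * S) + QL * (M * uab a b ^ n)"
    unfolding dd ..
  also have "\<dots> = (RL - QL) * (M * S) + QL * M"
    unfolding numerator_zinv unfolding S_def uab_geometric by (simp add: algebra_simps)
  also have "M * S = (\<Sum>i<n. z_monom N (m(a := m b - int i, b := m a + int i)))"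
    unfolding S_def sum_distrib_left M_def z_monom_uab[OF assms(1-3)] upd ..
  finally show ?thesis unfolding M_def n_def .
qed

lemma transpose_upd: "a \<noteq> b \<Longrightarrow> m(a := u, b := v) \<circ> transpose a b = m(a := v, b := u)"
  by (auto simp: fun_eq_iff transpose_def)

lemma low_coeff: "f \<in> lower N m \<Longrightarrow> (QL - RL) * f \<in> lower N m" "f \<in> lower N m \<Longrightarrow> (RL - QL) * f \<in> lower N m"
  using low_const[of f N m "q_par - inverse q_par"] low_const[of f N m "inverse q_par - q_par"]
  by (simp_all add: const_L_diff)

lemma sum_split_first: "(\<Sum>i<(n :: nat). f i) = (if n = 0 then 0 else f 0 + (\<Sum>i\<in>{1..<n}. f i :: laurent))"
  by (cases n) (simp_all add: lessThan_atLeast0 sum.atLeast_Suc_lessThan)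

text \<open>In both cases the monomials other than \<open>z\<^sup>m\<close> have exponents between \<open>m\<close> and its exchange. If \<open>m\<^sub>a < m\<^sub>b\<close>, the exchanged
exponent is higher than \<open>m\<close>, but it does not occur, and the first summand of the geometric sum changes the diagonal
entry from \<open>q\<close> to \<open>q\<^sup>-\<^sup>1\<close>.\<close>

lemma tri_swp_gop:
  assumes ab: "1 \<le> a" "a < b" "b \<le> N"
  shows "triangular N (swp a b * gop a b) (\<lambda>m. if m b \<le> m a then q_par else inverse q_par)"
  unfolding triangular_def
proof
  fix m :: "nat \<Rightarrow> int"
  have in12: "a \<in> {1..N}" "b \<in> {1..N}" "a \<noteq> b" using ab by auto
  have ho: "app (swp a b) (QL * f) = QL * app (swp a b) f" "app (swp a b) ((QL - RL) * f) = (QL - RL) * app (swp a b) f"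
    "app (swp a b) ((RL - QL) * f) = (RL - QL) * app (swp a b) f" for f
    by (simp_all add: alg_hom_mult[OF alg_hom_swp] alg_hom_const[OF alg_hom_swp])
  show "app (swp a b * gop a b) (z_monom N m) - const_L (if m b \<le> m a then q_par else inverse q_par) * z_monom N m \<in> lower N m"
  proof (cases "m b \<le> m a")
    case True
    have "app (swp a b * gop a b) (z_monom N m) = (QL - RL) * (\<Sum>i<nat (m a - m b). z_monom N (m(a := m b + int i, b := m a - int i))) + QL * z_monom N m"
      unfolding app_times gop_z_monom_ge[OF in12 True] app_add ho app_sum swp_z_monom[OF in12(1,2)] transpose_upd[OF in12(3)]
      by (simp add: comp_assoc)
    moreover have "(QL - RL) * (\<Sum>i<nat (m a - m b). z_monom N (m(a := m b + int i, b := m a - int i))) \<in> lower N m"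
      by (intro low_coeff low_sum low_monom bruhat_inside_desc[OF ab]) auto
    ultimately show ?thesis using True by simp
  next
    case False
    then have lt: "m a < m b" by simp
    have "app (swp a b * gop a b) (z_monom N m) = (RL - QL) * (\<Sum>i<nat (m b - m a). z_monom N (m(a := m a + int i, b := m b - int i))) + QL * z_monom N m"
      unfolding app_times gop_z_monom_less[OF in12 lt] app_add ho app_sum swp_z_monom[OF in12(1,2)] transpose_upd[OF in12(3)]
      by (simp add: comp_assoc)
    also have "\<dots> = (RL - QL) * (\<Sum>i\<in>{1..<nat (m b - m a)}. z_monom N (m(a := m a + int i, b := m b - int i))) + RL * z_monom N m"
      unfolding sum_split_first using lt by (simp add: algebra_simps)
    finally have "app (swp a b * gop a b) (z_monom N m) - RL * z_monom N m
        = (RL - QL) * (\<Sum>i\<in>{1..<nat (m b - m a)}. z_monom N (m(a := m a + int i, b := m b - int i)))"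
      by simp
    also have "\<dots> \<in> lower N m"
      by (intro low_coeff low_sum low_monom bruhat_inside_asc[OF ab]) auto
    finally show ?thesis using False by simp
  qed
qed

lemma tri_gin_swp:
  assumes ab: "1 \<le> a" "a < b" "b \<le> N"
  shows "triangular N (gin a b * swp a b) (\<lambda>m. if m b \<le> m a then inverse q_par else q_par)"
  unfolding triangular_def
proof
  fix m :: "nat \<Rightarrow> int"
  have in12: "a \<in> {1..N}" "b \<in> {1..N}" "a \<noteq> b" using ab by auto
  let ?m = "m \<circ> transpose a b"
  have m2: "?m \<circ> transpose a b = m" by (simp add: comp_assoc)
  have upd: "?m(a := u, b := v) = m(a := u, b := v)" for u v
    by (auto simp: fun_eq_iff transpose_def)
  have sw: "z_monom N ?m = z_monom N (m(a := m b, b := m a))"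
    by (intro arg_cong[where f = "z_monom N"]) (auto simp: fun_eq_iff transpose_def)
  have e: "app (gin a b * swp a b) (z_monom N m) = app (gop a b) (z_monom N ?m) - (QL - RL) * z_monom N ?m"
    by (simp add: gin_def swp_z_monom[OF in12(1,2)] const_L_diff)
  show "app (gin a b * swp a b) (z_monom N m) - const_L (if m b \<le> m a then inverse q_par else q_par) * z_monom N m \<in> lower N m"
  proof (cases "m b < m a")
    case True
    then have lt: "?m a < ?m b" by simp
    have "app (gin a b * swp a b) (z_monom N m) = (RL - QL) * (\<Sum>i<nat (m a - m b). z_monom N (m(a := m a - int i, b := m b + int i))) + QL * z_monom N m
        - (QL - RL) * z_monom N ?m"
      unfolding e gop_z_monom_less[OF in12 lt] m2 upd by simp
    also have "\<dots> = (RL - QL) * (\<Sum>i\<in>{1..<nat (m a - m b)}. z_monom N (m(a := m a - int i, b := m b + int i))) + RL * z_monom N m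
       - (QL - RL) * z_monom N (m(a := m b, b := m a))"
      unfolding sum_split_first sw using True by (simp add: algebra_simps)
    finally have "app (gin a b * swp a b) (z_monom N m) - RL * z_monom N m
       = (RL - QL) * (\<Sum>i\<in>{1..<nat (m a - m b)}. z_monom N (m(a := m a - int i, b := m b + int i)))
          - (QL - RL) * z_monom N (m(a := m b, b := m a))"
      by simp
    also have "\<dots> \<in> lower N m"
      using True by (intro low_diff low_coeff low_sum low_monom bruhat_inside_desc[OF ab]) auto
    finally show ?thesis using True by simp
  next
    case False
    then have ge: "?m b \<le> ?m a" by simp
    have f: "app (gin a b * swp a b) (z_monom N m) = (QL - RL) * (\<Sum>i<nat (m b - m a). z_monom N (m(a := m b - int i, b := m a + int i))) + QL * z_monom N m
        - (QL - RL) * z_monom N (m(a := m b, b := m a))"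
      unfolding e gop_z_monom_ge[OF in12 ge] m2 upd unfolding sw by simp
    show ?thesis
    proof (cases "m a = m b")
      case True
      have "m(a := m b, b := m a) = m" using True by (auto simp: fun_eq_iff)
      then show ?thesis using True unfolding f by (simp add: algebra_simps)
    next
      case neq: False
      have "app (gin a b * swp a b) (z_monom N m) - QL * z_monom N m
         = (QL - RL) * (\<Sum>i\<in>{1..<nat (m b - m a)}. z_monom N (m(a := m b - int i, b := m a + int i)))"
        unfolding f sum_split_first using False neq by (simp add: algebra_simps)
      also have "\<dots> \<in> lower N m"
        by (intro low_coeff low_sum low_monom bruhat_inside_asc[OF ab]) auto
      finally show ?thesis using False neq by simp
    qed
  qed
qed

subsection \<open>Eigenvalues\<close>

lemma sum_signs:
  "finite A \<Longrightarrow> (\<Sum>b\<in>A. if P b then 1 else - 1 :: int) = 2 * int (card {b\<in>A. P b}) - int (card A)"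
proof (induction A rule: finite_induct)
  case (insert x A)
  have "{b \<in> insert x A. P b} = (if P x then insert x {b\<in>A. P b} else {b\<in>A. P b})" by auto
  then show ?case using insert by simp
qed simp

lemma prod_list_q_powi: "prod_list (map (\<lambda>b. q_par powi e b) xs) = q_par powi sum_list (map e xs)"
  by (induction xs) (simp_all add: power_int_add)

text \<open>Each index \<open>b \<noteq> a\<close> contributes a factor \<open>q\<close> or \<open>q\<^sup>-\<^sup>1\<close>, and the number of factors \<open>q\<close> is counted by \<open>sigma_rank\<close>, which also
counts \<open>a\<close> itself.\<close>

lemma tri_Yop:
  assumes "a \<in> {1..N}"
  shows "triangular N (Yop N l a) (\<lambda>m. zeta N l m a)"
proof -
  let ?L = "\<lambda>m b. if m b \<le> (m a :: int) then inverse q_par else q_par"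
  let ?R = "\<lambda>m b. if m a \<le> (m b :: int) then q_par else inverse q_par"
  have "triangular N (Yop N l a) (\<lambda>m. prod_list (map (?L m) [a + 1..<N + 1]) * p_par l powi m a * prod_list (map (?R m) [1..<a]))"
    unfolding Yop_def Lpart_def Rpart_def
    by (intro tri_mult tri_prod_list tri_psh tri_gin_swp tri_swp_gop) (use assms in auto)
  moreover have "prod_list (map (?L m) [a + 1..<N + 1]) * p_par l powi m a * prod_list (map (?R m) [1..<a]) = zeta N l m a" for m
  proof -
    define e1 e2 where "e1 = (\<lambda>b. if m b > m a then 1 else - 1 :: int)" and "e2 = (\<lambda>b. if m b \<ge> m a then 1 else - 1 :: int)"
    have L: "?L m = (\<lambda>b. q_par powi e1 b)" and R: "?R m = (\<lambda>b. q_par powi e2 b)"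
      by (auto simp: fun_eq_iff power_int_minus e1_def e2_def)
    have 1: "sum_list (map e1 [a + 1..<N + 1]) = 2 * int (card {b \<in> {a + 1..<N + 1}. m b > m a}) - int (N - a)"
      unfolding interv_sum_list_conv_sum_set_nat set_upt e1_def by (simp add: sum_signs del: One_nat_def)
    have 2: "sum_list (map e2 [1..<a]) = 2 * int (card {b \<in> {1..<a}. m b \<ge> m a}) - int (a - 1)"
      unfolding interv_sum_list_conv_sum_set_nat set_upt e2_def by (simp add: sum_signs del: One_nat_def)
    have 3: "{b \<in> {1..N}. b > a \<and> m b > m a} = {b \<in> {a + 1..<N + 1}. m b > m a}"
      and 4: "{b \<in> {1..N}. b \<le> a \<and> m b \<ge> m a} = insert a {b \<in> {1..<a}. m b \<ge> m a}"
      using assms by auto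
    have "card (insert a {b \<in> {1..<a}. m b \<ge> m a}) = Suc (card {b \<in> {1..<a}. m b \<ge> m a})"
      by (rule card_insert_disjoint) auto
    then have exps: "sum_list (map e1 [a + 1..<N + 1]) + sum_list (map e2 [1..<a]) = 2 * int (sigma_rank N m a) - int N - 1"
      using assms unfolding 1 2 sigma_rank_def 3 4 by (simp add: of_nat_diff)
    have "prod_list (map (?L m) [a + 1..<N + 1]) * p_par l powi m a * prod_list (map (?R m) [1..<a])
       = p_par l powi m a * q_par powi (sum_list (map e1 [a + 1..<N + 1]) + sum_list (map e2 [1..<a]))"
      unfolding L R prod_list_q_powi power_int_add[OF disjI1[OF q_par_neq_0]] by (simp only: mult_ac)
    then show ?thesis unfolding exps zeta_def .
  qed
  ultimately show ?thesis by simp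
qed

section \<open>Existence and uniqueness of the nonsymmetric Macdonald polynomials\<close>

lemma eigenvalues_separate:
  assumes "l > 0" "bruhat_less N n m"
  shows "\<exists>a\<in>{1..N}. zeta N l n a \<noteq> zeta N l m a"
proof (rule ccontr)
  assume "\<not> (\<exists>a\<in>{1..N}. zeta N l n a \<noteq> zeta N l m a)"
  then have "\<And>a. a \<in> {1..N} \<Longrightarrow> n a = m a"
    unfolding zeta_def using p_q_monomials_distinct[OF assms(1)] by blast
  then show False
    using bruhat_rank_less[OF assms(2)] rank_cong[of N n m] by (auto simp: rank_less_def)
qed

context
  fixes N l :: nat and m :: "nat \<Rightarrow> int"
  assumes N: "N \<ge> 1" and l: "l > 0"
begin

text \<open>An index at which the eigenvalues at \<open>n\<close> and at \<open>m\<close> differ, for \<open>n\<close> below \<open>m\<close>.\<close>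

definition sepix :: "(nat \<Rightarrow> int) \<Rightarrow> nat" where
  "sepix n = (SOME a. a \<in> {1..N} \<and> zeta N l n a \<noteq> zeta N l m a)"

text \<open>This operator removes the leading term \<open>z\<^sup>n\<close> by triangularity, yet it multiplies an eigenvector with the eigenvalues at
\<open>m\<close> by a nonzero scalar.\<close>

definition killer :: "(nat \<Rightarrow> int) \<Rightarrow> lop" where
  "killer n = Yop N l (sepix n) - scal (zeta N l n (sepix n))"

definition kill :: "(nat \<Rightarrow> int) list \<Rightarrow> lop" where
  "kill ns = prod_list (map killer ns)"

definition below :: "(nat \<Rightarrow> int) list \<Rightarrow> bool" where
  "below ns \<longleftrightarrow> (\<forall>n\<in>set ns. bruhat_less N n m)"

lemma sepix:
  assumes "bruhat_less N n m"
  shows "sepix n \<in> {1..N}" "zeta N l n (sepix n) \<noteq> zeta N l m (sepix n)"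
proof -
  have "\<exists>a. a \<in> {1..N} \<and> zeta N l n a \<noteq> zeta N l m a"
    using eigenvalues_separate[OF l assms] by blast
  from someI_ex[OF this] show "sepix n \<in> {1..N}" "zeta N l n (sepix n) \<noteq> zeta N l m (sepix n)"
    unfolding sepix_def by blast+
qed

lemma Yop_commute: "a \<in> {1..N} \<Longrightarrow> b \<in> {1..N} \<Longrightarrow> Yop N l a * Yop N l b = Yop N l b * Yop N l a"
  using affine_hecke.Y_commute[OF affine_hecke_cyclic.axioms(1)[OF hecke_interp[OF N]]] by simp

lemma Yop_killer_commute:
  assumes "a \<in> {1..N}" "bruhat_less N n m"
  shows "Yop N l a * killer n = killer n * Yop N l a"
  unfolding killer_def right_diff_distrib left_diff_distrib
  using Yop_commute[OF assms(1) sepix(1)[OF assms(2)]] scal_commute by simp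

lemma Yop_kill_commute:
  assumes "a \<in> {1..N}" "below ns"
  shows "kill ns * Yop N l a = Yop N l a * kill ns"
  unfolding kill_def by (rule prod_list_commute) (use assms Yop_killer_commute in \<open>auto simp: below_def\<close>)

lemma kill_commute:
  assumes "below ns" "below ns'"
  shows "kill ns * kill ns' = kill ns' * kill ns"
proof -
  have "killer n * kill ns' = kill ns' * killer n" if "n \<in> set ns" for n
    using Yop_kill_commute[OF sepix(1) assms(2)] that assms(1) scal_commute
    unfolding killer_def right_diff_distrib left_diff_distrib by (simp add: below_def)
  then show ?thesis unfolding kill_def[of ns] by (intro prod_list_commute) auto
qed

lemma kill_append: "kill (ns @ ns') = kill ns * kill ns'"
  by (simp add: kill_def)

lemma kill_finite:
  assumes "finite A" "\<And>e. e \<in> A \<Longrightarrow> \<exists>ns. below ns \<and> app (kill ns) (single e 1) = 0"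
  shows "\<exists>ns. below ns \<and> (\<forall>e\<in>A. app (kill ns) (single e 1) = 0)"
  using assms
proof (induction A rule: finite_induct)
  case empty
  show ?case by (auto simp: below_def intro: exI[of _ "[]"])
next
  case (insert e A)
  then obtain ns where ns: "below ns" "\<forall>e\<in>A. app (kill ns) (single e 1) = 0" by blast
  obtain ns' where ns': "below ns'" "app (kill ns') (single e 1) = 0" using insert by blast
  have "app (kill (ns @ ns')) (single e 1) = 0"
    using ns' by (simp add: kill_append)
  moreover have "app (kill (ns @ ns')) (single e' 1) = 0" if "e' \<in> A" for e'
    using ns that unfolding kill_append kill_commute[OF ns(1) ns'(1)] by simp
  moreover have "below (ns @ ns')" using ns ns' by (auto simp: below_def)
  ultimately show ?case by (intro exI[of _ "ns @ ns'"]) auto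
qed

lemma kill_keys:
  assumes "\<And>e. e \<in> keys f \<Longrightarrow> app L (single e 1) = 0"
  shows "app L f = 0"
  using arg_cong[OF sum_of_singles[of f], of "app L"] assms by (simp add: app_sum)

text \<open>Induction along the rank: one factor lowers \<open>z\<^sup>n\<close> to finitely many smaller monomials, which are annihilated by induction.
Since the factors commute, the annihilating products can be concatenated.\<close>

lemma kill_monom:
  assumes "bruhat_less N n m"
  shows "\<exists>ns. below ns \<and> app (kill ns) (z_monom N n) = 0"
  using assms
proof (induction n rule: wfp_induct_rule[OF wfp_rank_less[of N]])
  case (1 n)
  define f where "f = app (killer n) (z_monom N n)"
  have "f \<in> lower N n"
    using tri_Yop[OF sepix(1)[OF 1(2)], of l] unfolding f_def killer_def triangular_def by simp
  then have "\<exists>ns. below ns \<and> app (kill ns) (single e 1) = 0" if "e \<in> keys f" for e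
  proof -
    obtain n' where "e = exponent N n'" "bruhat_less N n' n"
      using \<open>f \<in> lower N n\<close> \<open>e \<in> _\<close> unfolding lower_def by blast
    then show ?thesis
      using 1(1)[OF bruhat_rank_less bruhat_trans] 1(2) unfolding z_monom_def by simp
  qed
  then obtain ns where ns: "below ns" "\<forall>e\<in>keys f. app (kill ns) (single e 1) = 0"
    using kill_finite[of "keys f"] by auto
  then have "app (kill ns) f = 0" by (simp add: kill_keys)
  then have "app (kill (ns @ [n])) (z_monom N n) = 0"
    by (simp add: kill_append f_def kill_def)
  moreover have "below (ns @ [n])" using ns(1) 1(2) by (simp add: below_def)
  ultimately show ?case by (intro exI conjI)
qed

lemma kill_low_set:
  assumes "finite F" "F \<subseteq> lower N m"
  shows "\<exists>ns. below ns \<and> (\<forall>f\<in>F. app (kill ns) f = 0)"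
proof -
  have "\<exists>ns. below ns \<and> app (kill ns) (single e 1) = 0" if "e \<in> (\<Union>f\<in>F. keys f)" for e
  proof -
    obtain f where "f \<in> F" "e \<in> keys f" using \<open>e \<in> _\<close> by blast
    then obtain n where "e = exponent N n" "bruhat_less N n m"
      using assms(2) unfolding lower_def by blast
    then show ?thesis using kill_monom unfolding z_monom_def by simp
  qed
  then obtain ns where "below ns" "\<forall>e\<in>(\<Union>f\<in>F. keys f). app (kill ns) (single e 1) = 0"
    using kill_finite[of "\<Union>f\<in>F. keys f"] assms(1) by auto
  then have "app (kill ns) f = 0" if "f \<in> F" for f
    using that by (simp add: kill_keys)
  then show ?thesis using \<open>below ns\<close> by blast
qed

definition kill_scalar :: "(nat \<Rightarrow> int) list \<Rightarrow> coef" where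
  "kill_scalar ns = prod_list (map (\<lambda>n. zeta N l m (sepix n) - zeta N l n (sepix n)) ns)"

lemma kill_scalar_neq_0: "below ns \<Longrightarrow> kill_scalar ns \<noteq> 0"
proof (induction ns)
  case (Cons n ns)
  then show ?case using sepix(2)[of n] by (simp add: kill_scalar_def below_def)
qed (simp add: kill_scalar_def)

lemma kill_eigen:
  assumes "below ns" "\<And>a. a \<in> {1..N} \<Longrightarrow> app (Yop N l a) f = const_L (zeta N l m a) * f"
  shows "app (kill ns) f = const_L (kill_scalar ns) * f"
  using assms(1)
proof (induction ns)
  case (Cons n ns)
  have "app (killer n) f = const_L (zeta N l m (sepix n) - zeta N l n (sepix n)) * f"
    using assms(2)[OF sepix(1)] Cons.prems by (simp add: killer_def below_def const_L_diff left_diff_distrib)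
  then show ?case
    using Cons by (simp add: kill_def kill_scalar_def below_def const_L_mult mult.left_commute mult.assoc)
qed (simp add: kill_def kill_scalar_def)

lemma tri_kill: "below ns \<Longrightarrow> \<exists>d. triangular N (kill ns) d \<and> d m = kill_scalar ns"
proof (induction ns)
  case Nil
  then show ?case using tri_1 by (auto simp: kill_def kill_scalar_def)
next
  case (Cons n ns)
  then obtain d where d: "triangular N (kill ns) d" "d m = kill_scalar ns" by (auto simp: below_def)
  have "triangular N (killer n) (\<lambda>m. zeta N l m (sepix n) - zeta N l n (sepix n))"
    unfolding killer_def by (intro tri_scal_diff tri_Yop sepix) (use Cons in \<open>auto simp: below_def\<close>)
  from tri_mult[OF this d(1)]
  have "triangular N (kill (n # ns)) (\<lambda>m. (zeta N l m (sepix n) - zeta N l n (sepix n)) * d m)"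
    by (simp add: kill_def)
  moreover have "(zeta N l m (sepix n) - zeta N l n (sepix n)) * d m = kill_scalar (n # ns)"
    by (simp add: d(2) kill_scalar_def)
  ultimately show ?case by blast
qed

lemma killer_LP: "bruhat_less N n m \<Longrightarrow> pres N (killer n)"
  using unit_pres_Yop[OF sepix(1), of n l] unfolding pres_def killer_def unit_pres_def
  by (auto intro!: LP_diff LP_const_mult)

lemma kill_LP: "below ns \<Longrightarrow> pres N (kill ns)"
proof (induction ns)
  case (Cons n ns)
  then show ?case using killer_LP[of n] by (auto simp: kill_def below_def pres_def)
qed (simp add: kill_def pres_def)

text \<open>Existence: a product of killers that annihilates the lower terms of all \<open>Y\<^sub>a z\<^sup>m - \<zeta>\<^sub>a z\<^sup>m\<close> turns \<open>z\<^sup>m\<close> into an eigenvector with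
nonzero leading coefficient. Uniqueness: the difference of two solutions is an eigenvector without leading term, and a
product of killers acts on it both by zero and by a nonzero scalar.\<close>

lemma macdonald_unique_existence:
  "\<exists>!f. f \<in> LP N \<and> keys (f - z_monom N m) \<subseteq> exponent N ` {n. bruhat_less N n m} \<and>
     (\<forall>a\<in>{1..N}. Y_N N l a f = const_L (zeta N l m a) * f)"
proof (rule ex_ex1I)
  define F where "F = (\<lambda>a. app (Yop N l a) (z_monom N m) - const_L (zeta N l m a) * z_monom N m) ` {1..N}"
  have "F \<subseteq> lower N m" unfolding F_def using tri_Yop[of _ N l] unfolding triangular_def by auto
  then obtain ns where ns: "below ns" "\<forall>f\<in>F. app (kill ns) f = 0"
    using kill_low_set[of F] by (auto simp: F_def)
  (* the kill scalar is the leading coefficient of the annihilating product applied to the monomial *)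
  define f where "f = const_L (inverse (kill_scalar ns)) * app (kill ns) (z_monom N m)"
  have "f \<in> LP N" unfolding f_def by (intro LP_const_mult presD[OF kill_LP[OF ns(1)]] z_monom_LP)
  moreover have "f - z_monom N m \<in> lower N m"
  proof -
    obtain d where d: "triangular N (kill ns) d" "d m = kill_scalar ns" using tri_kill[OF ns(1)] by blast
    then have "const_L (inverse (kill_scalar ns)) * (app (kill ns) (z_monom N m) - const_L (kill_scalar ns) * z_monom N m) \<in> lower N m"
      unfolding triangular_def by (intro low_const) metis
    then show ?thesis
      using kill_scalar_neq_0[OF ns(1)] by (simp add: f_def right_diff_distrib flip: mult.assoc const_L_mult)
  qed
  moreover have "Y_N N l a f = const_L (zeta N l m a) * f" if "a \<in> {1..N}" for a
  proof -
    have "app (kill ns) (app (Yop N l a) (z_monom N m)) = const_L (zeta N l m a) * app (kill ns) (z_monom N m)"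
      using ns(2) that unfolding F_def by auto
    then have "app (Yop N l a) (app (kill ns) (z_monom N m)) = const_L (zeta N l m a) * app (kill ns) (z_monom N m)"
      using Yop_kill_commute[OF that ns(1)] by (metis app_times)
    then show ?thesis by (simp add: f_def Y_N_eq mult.left_commute)
  qed
  ultimately show "\<exists>f. f \<in> LP N \<and> keys (f - z_monom N m) \<subseteq> exponent N ` {n. bruhat_less N n m} \<and>
     (\<forall>a\<in>{1..N}. Y_N N l a f = const_L (zeta N l m a) * f)"
    unfolding lower_def by blast
next
  fix f g
  assume f: "f \<in> LP N \<and> keys (f - z_monom N m) \<subseteq> exponent N ` {n. bruhat_less N n m} \<and>
     (\<forall>a\<in>{1..N}. Y_N N l a f = const_L (zeta N l m a) * f)"
    and g: "g \<in> LP N \<and> keys (g - z_monom N m) \<subseteq> exponent N ` {n. bruhat_less N n m} \<and>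
     (\<forall>a\<in>{1..N}. Y_N N l a g = const_L (zeta N l m a) * g)"
  have "f - z_monom N m \<in> lower N m" "g - z_monom N m \<in> lower N m"
    using f g unfolding lower_def by blast+
  from low_diff[OF this] obtain ns where ns: "below ns" "app (kill ns) (f - g) = 0"
    using kill_low_set[of "{f - g}"] by auto
  have "app (kill ns) (f - g) = const_L (kill_scalar ns) * (f - g)"
    using f g by (intro kill_eigen[OF ns(1)]) (simp add: Y_N_eq right_diff_distrib)
  then show "f = g" using ns(2) kill_scalar_neq_0[OF ns(1)] by simp
qed

lemma macdonald:
  shows "macdonald N l m \<in> LP N"
    and "macdonald N l m - z_monom N m \<in> lower N m"
    and "a \<in> {1..N} \<Longrightarrow> app (Yop N l a) (macdonald N l m) = const_L (zeta N l m a) * macdonald N l m"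
proof -
  have *: "macdonald N l m \<in> LP N \<and>
     keys (macdonald N l m - z_monom N m) \<subseteq> exponent N ` {n. bruhat_less N n m} \<and>
     (\<forall>a\<in>{1..N}. Y_N N l a (macdonald N l m) = const_L (zeta N l m a) * macdonald N l m)"
    unfolding macdonald_def by (rule theI'[OF macdonald_unique_existence])
  show "macdonald N l m \<in> LP N" using * by blast
  show "macdonald N l m - z_monom N m \<in> lower N m" using * unfolding lower_def by blast
  show "app (Yop N l a) (macdonald N l m) = const_L (zeta N l m a) * macdonald N l m" if "a \<in> {1..N}"
    using * that unfolding Y_N_eq by blast
qed

end

section \<open>The space of tensors\<close>

lemma lookup_scale_T [simp]: "lookup (scale_T c x) j = const_L c * lookup x j"
  by (simp add: scale_T_def map.rep_eq when_def)

interpretation T: module scale_T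
  by unfold_locales
    (auto intro!: poly_mapping_eqI simp: lookup_add algebra_simps const_L_add const_L_mult)

lemma scale_T_single [simp]: "scale_T c (single j h) = single j (const_L c * h)"
  by (rule poly_mapping_eqI) (simp add: lookup_single when_def)

lemma lookup_tens [simp]: "lookup (tens f w) j = const_L (lookup w j) * f"
  by (simp add: tens_def map.rep_eq when_def)

lemma tens_v_basis: "tens f (v_basis j) = single j f"
  by (rule poly_mapping_eqI) (simp add: v_basis_def lookup_single when_def)

lemma tens_single: "tens f (single j c) = single j (const_L c * f)"
  by (rule poly_mapping_eqI) (simp add: lookup_single when_def)

lemma tens_add: "tens f (v + w) = tens f v + tens f w"
  by (rule poly_mapping_eqI) (simp add: lookup_add const_L_add distrib_right)

definition lin :: "(tensor \<Rightarrow> tensor) \<Rightarrow> bool" where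
  "lin F \<longleftrightarrow> (\<forall>x y. F (x + y) = F x + F y) \<and> (\<forall>c x. F (scale_T c x) = scale_T c (F x))"

lemma lin_add: "lin F \<Longrightarrow> F (x + y) = F x + F y" and lin_scale: "lin F \<Longrightarrow> F (scale_T c x) = scale_T c (F x)"
  by (simp_all add: lin_def)

lemma lin_0: "lin F \<Longrightarrow> F 0 = 0" using lin_scale[of F 0 0] by simp

lemma lin_neg: "lin F \<Longrightarrow> F (- x) = - F x" using lin_scale[of F "-1" x] by simp

lemma lin_diff: "lin F \<Longrightarrow> F (x - y) = F x - F y" using lin_add[of F x "- y"] lin_neg[of F y] by simp

lemma lin_comp: "lin F \<Longrightarrow> lin G \<Longrightarrow> lin (F \<circ> G)" by (simp add: lin_def)

lemma lin_span:
  assumes "lin F" "\<And>g. g \<in> A \<Longrightarrow> F g \<in> T.span B" "x \<in> T.span A"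
  shows "F x \<in> T.span B"
proof -
  have "T.subspace {x. F x \<in> T.span B}"
    by (auto simp: T.subspace_def lin_0[OF assms(1)] lin_add[OF assms(1)] lin_scale[OF assms(1)]
        intro: T.span_zero T.span_add T.span_scale)
  then have "T.span A \<subseteq> {x. F x \<in> T.span B}"
    using assms(2) by (intro T.span_minimal) auto
  then show ?thesis using assms(3) by auto
qed

lemma lin_lin_ext:
  assumes "\<And>j a b. F j (a + b) = F j a + F j b" "\<And>j c a. F j (const_L c * a) = scale_T c (F j a)"
  shows "lin (lin_ext F)"
proof -
  have 0: "F j 0 = 0" for j using assms(2)[of j 0 0] by simp
  have add: "lin_ext F (x + y) = lin_ext F x + lin_ext F y" for x y
    by (rule lin_ext_add) (simp_all add: assms 0)
  have "lin_ext F (scale_T c x) = scale_T c (lin_ext F x)" for c x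
    by (rule additive_eqI[where \<phi> = "\<lambda>x. lin_ext F (scale_T c x)" and \<psi> = "\<lambda>x. scale_T c (lin_ext F x)"])
      (simp_all add: add T.scale_right_distrib assms(2) 0)
  then show ?thesis using add by (simp add: lin_def)
qed

lemma tensor_sum: "x = (\<Sum>j\<in>keys x. single j (lookup x j))" for x :: tensor
  by (rule poly_mapping_eqI) (simp add: lookup_sum lookup_single when_def sum.delta' in_keys_iff)

lemma tensors_0 [simp]: "0 \<in> tensors N l" by (simp add: tensors_def)
lemma tensors_single: "j \<in> letters N l \<Longrightarrow> f \<in> LP N \<Longrightarrow> single j f \<in> tensors N l"
  by (auto simp: tensors_def lookup_single when_def)
lemma tensors_add: "x \<in> tensors N l \<Longrightarrow> y \<in> tensors N l \<Longrightarrow> x + y \<in> tensors N l"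
  using keys_add[of x y] unfolding tensors_def by (auto simp: lookup_add intro!: LP_add)
lemma tensors_scale: "x \<in> tensors N l \<Longrightarrow> scale_T c x \<in> tensors N l"
  unfolding tensors_def by (auto simp: in_keys_iff intro!: LP_const_mult)
lemma tensors_induct [consumes 1, case_names zero single add]:
  assumes "x \<in> tensors N l" "P 0" "\<And>j f. j \<in> letters N l \<Longrightarrow> f \<in> LP N \<Longrightarrow> P (single j f)"
    "\<And>x y. P x \<Longrightarrow> P y \<Longrightarrow> P (x + y)"
  shows "P x"
proof -
  have "P (\<Sum>j\<in>A. single j (lookup x j))" if "finite A" "A \<subseteq> keys x" for A
    using that
  proof (induction A rule: finite_induct)
    case (insert j A)
    have "P (single j (lookup x j))"
      using insert assms(1) by (intro assms(3)) (auto simp: tensors_def)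
    then show ?case using insert by (simp add: assms(4))
  qed (simp add: assms(2))
  from this[of "keys x"] show ?thesis
    unfolding tensor_sum[of x, symmetric] by simp
qed

lemma letters_swap:
  assumes "j \<in> letters N l" "1 \<le> a" "a < N"
  shows "j \<circ> transpose a (Suc a) \<in> letters N l"
  using assms unfolding letters_def PiE_iff extensional_def by (auto simp: transpose_def)

lemma comp_transpose_twice [simp]: "j \<circ> transpose a b \<circ> transpose a b = j"
  by (simp add: comp_assoc)

section \<open>A presentation of the Hecke relations\<close>

abbreviation "sw a \<equiv> swp a (Suc a)"
abbreviation "gg a \<equiv> gop a (Suc a)"
abbreviation "gi a \<equiv> gin a (Suc a)"
abbreviation "jsw j a \<equiv> j \<circ> transpose a (Suc a)"

text \<open>The image of \<open>T\<^sub>a - q\<^sup>2\<close> consists of the polynomials symmetric in \<open>z\<^sub>a, z\<^bsub>a+1\<^esub>\<close>.\<close>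

definition sym_rel :: "nat \<Rightarrow> nat \<Rightarrow> tensor set" where
  "sym_rel N l = {single j f | j a f. j \<in> letters N l \<and> 1 \<le> a \<and> a < N \<and> j a = j (Suc a)
     \<and> f \<in> LP N \<and> app (sw a) f = f}"

text \<open>The relation \<open>f T\<^sub>a \<otimes> v = f \<otimes> T\<^sub>a v\<close> for \<open>v\<close> with an ascent at \<open>a\<close>, solved for the tensor with a descent; recall
\<open>T\<^sub>a = - q G\<^sub>a\<^sup>-\<^sup>1\<close>.\<close>

definition swap_rel :: "nat \<Rightarrow> nat \<Rightarrow> tensor set" where
  "swap_rel N l = {single j f + single (jsw j a) (app (gi a) f) | j a f.
     j \<in> letters N l \<and> 1 \<le> a \<and> a < N \<and> j (Suc a) < j a \<and> f \<in> LP N}"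

lemma T_poly_eq: "T_poly a f = - (QL * app (gi a) f)"
proof -
  have "QL * const_L (q_par - inverse q_par) = const_L (q_par ^ 2 - 1)"
    by (simp add: power2_eq_square right_diff_distrib flip: const_L_mult)
  then show ?thesis
    by (simp add: T_poly_def gin_def app_gop right_diff_distrib flip: mult.assoc)
qed

lemma gop_symmetric:
  assumes "a \<noteq> b" "app (swp a b) f = f"
  shows "app (gop a b) f = QL * f"
  by (rule gop_eqI[OF assms(1)]) (simp add: assms(2) algebra_simps)

lemma symmetric_gop:
  assumes "a \<noteq> b" "app (gop a b) f = QL * f"
  shows "app (swp a b) f = f"
proof -
  have "(var_z a - var_z b) * (QL * f) = (QL - RL) * var_z a * f + (RL * var_z a - QL * var_z b) * app (swp a b) f"
    using gop_clear[OF assms(1), of f] assms(2) by simp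
  then have "(RL * var_z a - QL * var_z b) * (app (swp a b) f - f) = 0" by algebra
  moreover have "RL * var_z a - QL * var_z b \<noteq> 0"
  proof
    assume "RL * var_z a - QL * var_z b = 0"
    then have "lookup (RL * var_z a - QL * var_z b) (single a 1) = 0" by simp
    moreover have "single a (1::int) \<noteq> single b 1"
      using assms(1) by (metis lookup_single_eq lookup_single_not_eq zero_neq_one)
    ultimately show False
      by (simp add: lookup_minus lookup_const_L_times var_z_def lookup_single when_def)
  qed
  ultimately show ?thesis by simp
qed

text \<open>By the quadratic relation, the image of \<open>g + q\<^sup>-\<^sup>1\<close> lies in the eigenspace of \<open>g\<close> for \<open>q\<close>, which is the space of symmetric
polynomials.\<close>

lemma gop_plus_symmetric:
  assumes "a \<noteq> b"
  shows "app (swp a b) (app (gop a b) f + RL * f) = app (gop a b) f + RL * f"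
proof (rule symmetric_gop[OF assms])
  have "app (gop a b) (app (gop a b) f + RL * f) = (QL - RL) * app (gop a b) f + f + RL * app (gop a b) f"
    by (simp add: gop_quadratic[OF assms])
  also have "\<dots> = QL * (app (gop a b) f + RL * f)"
    using QL_RL by algebra
  finally show "app (gop a b) (app (gop a b) f + RL * f) = QL * (app (gop a b) f + RL * f)" .
qed

lemma T_V_v_basis: "T_V a (v_basis j) = T_basis a j"
proof -
  have "Poly_Mapping.map ((*) 1) w = w" for w :: vtensor
    by (rule poly_mapping_eqI) (simp add: map.rep_eq when_def)
  then show ?thesis by (simp add: T_V_def v_basis_def)
qed

lemma hecke_gen_in: 
  assumes "1 \<le> a" "a < N" "f \<in> LP N" "j \<in> letters N l"
  shows "single j (T_poly a f) - tens f (T_basis a j) \<in> hecke_rel N l"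
proof -
  have "v_basis j \<in> V_tensors N l" using assms by (simp add: V_tensors_def v_basis_def)
  then have "tens (T_poly a f) (v_basis j) - tens f (T_V a (v_basis j)) \<in> hecke_rel N l"
    unfolding hecke_rel_def using assms by (intro T.span_base) blast
  then show ?thesis by (simp add: tens_v_basis T_V_v_basis)
qed

lemma swap_rel_hecke: "swap_rel N l \<subseteq> hecke_rel N l"
proof
  fix x assume "x \<in> swap_rel N l"
  then obtain j a f where x: "x = single j f + single (jsw j a) (app (gi a) f)"
    and j: "j \<in> letters N l" "1 \<le> a" "a < N" "j (Suc a) < j a" "f \<in> LP N"
    unfolding swap_rel_def by blast
  have "single (jsw j a) (T_poly a f) - tens f (T_basis a (jsw j a)) \<in> hecke_rel N l"
    using j by (intro hecke_gen_in letters_swap)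
  also have "T_basis a (jsw j a) = single j q_par"
    using j by (simp add: T_basis_def comp_assoc)
  finally have "scale_T (- inverse q_par) (single (jsw j a) (T_poly a f) - tens f (single j q_par)) \<in> hecke_rel N l"
    unfolding hecke_rel_def by (rule T.span_scale)
  also have "scale_T (- inverse q_par) (single (jsw j a) (T_poly a f) - tens f (single j q_par)) = x"
    unfolding x T_poly_eq tens_single
    by (simp add: T.scale_right_diff_distrib const_L_uminus add.commute flip: mult.assoc)
      (simp add: single_uminus)
  finally show "x \<in> hecke_rel N l" .
qed

lemma sym_rel_hecke: "sym_rel N l \<subseteq> hecke_rel N l"
proof
  fix x assume "x \<in> sym_rel N l"
  then obtain j a f where x: "x = single j f"
    and j: "j \<in> letters N l" "1 \<le> a" "a < N" "j a = j (Suc a)" "f \<in> LP N" "app (sw a) f = f"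
    unfolding sym_rel_def by blast
  have "single j (T_poly a f) - tens f (T_basis a j) \<in> hecke_rel N l"
    using j by (intro hecke_gen_in)
  also have "T_basis a j = single j (q_par ^ 2)"
    using j by (simp add: T_basis_def)
  also have "T_poly a f = - f"
    using gop_symmetric[of a "Suc a" f] j QL_RL unfolding T_poly_eq gin_def by (simp add: const_L_diff algebra_simps)
  finally have "scale_T (- inverse (1 + q_par ^ 2)) (single j (- f) - tens f (single j (q_par ^ 2))) \<in> hecke_rel N l"
    unfolding hecke_rel_def by (rule T.span_scale)
  also have "single j (- f) - tens f (single j (q_par ^ 2)) = single j (const_L (- (1 + q_par ^ 2)) * f)"
  proof -
    have "const_L (- (1 + q_par ^ 2)) * f = - f - const_L (q_par ^ 2) * f"
      unfolding const_L_uminus const_L_add by (simp add: algebra_simps)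
    then show ?thesis unfolding tens_single single_diff[symmetric] by simp
  qed
  also have "scale_T (- inverse (1 + q_par ^ 2)) (single j (const_L (- (1 + q_par ^ 2)) * f)) = x"
  proof -
    have "- inverse (1 + q_par ^ 2) * - (1 + q_par ^ 2) = 1"
      using one_plus_q2_neq_0 by (simp only: minus_mult_minus left_inverse not_False_eq_True)
    then show ?thesis
      unfolding x scale_T_single mult.assoc[symmetric] const_L_mult[symmetric] by (simp only: const_L_simps mult_1_left)
  qed
  finally show "x \<in> hecke_rel N l" .
qed

lemma hecke_gen_presented:
  assumes "1 \<le> a" "a < N" "f \<in> LP N" "j \<in> letters N l"
  shows "single j (T_poly a f) - tens f (T_basis a j) \<in> T.span (sym_rel N l \<union> swap_rel N l)"
proof -
  have LP: "app (gg a) f \<in> LP N" "app (gi a) f \<in> LP N"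
    using presD[OF gop_LP assms(3)] presD[OF gin_LP assms(3)] assms(1,2) by auto
  consider "j a = j (Suc a)" | "j a < j (Suc a)" | "j (Suc a) < j a" by linarith
  then show ?thesis
  proof cases
    case 1
    (* T - q^2 = - q (g + 1/q), and the image of g + 1/q is symmetric *)
    define h where "h = app (gg a) f + RL * f"
    have "h \<in> LP N" unfolding h_def using LP assms by (intro LP_add LP_const_mult)
    moreover have "app (sw a) h = h" unfolding h_def by (rule gop_plus_symmetric) simp
    ultimately have "single j h \<in> sym_rel N l"
      unfolding sym_rel_def using assms 1 by blast
    then have "scale_T (- q_par) (single j h) \<in> T.span (sym_rel N l \<union> swap_rel N l)"
      by (intro T.span_scale T.span_base) blast
    also have "scale_T (- q_par) (single j h) = single j (T_poly a f) - tens f (T_basis a j)"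
    proof -
      have "const_L (- q_par) * h = T_poly a f - const_L (q_par ^ 2) * f"
        unfolding T_poly_eq h_def gin_def
        by (simp add: const_L_diff const_L_uminus power2_eq_square const_L_mult) algebra
      then show ?thesis using 1 by (simp add: T_basis_def tens_single flip: single_diff)
    qed
    finally show ?thesis .
  next
    case 2
    have "single (jsw j a) f + single (jsw (jsw j a) a) (app (gi a) f) \<in> swap_rel N l"
      unfolding swap_rel_def using assms 2 letters_swap[of j N l a]
      by (intro CollectI exI[of _ "jsw j a"] exI[of _ a] exI[of _ f] conjI) auto
    then have "scale_T (- q_par) (single (jsw j a) f + single j (app (gi a) f)) \<in> T.span (sym_rel N l \<union> swap_rel N l)"
      by (intro T.span_scale T.span_base) simp
    also have "scale_T (- q_par) (single (jsw j a) f + single j (app (gi a) f))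
       = single j (T_poly a f) - tens f (T_basis a j)"
      using 2 by (simp add: T_basis_def tens_single T.scale_right_distrib T_poly_eq const_L_uminus single_uminus)
    finally show ?thesis .
  next
    case 3
    have "single j (app (gg a) f) + single (jsw j a) (app (gi a) (app (gg a) f)) \<in> swap_rel N l"
      unfolding swap_rel_def using assms 3 LP
      by (intro CollectI exI[of _ j] exI[of _ a] exI[of _ "app (gg a) f"] conjI) auto
    moreover have "app (gi a) (app (gg a) f) = f"
      using gin_gop[of a "Suc a"] by (simp flip: app_times)
    ultimately have "scale_T (- q_par) (single j (app (gg a) f) + single (jsw j a) f) \<in> T.span (sym_rel N l \<union> swap_rel N l)"
      by (intro T.span_scale T.span_base) simp
    also have "scale_T (- q_par) (single j (app (gg a) f) + single (jsw j a) f)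
       = single j (T_poly a f) - tens f (T_basis a j)"
    proof -
      have "- (QL * app (gg a) f) = T_poly a f - const_L (q_par ^ 2 - 1) * f"
        unfolding T_poly_eq gin_def
        by (simp add: const_L_diff power2_eq_square const_L_mult) (use QL_RL(1) in algebra)
      then have e: "single j (T_poly a f) - single j (const_L (q_par ^ 2 - 1) * f) = - single j (QL * app (gg a) f)"
        by (simp flip: single_diff single_uminus)
      have "tens f (T_basis a j) = single (jsw j a) (QL * f) + single j (const_L (q_par ^ 2 - 1) * f)"
        using 3 by (simp add: T_basis_def tens_add tens_single)
      then have "single j (T_poly a f) - tens f (T_basis a j)
          = (single j (T_poly a f) - single j (const_L (q_par ^ 2 - 1) * f)) - single (jsw j a) (QL * f)"
        by simp
      then show ?thesis unfolding e by (simp add: T.scale_right_distrib const_L_uminus single_uminus)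
    qed
    finally show ?thesis .
  qed
qed

text \<open>Two families of generators suffice: the relations at an ascent are multiples of those at the exchanged descent, and the ones
at a descent \<open>f\<close> are those at \<open>G\<^sub>a f\<close>.\<close>

lemma hecke_rel_presentation: "hecke_rel N l = T.span (sym_rel N l \<union> swap_rel N l)"
proof
  show "T.span (sym_rel N l \<union> swap_rel N l) \<subseteq> hecke_rel N l"
    using sym_rel_hecke swap_rel_hecke unfolding hecke_rel_def
    by (intro T.span_minimal T.subspace_span) blast
  show "hecke_rel N l \<subseteq> T.span (sym_rel N l \<union> swap_rel N l)"
    unfolding hecke_rel_def
  proof (rule T.span_minimal[OF _ T.subspace_span], rule subsetI)
    fix x assume "x \<in> {tens (T_poly a f) w - tens f (T_V a w) | a f w. 1 \<le> a \<and> a < N \<and> f \<in> LP N \<and> w \<in> V_tensors N l}"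
    then obtain a f w where x: "x = tens (T_poly a f) w - tens f (T_V a w)"
      and a: "1 \<le> a" "a < N" "f \<in> LP N" "w \<in> V_tensors N l" by blast
    let ?c = "lookup w"
    have 1: "tens (T_poly a f) w = (\<Sum>j\<in>keys w. scale_T (?c j) (single j (T_poly a f)))"
      by (rule poly_mapping_eqI) (simp add: lookup_sum lookup_single when_def sum.delta' in_keys_iff)
    have 2: "tens f (T_V a w) = (\<Sum>j\<in>keys w. scale_T (?c j) (tens f (T_basis a j)))"
    proof -
      have "tens f (sum g A) = (\<Sum>i\<in>A. tens f (g i))" for g :: "(nat \<Rightarrow> nat) \<Rightarrow> vtensor" and A
      proof (induction A rule: infinite_finite_induct)
        case (insert x F) then show ?case by (simp add: tens_add)
      qed (auto intro!: poly_mapping_eqI)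
      moreover have "tens f (Poly_Mapping.map ((*) c) v) = scale_T c (tens f v)" for c v
        by (rule poly_mapping_eqI) (simp add: map.rep_eq when_def const_L_mult mult.assoc)
      ultimately show ?thesis by (simp add: T_V_def)
    qed
    have "x = (\<Sum>j\<in>keys w. scale_T (?c j) (single j (T_poly a f) - tens f (T_basis a j)))"
      unfolding x 1 2 T.scale_right_diff_distrib by (rule sum_subtractf[symmetric])
    moreover have "j \<in> letters N l" if "j \<in> keys w" for j
      using a(4) that by (auto simp: V_tensors_def)
    ultimately show "x \<in> T.span (sym_rel N l \<union> swap_rel N l)"
      using a hecke_gen_presented by (auto intro!: T.span_sum T.span_scale simp del: scale_T_single)
  qed
qed

lemma lin_hecke:
  assumes "lin F" "\<And>g. g \<in> sym_rel N l \<Longrightarrow> F g \<in> T.span B" "\<And>g. g \<in> swap_rel N l \<Longrightarrow> F g \<in> T.span B" "x \<in> hecke_rel N l"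
  shows "F x \<in> T.span B"
  using lin_span[OF assms(1), of "sym_rel N l \<union> swap_rel N l"] assms unfolding hecke_rel_presentation by blast

lemma hecke_add: "x \<in> hecke_rel N l \<Longrightarrow> y \<in> hecke_rel N l \<Longrightarrow> x + y \<in> hecke_rel N l"
  and hecke_diff: "x \<in> hecke_rel N l \<Longrightarrow> y \<in> hecke_rel N l \<Longrightarrow> x - y \<in> hecke_rel N l"
  and hecke_scale: "x \<in> hecke_rel N l \<Longrightarrow> scale_T c x \<in> hecke_rel N l"
  and hecke_0: "0 \<in> hecke_rel N l"
  unfolding hecke_rel_def by (auto intro: T.span_add T.span_diff T.span_scale T.span_zero)

section \<open>Straightening\<close>

definition descent :: "nat \<Rightarrow> (nat \<Rightarrow> nat) \<Rightarrow> nat \<Rightarrow> bool" where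
  "descent N j a \<longleftrightarrow> 1 \<le> a \<and> a < N \<and> j (Suc a) < j a"

text \<open>The termination measure of straightening: exchanging a descent moves the larger letter to the later position, where its factor
is smaller.\<close>

definition letter_weight :: "nat \<Rightarrow> (nat \<Rightarrow> nat) \<Rightarrow> nat" where
  "letter_weight N j = (\<Sum>a\<in>{1..N}. (N - a) * j a)"

lemma wt_swap_less:
  assumes "descent N j a"
  shows "letter_weight N (jsw j a) < letter_weight N j"
proof -
  have a: "a \<in> {1..N}" "Suc a \<in> {1..N}" "a \<noteq> Suc a" using assms by (auto simp: descent_def)
  have rest: "(\<Sum>b\<in>{1..N} - {a, Suc a}. (N - b) * jsw j a b) = (\<Sum>b\<in>{1..N} - {a, Suc a}. (N - b) * j b)"
    by (rule sum.cong) (auto simp: transpose_apply_other)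
  obtain n where n: "N - a = Suc n" "N - Suc a = n" using assms by (auto simp: descent_def) (metis Suc_diff_Suc)
  show ?thesis
    unfolding letter_weight_def sum_two[OF finite_atLeastAtMost a] rest using assms
    by (simp add: n descent_def)
qed

text \<open>Exchanging the leftmost descent repeatedly, with the factor \<open>- G\<^sub>a\<^sup>-\<^sup>1\<close> that the relations prescribe. The choice of the
descent is immaterial (\<open>str_step\<close>).\<close>

function straighten :: "nat \<Rightarrow> (nat \<Rightarrow> nat) \<Rightarrow> laurent \<Rightarrow> tensor" where
  "straighten N j h = (if \<exists>a. descent N j a then (let a = (LEAST a. descent N j a) in straighten N (jsw j a) (- app (gi a) h))
     else single j h)"
  by pat_completeness auto
termination
proof (relation "measure (\<lambda>(N, j, h). letter_weight N j)")
  fix N j h x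
  assume "\<exists>a. descent N j a" "x = (LEAST a. descent N j a)"
  then have "descent N j x" using LeastI_ex by metis
  then show "((N, jsw j x, - app (gi x) h), N, j, h) \<in> measure (\<lambda>(N, j, h). letter_weight N j)"
    using wt_swap_less by simp
qed simp

declare straighten.simps [simp del]

lemma str_least: "descent N j a \<Longrightarrow> straighten N j h = straighten N (jsw j (LEAST a. descent N j a)) (- app (gi (LEAST a. descent N j a)) h)"
  by (subst straighten.simps) (auto simp: Let_def)

lemma str_sorted: "(\<And>a. \<not> descent N j a) \<Longrightarrow> straighten N j h = single j h"
  by (subst straighten.simps) auto

lemma gin_gin_commute:
  assumes "a \<noteq> b" "c \<noteq> d" "{a,b} \<inter> {c,d} = {}"
  shows "gin a b * gin c d = gin c d * gin a b"
  using gop_gop_commute[OF assms] scal_commute[of _ "gop a b"] scal_commute[of _ "gop c d"]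
  unfolding gin_def left_diff_distrib right_diff_distrib by simp

text \<open>The braid relation with two of the generators inverted.\<close>

lemma braid_mixed:
  fixes g1 :: "'a :: ring_1"
  assumes "g1 * i1 = 1" "i1 * g1 = 1" "g2 * i2 = 1" "i2 * g2 = 1" "g1 * g2 * g1 = g2 * g1 * g2"
  shows "i1 * i2 * g1 = g2 * i1 * i2"
proof -
  have "i2 * (g1 * g2) = g1 * g2 * i1"
    by (rule inverse_conj[where g = g1 and g' = g2]) (use assms in \<open>auto simp: mult.assoc\<close>)
  then have "i1 * (i2 * (g1 * g2)) * i2 = i1 * (g1 * g2 * i1) * i2" by simp
  moreover have "i1 * (i2 * (g1 * g2)) * i2 = i1 * i2 * g1 * (g2 * i2)" by (simp only: mult.assoc)
  moreover have "i1 * (g1 * g2 * i1) * i2 = (i1 * g1) * g2 * i1 * i2" by (simp only: mult.assoc)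
  ultimately show ?thesis using assms by simp
qed

lemma gin_gop_mixed:
  "gi a * gi (Suc a) * gg a = gg (Suc a) * gi a * gi (Suc a)"
  "gi (Suc a) * gi a * gg (Suc a) = gg a * gi (Suc a) * gi a"
proof -
  have b: "gg a * gg (Suc a) * gg a = gg (Suc a) * gg a * gg (Suc a)"
    by (rule gop_braid) auto
  show "gi a * gi (Suc a) * gg a = gg (Suc a) * gi a * gi (Suc a)"
    by (rule braid_mixed[OF _ _ _ _ b]) (auto simp: gop_gin gin_gop)
  show "gi (Suc a) * gi a * gg (Suc a) = gg a * gi (Suc a) * gi a"
    by (rule braid_mixed[OF _ _ _ _ b[symmetric]]) (auto simp: gop_gin gin_gop)
qed

lemma gin_braid: "gi a * gi (Suc a) * gi a = gi (Suc a) * gi a * gi (Suc a)"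
proof -
  have "gi a * (gi (Suc a) * gi a * gg (Suc a)) = gi a * (gg a * gi (Suc a) * gi a)"
    unfolding gin_gop_mixed(2) ..
  then have "gi a * gi (Suc a) * gi a * gg (Suc a) = (gi a * gg a) * gi (Suc a) * gi a"
    by (simp only: mult.assoc)
  then have "gi a * gi (Suc a) * gi a * gg (Suc a) * gi (Suc a) = gi (Suc a) * gi a * gi (Suc a)"
    by (simp add: gin_gop)
  then show ?thesis by (simp only: mult.assoc gop_gin n_not_Suc_n not_False_eq_True mult_1_right)
qed

lemma jsw_far: "Suc a < b \<Longrightarrow> jsw (jsw j a) b = jsw (jsw j b) a"
  by (auto simp: fun_eq_iff transpose_def)

lemma jsw_braid: "jsw (jsw (jsw j a) (Suc a)) a = jsw (jsw (jsw j (Suc a)) a) (Suc a)"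
  by (auto simp: fun_eq_iff transpose_def)

text \<open>A diamond argument: exchanges at distant positions commute, and three exchanges that reverse a decreasing triple of
adjacent letters agree by the braid relation.\<close>

lemma str_step: "descent N j a \<Longrightarrow> straighten N j h = straighten N (jsw j a) (- app (gi a) h)"
proof (induction "letter_weight N j" arbitrary: j a h rule: less_induct)
  case less
  have IH: "straighten N j' h' = straighten N (jsw j' c) (- app (gi c) h')" if "letter_weight N j' < letter_weight N j" "descent N j' c" for j' c h'
    using less.hyps[OF that] .
  have IH1: "straighten N (jsw j b) h' = straighten N (jsw (jsw j b) c) (- app (gi c) h')" if "descent N j b" "descent N (jsw j b) c" for b c h'
    using IH[OF wt_swap_less[OF that(1)] that(2)] .
  have IH2: "straighten N (jsw (jsw j b) c) h' = straighten N (jsw (jsw (jsw j b) c) d) (- app (gi d) h')"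
    if "descent N j b" "descent N (jsw j b) c" "descent N (jsw (jsw j b) c) d" for b c d h'
    using IH[OF less_trans[OF wt_swap_less[OF that(2)] wt_swap_less[OF that(1)]] that(3)] .
  have far: "straighten N (jsw j x) (- app (gi x) h) = straighten N (jsw j y) (- app (gi y) h)"
    if "descent N j x" "descent N j y" "Suc x < y" for x y
  proof -
    have "descent N (jsw j x) y" "descent N (jsw j y) x"
      using that by (auto simp: descent_def transpose_def)
    then have "straighten N (jsw j x) (- app (gi x) h) = straighten N (jsw (jsw j x) y) (app (gi y * gi x) h)"
      "straighten N (jsw j y) (- app (gi y) h) = straighten N (jsw (jsw j y) x) (app (gi x * gi y) h)"
      using IH1 that by simp_all
    moreover have "gi x * gi y = gi y * gi x" using that by (intro gin_gin_commute) auto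
    ultimately show ?thesis using jsw_far[OF that(3), of j] by simp
  qed
  have near: "straighten N (jsw j x) (- app (gi x) h) = straighten N (jsw j (Suc x)) (- app (gi (Suc x)) h)"
    if "descent N j x" "descent N j (Suc x)" for x
  proof -
    have d: "descent N (jsw j x) (Suc x)" "descent N (jsw (jsw j x) (Suc x)) x"
        "descent N (jsw j (Suc x)) x" "descent N (jsw (jsw j (Suc x)) x) (Suc x)"
      using that by (auto simp: descent_def transpose_def)
    have "straighten N (jsw j x) (- app (gi x) h) = straighten N (jsw (jsw (jsw j x) (Suc x)) x) (- app (gi x * gi (Suc x) * gi x) h)"
      using IH1[OF that(1) d(1)] IH2[OF that(1) d(1,2)] by simp
    also have "\<dots> = straighten N (jsw (jsw (jsw j (Suc x)) x) (Suc x)) (- app (gi (Suc x) * gi x * gi (Suc x)) h)"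
      unfolding jsw_braid gin_braid ..
    also have "\<dots> = straighten N (jsw j (Suc x)) (- app (gi (Suc x)) h)"
      using IH1[OF that(2) d(3)] IH2[OF that(2) d(3,4)] by simp
    finally show ?thesis .
  qed
  have any: "straighten N (jsw j x) (- app (gi x) h) = straighten N (jsw j y) (- app (gi y) h)" if "descent N j x" "descent N j y" for x y
  proof -
    consider "x = y" | "y = Suc x" | "x = Suc y" | "Suc x < y" | "Suc y < x" by linarith
    then show ?thesis using far near that by cases metis+
  qed
  have "descent N j (LEAST a. descent N j a)" using less.prems by (rule LeastI)
  from trans[OF str_least[OF less.prems] any[OF this less.prems]] show ?case .
qed

lemma sorted_or_descent:
  obtains "\<And>a. \<not> descent N j a" | a where "descent N j a" by blast

lemma str_add: "straighten N j (f + g) = straighten N j f + straighten N j g"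
proof (induction "letter_weight N j" arbitrary: j f g rule: less_induct)
  case less
  show ?case
  proof (cases rule: sorted_or_descent[of N j])
    case 1 then show ?thesis by (simp add: str_sorted single_add)
  next
    case (2 a)
    have "straighten N (jsw j a) (- app (gi a) f + - app (gi a) g) = straighten N (jsw j a) (- app (gi a) f) + straighten N (jsw j a) (- app (gi a) g)"
      by (rule less) (rule wt_swap_less[OF 2])
    then show ?thesis unfolding str_step[OF 2] by simp
  qed
qed

lemma str_scale: "straighten N j (const_L c * f) = scale_T c (straighten N j f)"
proof (induction "letter_weight N j" arbitrary: j f rule: less_induct)
  case less
  show ?case
  proof (cases rule: sorted_or_descent[of N j])
    case 1 then show ?thesis by (simp add: str_sorted)
  next
    case (2 a)
    have "straighten N (jsw j a) (const_L c * (- app (gi a) f)) = scale_T c (straighten N (jsw j a) (- app (gi a) f))"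
      by (rule less) (rule wt_swap_less[OF 2])
    then show ?thesis unfolding str_step[OF 2] by simp
  qed
qed

lemma str_neg: "straighten N j (- f) = - straighten N j f"
  using str_scale[of N j "-1" f] by (simp add: const_L_uminus)

definition Straighten :: "nat \<Rightarrow> tensor \<Rightarrow> tensor" where
  "Straighten N = lin_ext (straighten N)"

lemma lin_Str: "lin (Straighten N)"
  unfolding Straighten_def by (rule lin_lin_ext) (simp_all add: str_add str_scale)

lemma Str_single: "Straighten N (single j h) = straighten N j h"
  unfolding Straighten_def using str_scale[of N j 0 0] by simp

definition sorted_tensors :: "nat \<Rightarrow> nat \<Rightarrow> tensor set" where
  "sorted_tensors N l = {x \<in> tensors N l. \<forall>j\<in>keys x. \<forall>a. \<not> descent N j a}"

lemma gi_LP: "1 \<le> a \<Longrightarrow> a < N \<Longrightarrow> f \<in> LP N \<Longrightarrow> app (gi a) f \<in> LP N"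
  by (rule presD[OF gin_LP]) auto

lemma str_tensors:
  assumes "j \<in> letters N l" "h \<in> LP N"
  shows "straighten N j h \<in> sorted_tensors N l" "single j h - straighten N j h \<in> hecke_rel N l"
proof -
  have "straighten N j h \<in> sorted_tensors N l \<and> single j h - straighten N j h \<in> hecke_rel N l"
    using assms
  proof (induction "letter_weight N j" arbitrary: j h rule: less_induct)
    case less
    show ?case
    proof (cases rule: sorted_or_descent[of N j])
      case 1 then show ?thesis
        using less.prems tensors_single[of j N l h] by (auto simp: str_sorted sorted_tensors_def hecke_0 split: if_splits)
    next
      case (2 a)
      then have a: "1 \<le> a" "a < N" "j (Suc a) < j a" by (auto simp: descent_def)
      have IH: "straighten N (jsw j a) (- app (gi a) h) \<in> sorted_tensors N l"
        "single (jsw j a) (- app (gi a) h) - straighten N (jsw j a) (- app (gi a) h) \<in> hecke_rel N l"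
        using less.hyps[OF wt_swap_less[OF 2] letters_swap[OF less.prems(1) a(1,2)] LP_uminus[OF gi_LP[OF a(1,2) less.prems(2)]]]
        by blast+
      have "single j h + single (jsw j a) (app (gi a) h) \<in> hecke_rel N l"
        using swap_rel_hecke[of N l] less.prems a unfolding swap_rel_def by blast
      from hecke_add[OF this IH(2)] IH(1) show ?thesis
        unfolding str_step[OF 2] by (simp add: single_uminus)
    qed
  qed
  then show "straighten N j h \<in> sorted_tensors N l" "single j h - straighten N j h \<in> hecke_rel N l" by auto
qed

lemma sorted_tensors_add:
  assumes "x \<in> sorted_tensors N l" "y \<in> sorted_tensors N l"
  shows "x + y \<in> sorted_tensors N l"
  using assms keys_add[of x y] tensors_add[of x N l y] unfolding sorted_tensors_def by blast

lemma Str_tensors: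
  assumes "x \<in> tensors N l"
  shows "Straighten N x \<in> sorted_tensors N l" "x - Straighten N x \<in> hecke_rel N l"
proof -
  have "Straighten N x \<in> sorted_tensors N l \<and> x - Straighten N x \<in> hecke_rel N l"
    using assms
  proof (induction rule: tensors_induct)
    case zero then show ?case by (simp add: lin_0[OF lin_Str] sorted_tensors_def hecke_0)
  next
    case (single j f)
    then show ?case by (simp add: Str_single str_tensors)
  next
    case (add x y)
    then have "x - Straighten N x + (y - Straighten N y) \<in> hecke_rel N l" "Straighten N x + Straighten N y \<in> sorted_tensors N l"
      by (auto intro: hecke_add sorted_tensors_add)
    then show ?case by (simp add: lin_add[OF lin_Str] algebra_simps)
  qed
  then show "Straighten N x \<in> sorted_tensors N l" "x - Straighten N x \<in> hecke_rel N l" by auto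
qed

definition sorted_sym_rel :: "nat \<Rightarrow> nat \<Rightarrow> tensor set" where
  "sorted_sym_rel N l = {single j f | j a f. j \<in> letters N l \<and> (\<forall>b. \<not> descent N j b) \<and> 1 \<le> a \<and> a < N \<and> j a = j (Suc a)
     \<and> f \<in> LP N \<and> app (sw a) f = f}"

lemma sorted_sym_rel_hecke: "T.span (sorted_sym_rel N l) \<subseteq> hecke_rel N l"
proof -
  have "sorted_sym_rel N l \<subseteq> sym_rel N l" unfolding sorted_sym_rel_def sym_rel_def by blast
  then show ?thesis unfolding hecke_rel_presentation by (intro T.span_mono) blast
qed

text \<open>The relation for equal adjacent letters survives straightening. If a descent next to the pair of equal letters moves a third
letter across it, then the pair moves by one position, and the mixed braid relation says that the transformed
coefficient is symmetric in the new pair of variables.\<close>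

lemma str_symmetric:
  assumes "j \<in> letters N l" "1 \<le> a" "a < N" "j a = j (Suc a)" "f \<in> LP N" "app (sw a) f = f"
  shows "straighten N j f \<in> T.span (sorted_sym_rel N l)"
  using assms
proof (induction "letter_weight N j" arbitrary: j a f rule: less_induct)
  case less
  note j = less.prems
  have eig: "app (gg a) f = QL * f" using gop_symmetric[of a "Suc a" f] j by simp
  show ?case
  proof (cases rule: sorted_or_descent[of N j])
    case 1
    then have "single j f \<in> sorted_sym_rel N l"
      unfolding sorted_sym_rel_def using j by blast
    then show ?thesis using 1 by (simp add: str_sorted T.span_base)
  next
    case (2 b)
    then have b: "1 \<le> b" "b < N" by (auto simp: descent_def)
    have "a \<noteq> b" using 2 j by (auto simp: descent_def)
    then consider "Suc a < b \<or> Suc b < a" | "b = Suc a" | "a = Suc b" by linarith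
    then show ?thesis
    proof cases
      case 1
      have "sw a * gi b = gi b * sw a"
        using swp_gin[of b "Suc b" a "Suc a"] 1 by (auto simp: transpose_apply_other)
      then have "app (sw a) (- app (gi b) f) = - app (gi b) f"
        using j(6) by (metis app_neg app_times)
      moreover have "jsw j b a = jsw j b (Suc a)" using 1 j(4) by (auto simp: transpose_def)
      ultimately have "straighten N (jsw j b) (- app (gi b) f) \<in> T.span (sorted_sym_rel N l)"
        using j b by (intro less.hyps[OF wt_swap_less[OF 2]] letters_swap LP_uminus gi_LP)
      then show ?thesis unfolding str_step[OF 2] .
    next
      case [simp]: 2
      have d: "descent N j (Suc a)" "descent N (jsw j (Suc a)) a"
        using \<open>descent N j b\<close> j by (auto simp: descent_def transpose_def)
      have "app (gg (Suc a)) (app (gi a * gi (Suc a)) f) = app (gi a * gi (Suc a) * gg a) f"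
        unfolding gin_gop_mixed by (simp add: mult.assoc)
      also have "\<dots> = QL * app (gi a * gi (Suc a)) f" by (simp add: eig)
      finally have "app (sw (Suc a)) (app (gi a * gi (Suc a)) f) = app (gi a * gi (Suc a)) f"
        by (intro symmetric_gop) auto
      moreover have "jsw (jsw j (Suc a)) a (Suc a) = jsw (jsw j (Suc a)) a (Suc (Suc a))"
        using j(4) by (simp add: transpose_def)
      ultimately have "straighten N (jsw (jsw j (Suc a)) a) (app (gi a * gi (Suc a)) f) \<in> T.span (sorted_sym_rel N l)"
        using j b wt_swap_less[OF d(1)] wt_swap_less[OF d(2)]
        by (intro less.hyps[of _ "Suc a"] letters_swap) (auto intro!: gi_LP)
      then show ?thesis unfolding str_step[OF d(1)] str_step[OF d(2)] by simp
    next
      case [simp]: 3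
      have d: "descent N j b" "descent N (jsw j b) (Suc b)"
        using \<open>descent N j b\<close> j by (auto simp: descent_def transpose_def)
      have "app (gg b) (app (gi (Suc b) * gi b) f) = app (gi (Suc b) * gi b * gg (Suc b)) f"
        unfolding gin_gop_mixed by (simp add: mult.assoc)
      also have "\<dots> = QL * app (gi (Suc b) * gi b) f" using eig by simp
      finally have "app (sw b) (app (gi (Suc b) * gi b) f) = app (gi (Suc b) * gi b) f"
        by (intro symmetric_gop) auto
      moreover have "jsw (jsw j b) (Suc b) b = jsw (jsw j b) (Suc b) (Suc b)"
        using j(4) by (simp add: transpose_def)
      ultimately have "straighten N (jsw (jsw j b) (Suc b)) (app (gi (Suc b) * gi b) f) \<in> T.span (sorted_sym_rel N l)"
        using j b wt_swap_less[OF d(1)] wt_swap_less[OF d(2)]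
        by (intro less.hyps[of _ b] letters_swap) (auto intro!: gi_LP)
      then show ?thesis unfolding str_step[OF d(1)] str_step[OF d(2)] by simp
    qed
  qed
qed

lemma Str_hecke:
  assumes "x \<in> hecke_rel N l"
  shows "Straighten N x \<in> T.span (sorted_sym_rel N l)"
proof (rule lin_hecke[OF lin_Str _ _ assms])
  fix g assume "g \<in> sym_rel N l"
  then show "Straighten N g \<in> T.span (sorted_sym_rel N l)"
    unfolding sym_rel_def using str_symmetric[of _ N l] Str_single[of N] by (smt (verit) mem_Collect_eq)
next
  fix g assume "g \<in> swap_rel N l"
  then obtain j a f where g: "g = single j f + single (jsw j a) (app (gi a) f)"
    and d: "descent N j a"
    unfolding swap_rel_def descent_def by blast
  have "Straighten N g = 0"
    unfolding g by (simp add: lin_add[OF lin_Str] Str_single str_step[OF d] str_neg)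
  then show "Straighten N g \<in> T.span (sorted_sym_rel N l)" by (simp add: T.span_zero)
qed

section \<open>Nonvanishing in the wedge space\<close>

definition stab :: "nat \<Rightarrow> (nat \<Rightarrow> nat) \<Rightarrow> (nat \<Rightarrow> nat) set" where
  "stab N j = {w. w permutes {1..N} \<and> j \<circ> w = j}"

text \<open>The coefficient of \<open>z\<^sup>m\<close> in the antisymmetrization of \<open>f\<close> over the stabilizer of the letters. It detects nonzero
elements of the wedge space.\<close>

definition alt_coeff :: "nat \<Rightarrow> (nat \<Rightarrow> nat) \<Rightarrow> (nat \<Rightarrow> int) \<Rightarrow> laurent \<Rightarrow> coef" where
  "alt_coeff N j m f = (\<Sum>w\<in>stab N j. of_int (sign w) * lookup f (exponent N (m \<circ> w)))"

lemma finite_stab: "finite (stab N j)"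
  unfolding stab_def by (rule finite_subset[OF _ finite_permutations[of "{1..N}"]]) auto

lemma lookup_swp: "lookup (app (swp a b) f) e = lookup f (map_key (transpose a b) e)"
proof (rule additive_eqI[where \<phi> = "\<lambda>f. lookup (app (swp a b) f) e" and \<psi> = "\<lambda>f. lookup f (map_key (transpose a b) e)"])
  fix i c
  have "map_key (transpose a b) i = e \<longleftrightarrow> i = map_key (transpose a b) e"
    by (metis map_key_transpose_twice)
  then show "lookup (app (swp a b) (single i c)) e = lookup (single i c) (map_key (transpose a b) e)"
    by (auto simp: swp_def lookup_single when_def)
qed (simp_all add: lookup_add)

lemma map_key_exponent:
  assumes "a \<in> {1..N}" "b \<in> {1..N}"
  shows "map_key (transpose a b) (exponent N m) = exponent N (m \<circ> transpose a b)"
  by (rule poly_mapping_eqI) (use assms in \<open>auto simp: transpose_def\<close>)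

text \<open>The summands for \<open>w\<close> and \<open>w \<circ> \<sigma>\<close> have opposite signs and equal coefficients.\<close>

lemma alt_symmetric:
  assumes "1 \<le> a" "a < N" "j a = j (Suc a)" "app (sw a) f = f"
  shows "alt_coeff N j m f = 0"
proof -
  let ?t = "transpose a (Suc a)"
  have jt: "j \<circ> ?t = j" using assms(3) by (auto simp: fun_eq_iff transpose_def)
  have tp: "?t permutes {1..N}" using assms by (intro permutes_swap_id) auto
  have mem: "w \<circ> ?t \<in> stab N j" if "w \<in> stab N j" for w
    using that permutes_compose[OF tp, of w] jt unfolding stab_def by (auto simp flip: comp_assoc)
  have bij: "bij_betw (\<lambda>w. w \<circ> ?t) (stab N j) (stab N j)"
    by (rule bij_betwI[where g = "\<lambda>w. w \<circ> ?t"]) (use mem in auto)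
  have sg: "sign (w \<circ> ?t) = - sign w" if "w \<in> stab N j" for w
  proof -
    have "permutation w" using that unfolding stab_def by (auto intro: permutes_imp_permutation[of "{1..N}"])
    then show ?thesis by (simp add: sign_compose permutation_swap_id sign_swap_id)
  qed
  have lk: "lookup f (exponent N (m \<circ> (w \<circ> ?t))) = lookup f (exponent N (m \<circ> w))" for w
    using lookup_swp[of a "Suc a" f "exponent N (m \<circ> w)"] assms
    by (simp add: map_key_exponent comp_assoc)
  have "alt_coeff N j m f = (\<Sum>w\<in>stab N j. of_int (sign (w \<circ> ?t)) * lookup f (exponent N (m \<circ> (w \<circ> ?t))))"
    unfolding alt_coeff_def by (rule sum.reindex_bij_betw[OF bij, symmetric])
  also have "\<dots> = (\<Sum>w\<in>stab N j. - (of_int (sign w) * lookup f (exponent N (m \<circ> w))))"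
    unfolding lk by (rule sum.cong) (simp_all add: sg)
  also have "\<dots> = - alt_coeff N j m f" unfolding alt_coeff_def by (rule sum_negf)
  finally have "alt_coeff N j m f + alt_coeff N j m f = - alt_coeff N j m f + alt_coeff N j m f"
    by (rule arg_cong)
  then have "2 * alt_coeff N j m f = 0" unfolding mult_2 add.left_inverse .
  then show ?thesis using two_neq_0_coef by (simp only: mult_eq_0_iff) simp
qed

lemma rank1_permutes:
  assumes "w permutes {1..N}"
  shows "rank1 N (m \<circ> w) = rank1 N m"
  unfolding rank1_def using sum.permute[OF assms, of "\<lambda>a. (m a)\<^sup>2"] by (simp add: comp_def)

text \<open>Take a minimizer in the orbit. It has no descent within a block, as exchanging one would lower the rank; hence it is
increasing on the blocks, and the permutation producing it is the identity.\<close>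

lemma rank2_increasing_minimal:
  assumes inc: "\<And>a b. a \<in> {1..N} \<Longrightarrow> b \<in> {1..N} \<Longrightarrow> a < b \<Longrightarrow> j a = j b \<Longrightarrow> m a < m b"
    and w: "w \<in> stab N j"
  shows "rank2 N m \<le> rank2 N (m \<circ> w)"
proof -
  obtain w0 where w0: "w0 \<in> stab N j" "\<And>w. w \<in> stab N j \<Longrightarrow> rank2 N (m \<circ> w0) \<le> rank2 N (m \<circ> w)"
  proof -
    have "Min ((\<lambda>w. rank2 N (m \<circ> w)) ` stab N j) \<in> (\<lambda>w. rank2 N (m \<circ> w)) ` stab N j"
      using finite_stab w by (intro Min_in) auto
    then obtain w0 where "w0 \<in> stab N j" "rank2 N (m \<circ> w0) = Min ((\<lambda>w. rank2 N (m \<circ> w)) ` stab N j)" by auto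
    then show ?thesis using that[of w0] finite_stab by simp
  qed
  then have p: "w0 permutes {1..N}" and jw: "j (w0 a) = j a" for a
    unfolding stab_def by (auto simp: fun_eq_iff)
  have inc0: "w0 a < w0 b" if ab: "a \<in> {1..N}" "b \<in> {1..N}" "a < b" "j a = j b" for a b
  proof (rule ccontr)
    assume "\<not> w0 a < w0 b"
    moreover have "w0 a \<noteq> w0 b" using p ab(3) by (metis permutes_inj inj_eq less_irrefl)
    moreover have mem: "w0 a \<in> {1..N}" "w0 b \<in> {1..N}" using ab p by (simp_all only: permutes_in_image)
    ultimately have "m (w0 b) < m (w0 a)" using ab by (intro inc) (auto simp: jw)
    then have "rank_less N (m \<circ> w0 \<circ> transpose a b) (m \<circ> w0)"
      using ab by (intro rank_less_exchange) auto
    moreover have "transpose a b permutes {1..N}" using ab by (intro permutes_swap_id)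
    then have p': "w0 \<circ> transpose a b permutes {1..N}" using p by (rule permutes_compose)
    moreover have "j \<circ> (w0 \<circ> transpose a b) = j"
      using ab(4) by (auto simp: fun_eq_iff jw transpose_def)
    ultimately have "w0 \<circ> transpose a b \<in> stab N j" "rank2 N (m \<circ> (w0 \<circ> transpose a b)) < rank2 N (m \<circ> w0)"
      using rank1_permutes[OF p, of m] rank1_permutes[OF p', of m] by (auto simp: stab_def rank_less_def comp_assoc)
    then show False using w0(2) by fastforce
  qed
  have "w0 a = a" for a
  proof (induction a rule: less_induct)
    case (less a)
    show ?case
    proof (cases "a \<in> {1..N}")
      case True
      obtain c where c: "w0 c = a" using p by (metis permutes_surj surjD)
      show ?thesis
      proof (rule ccontr)
        assume neq: "w0 a \<noteq> a"
        have "\<not> w0 a < a" using less[of "w0 a"] p by (metis inj_eq neq permutes_inj)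
        moreover have "c > a" using c less[of c] neq by (metis linorder_neqE_nat)
        moreover have "c \<in> {1..N}" using c True p by (metis permutes_in_image)
        ultimately have "w0 a < w0 c" using True c jw[of c] by (intro inc0) auto
        then show False using c \<open>\<not> w0 a < a\<close> by simp
      qed
    qed (use p in \<open>simp add: permutes_not_in\<close>)
  qed
  then have "m \<circ> w0 = m" by (simp add: fun_eq_iff)
  then show ?thesis using w0(2)[OF w] by simp
qed

text \<open>The exponents in the orbit of \<open>m\<close> do not have smaller rank than \<open>m\<close>, so that they do not occur among the lower terms.\<close>

lemma alt_leading:
  assumes inc: "\<And>a b. a \<in> {1..N} \<Longrightarrow> b \<in> {1..N} \<Longrightarrow> a < b \<Longrightarrow> j a = j b \<Longrightarrow> m a < m b"
    and f: "f - z_monom N m \<in> lower N m"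
  shows "alt_coeff N j m f = 1"
proof -
  have zero: "lookup (f - z_monom N m) (exponent N (m \<circ> w)) = 0" if w: "w \<in> stab N j" for w
  proof (rule ccontr)
    assume "lookup (f - z_monom N m) (exponent N (m \<circ> w)) \<noteq> 0"
    then obtain n where n: "exponent N (m \<circ> w) = exponent N n" "bruhat_less N n m"
      using f unfolding lower_def by (auto simp: in_keys_iff)
    then have "rank1 N n = rank1 N (m \<circ> w)" "rank2 N n = rank2 N (m \<circ> w)"
      unfolding exponent_eq_iff by (auto intro!: rank_cong)
    moreover have "rank1 N (m \<circ> w) = rank1 N m" using w by (intro rank1_permutes) (auto simp: stab_def)
    moreover have "rank2 N m \<le> rank2 N (m \<circ> w)" using rank2_increasing_minimal[of N j m w] inc w by blast
    ultimately show False using bruhat_rank_less[OF n(2)] by (simp add: rank_less_def)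
  qed
  have monom: "lookup (z_monom N m) (exponent N (m \<circ> w)) = (if w = id then 1 else 0)" if w: "w \<in> stab N j" for w
  proof -
    have "w = id" if eq: "\<forall>a\<in>{1..N}. m a = m (w a)"
    proof
      fix a
      have p: "w permutes {1..N}" and "j (w a) = j a" using w by (auto simp: stab_def fun_eq_iff)
      show "w a = id a"
      proof (cases "a \<in> {1..N}")
        case True
        then have "w a \<in> {1..N}" using p by (simp only: permutes_in_image)
        then show ?thesis using inc[of a "w a"] inc[of "w a" a] True eq \<open>j (w a) = j a\<close>
          by (metis id_apply less_irrefl linorder_neqE_nat)
      qed (use p in \<open>simp add: permutes_not_in\<close>)
    qed
    then show ?thesis by (auto simp: z_monom_def lookup_single when_def exponent_eq_iff)
  qed
  have "lookup f (exponent N (m \<circ> w)) = (if w = id then 1 else 0)" if "w \<in> stab N j" for w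
    using zero[OF that] monom[OF that] by (simp add: lookup_minus)
  then have "alt_coeff N j m f = (\<Sum>w\<in>stab N j. if w = id then 1 else 0)"
    unfolding alt_coeff_def by (intro sum.cong) (auto simp: sign_id)
  also have "\<dots> = 1" using finite_stab permutes_id by (simp add: sum.delta stab_def)
  finally show ?thesis .
qed

lemma sorted_not_hecke:
  assumes "\<And>a. \<not> descent N j a"
    and inc: "\<And>a b. a \<in> {1..N} \<Longrightarrow> b \<in> {1..N} \<Longrightarrow> a < b \<Longrightarrow> j a = j b \<Longrightarrow> m a < m b"
    and f: "f - z_monom N m \<in> lower N m"
  shows "single j f \<notin> hecke_rel N l"
proof
  assume "single j f \<in> hecke_rel N l"
  then have 1: "single j f \<in> T.span (sorted_sym_rel N l)"
    using Str_hecke[of "single j f" N l] assms(1) by (simp add: Str_single str_sorted)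
  have addalt: "alt_coeff N j m (g + h) = alt_coeff N j m g + alt_coeff N j m h" for g h
    by (simp add: alt_coeff_def lookup_add distrib_left sum.distrib)
  have scalealt: "alt_coeff N j m (const_L c * h) = c * alt_coeff N j m h" for c h
    by (simp add: alt_coeff_def lookup_const_L_times sum_distrib_left mult.left_commute)
  have zeroalt: "alt_coeff N j m 0 = 0" by (simp add: alt_coeff_def)
  have sub: "T.subspace {x. alt_coeff N j m (lookup x j) = 0}"
    by (auto simp: T.subspace_def lookup_add addalt scalealt zeroalt)
  have "sorted_sym_rel N l \<subseteq> {x. alt_coeff N j m (lookup x j) = 0}"
  proof
    fix x assume "x \<in> sorted_sym_rel N l"
    then obtain j' a h where x: "x = single j' h" and "1 \<le> a" "a < N" "j' a = j' (Suc a)" "app (sw a) h = h"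
      unfolding sorted_sym_rel_def by blast
    then have "alt_coeff N j' m h = 0" by (intro alt_symmetric)
    then show "x \<in> {x. alt_coeff N j m (lookup x j) = 0}"
      unfolding x by (cases "j = j'") (simp_all add: lookup_single zeroalt)
  qed
  then have "T.span (sorted_sym_rel N l) \<subseteq> {x. alt_coeff N j m (lookup x j) = 0}"
    using sub by (rule T.span_minimal)
  then have "alt_coeff N j m f = 0" using 1 by auto
  moreover have "alt_coeff N j m f = 1" using alt_leading[of N j m f] inc f by blast
  ultimately show False by simp
qed

section \<open>The wedge space as a quotient\<close>

lemma mem_wcoset: "y \<in> wcoset N l x \<longleftrightarrow> y - x \<in> hecke_rel N l"
  unfolding wcoset_def elt_set_plus_def by (auto simp: algebra_simps) (metis add_diff_cancel_left' diff_add_cancel)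

lemma wcoset_eq_iff: "wcoset N l x = wcoset N l y \<longleftrightarrow> x - y \<in> hecke_rel N l"
proof
  assume "wcoset N l x = wcoset N l y"
  moreover have "x \<in> wcoset N l x" by (simp add: mem_wcoset hecke_0)
  ultimately show "x - y \<in> hecke_rel N l" by (simp add: mem_wcoset)
next
  assume xy: "x - y \<in> hecke_rel N l"
  have "z - x \<in> hecke_rel N l \<longleftrightarrow> z - y \<in> hecke_rel N l" for z
    using hecke_add[of "z - x" N l "x - y"] hecke_diff[of "z - y" N l "x - y"] xy by auto
  then show "wcoset N l x = wcoset N l y" by (auto simp: mem_wcoset)
qed

lemma wcoset_0: "wcoset N l 0 = hecke_rel N l"
  by (auto simp: mem_wcoset)

lemma wcoset_plus_hecke: "(\<lambda>z. F z) ` wcoset N l x + hecke_rel N l = wcoset N l (F x)"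
  if "lin F" "\<And>h. h \<in> hecke_rel N l \<Longrightarrow> F h \<in> hecke_rel N l"
proof (rule set_eqI)
  fix z
  show "z \<in> F ` wcoset N l x + hecke_rel N l \<longleftrightarrow> z \<in> wcoset N l (F x)"
  proof
    assume "z \<in> F ` wcoset N l x + hecke_rel N l"
    then obtain y h where z: "z = F y + h" "y - x \<in> hecke_rel N l" "h \<in> hecke_rel N l"
      by (auto simp: set_plus_def mem_wcoset)
    have "F (y - x) + h \<in> hecke_rel N l" using z that(2) hecke_add by blast
    then show "z \<in> wcoset N l (F x)"
      by (simp add: mem_wcoset z lin_diff[OF that(1)] algebra_simps)
  next
    assume "z \<in> wcoset N l (F x)"
    then have "z - F x \<in> hecke_rel N l" "x \<in> wcoset N l x" by (simp_all add: mem_wcoset hecke_0)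
    then show "z \<in> F ` wcoset N l x + hecke_rel N l"
      unfolding set_plus_def by (intro CollectI bexI[of _ "F x"] bexI[of _ "z - F x"]) auto
  qed
qed

lemma lin_scale_T: "lin (scale_T c)"
  by (simp add: lin_def T.scale_right_distrib mult.commute)

lemma scale_W_wcoset: "scale_W N l c (wcoset N l x) = wcoset N l (scale_T c x)"
  unfolding scale_W_def using wcoset_plus_hecke[OF lin_scale_T hecke_scale] by simp

lemma wcoset_add: "wcoset N l x + wcoset N l y = wcoset N l (x + y)"
proof (rule set_eqI)
  fix z
  show "z \<in> wcoset N l x + wcoset N l y \<longleftrightarrow> z \<in> wcoset N l (x + y)"
  proof
    assume "z \<in> wcoset N l x + wcoset N l y"
    then obtain u v where z: "z = u + v" "u - x \<in> hecke_rel N l" "v - y \<in> hecke_rel N l"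
      by (auto simp: set_plus_def mem_wcoset)
    from hecke_add[OF z(2,3)] show "z \<in> wcoset N l (x + y)"
      by (simp add: mem_wcoset z algebra_simps)
  next
    assume "z \<in> wcoset N l (x + y)"
    then have "z - y \<in> wcoset N l x" "y \<in> wcoset N l y"
      by (simp_all add: mem_wcoset hecke_0 algebra_simps)
    then show "z \<in> wcoset N l x + wcoset N l y"
      unfolding set_plus_def by (intro CollectI bexI[of _ "z - y"] bexI[of _ y]) auto
  qed
qed

lemma wcoset_wedge: "x \<in> tensors N l \<Longrightarrow> wcoset N l x \<in> wedge N l"
  by (simp add: wedge_def)

lemma letters_restrict: "j \<in> letters N l \<Longrightarrow> restrict j {1..N} = j"
  unfolding letters_def by (rule PiE_restrict)

lemma wtens_letters: "j \<in> letters N l \<Longrightarrow> wtens N l h j = wcoset N l (single j h)"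
  by (simp add: wtens_def tens_v_basis letters_restrict del: One_nat_def)

definition stable :: "nat \<Rightarrow> nat \<Rightarrow> (tensor \<Rightarrow> tensor) \<Rightarrow> bool" where
  "stable N l M \<longleftrightarrow> lin M \<and> (\<forall>x\<in>tensors N l. M x \<in> tensors N l) \<and> (\<forall>x\<in>hecke_rel N l. M x \<in> hecke_rel N l)"

text \<open>For linear \<open>M\<close> preserving the relations, \<open>M ` X\<close> need not be a whole coset; adding the subspace of relations
completes it.\<close>

definition induced :: "nat \<Rightarrow> nat \<Rightarrow> (tensor \<Rightarrow> tensor) \<Rightarrow> tensor set \<Rightarrow> tensor set" where
  "induced N l M = restrict (\<lambda>X. M ` X + hecke_rel N l) (wedge N l)"

lemma induced_wcoset:
  assumes "stable N l M" "x \<in> tensors N l"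
  shows "induced N l M (wcoset N l x) = wcoset N l (M x)"
  using assms wcoset_plus_hecke[of M N l x] by (simp add: induced_def stable_def wcoset_wedge)

lemma induced_endo:
  assumes M: "stable N l M"
  shows "wedge_endo N l (induced N l M)"
  unfolding wedge_endo_def
proof (intro conjI ballI allI)
  show "induced N l M \<in> wedge N l \<rightarrow>\<^sub>E wedge N l"
  proof (rule PiE_I)
    fix X assume "X \<in> wedge N l"
    then obtain x where x: "x \<in> tensors N l" "X = wcoset N l x" by (auto simp: wedge_def)
    then show "induced N l M X \<in> wedge N l"
      using M by (simp add: induced_wcoset wcoset_wedge stable_def)
  qed (simp add: induced_def)
next
  fix X Y assume "X \<in> wedge N l" "Y \<in> wedge N l"
  then obtain x y where x: "x \<in> tensors N l" "X = wcoset N l x" "y \<in> tensors N l" "Y = wcoset N l y"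
    by (auto simp: wedge_def)
  then show "induced N l M (X + Y) = induced N l M X + induced N l M Y"
    using M by (simp add: wcoset_add induced_wcoset tensors_add stable_def lin_add)
next
  fix c X assume "X \<in> wedge N l"
  then obtain x where x: "x \<in> tensors N l" "X = wcoset N l x" by (auto simp: wedge_def)
  then show "induced N l M (scale_W N l c X) = scale_W N l c (induced N l M X)"
    using M by (simp add: scale_W_wcoset induced_wcoset tensors_scale stable_def lin_scale)
qed

lemma endo_wcoset_add:
  assumes "wedge_endo N l F" "x \<in> tensors N l" "y \<in> tensors N l"
  shows "F (wcoset N l (x + y)) = F (wcoset N l x) + F (wcoset N l y)"
  using assms wcoset_wedge unfolding wedge_endo_def wcoset_add[symmetric] by blast

lemma endo_wcoset_scale:
  assumes "wedge_endo N l F" "x \<in> tensors N l"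
  shows "F (wcoset N l (scale_T c x)) = scale_W N l c (F (wcoset N l x))"
  using assms wcoset_wedge unfolding wedge_endo_def scale_W_wcoset[symmetric] by blast

lemma scale_W_0: "X \<in> wedge N l \<Longrightarrow> scale_W N l 0 X = hecke_rel N l"
  unfolding wedge_def by (auto simp: scale_W_wcoset wcoset_0)

lemma endo_0:
  assumes "wedge_endo N l F"
  shows "F (hecke_rel N l) = hecke_rel N l"
proof -
  have 0: "hecke_rel N l \<in> wedge N l" using wcoset_wedge[of 0 N l] by (simp add: wcoset_0)
  then have "F (hecke_rel N l) \<in> wedge N l" using assms unfolding wedge_endo_def by blast
  moreover have "F (scale_W N l 0 (hecke_rel N l)) = scale_W N l 0 (F (hecke_rel N l))"
    using assms 0 unfolding wedge_endo_def by blast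
  ultimately show ?thesis by (simp add: scale_W_0 0)
qed

text \<open>Every class is represented by a straightened tensor, so that endomorphisms are determined by sorted pure tensors.\<close>

lemma endo_eqI:
  assumes F: "wedge_endo N l F" and G: "wedge_endo N l G"
    and eq: "\<And>j f. j \<in> letters N l \<Longrightarrow> (\<And>a. \<not> descent N j a) \<Longrightarrow> f \<in> LP N \<Longrightarrow>
      F (wcoset N l (single j f)) = G (wcoset N l (single j f))"
  shows "F = G"
proof (rule PiE_ext)
  show "F \<in> wedge N l \<rightarrow>\<^sub>E wedge N l" "G \<in> wedge N l \<rightarrow>\<^sub>E wedge N l"
    using F G by (simp_all add: wedge_endo_def)
  fix X assume "X \<in> wedge N l"
  then obtain x where x: "x \<in> tensors N l" "X = wcoset N l x" by (auto simp: wedge_def)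
  define y where "y = Straighten N x"
  have y: "y \<in> sorted_tensors N l" "X = wcoset N l y"
    using Str_tensors[OF x(1)] x(2) by (simp_all add: y_def wcoset_eq_iff)
  have "F (wcoset N l (\<Sum>j\<in>A. single j (lookup y j))) = G (wcoset N l (\<Sum>j\<in>A. single j (lookup y j)))
     \<and> (\<Sum>j\<in>A. single j (lookup y j)) \<in> tensors N l"
    if "finite A" "A \<subseteq> keys y" for A
    using that
  proof (induction A rule: finite_induct)
    case empty
    then show ?case by (simp add: wcoset_0 endo_0[OF F] endo_0[OF G])
  next
    case (insert j A)
    have j: "j \<in> letters N l" "\<And>a. \<not> descent N j a" "lookup y j \<in> LP N"
      using insert y(1) by (auto simp: sorted_tensors_def tensors_def)
    then show ?case
      using insert eq[OF j] tensors_single[OF j(1,3)]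
      by (simp add: endo_wcoset_add[OF F] endo_wcoset_add[OF G] tensors_add)
  qed
  from this[of "keys y"] show "F X = G X"
    unfolding tensor_sum[of y, symmetric] y(2) by simp
qed

lemma mono_iff_no_descent: "mono_on {1..N} j \<longleftrightarrow> (\<forall>a. \<not> descent N j a)"
proof
  assume m: "mono_on {1..N} j"
  show "\<forall>a. \<not> descent N j a"
  proof (intro allI notI)
    fix a assume d: "descent N j a"
    then have "j a \<le> j (Suc a)" using m by (intro mono_onD[OF m]) (auto simp: descent_def)
    then show False using d by (simp add: descent_def)
  qed
next
  assume nd: "\<forall>a. \<not> descent N j a"
  have "j a \<le> j b" if "1 \<le> a" "a \<le> b" "b \<le> N" for a b
    using that(2,3)
  proof (induction b rule: dec_induct)
    case (step b)
    moreover have "\<not> descent N j b" using nd by blast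
    ultimately have "j b \<le> j (Suc b)" using that(1) by (simp add: descent_def)
    then show ?case using step by simp
  qed simp
  then show "mono_on {1..N} j" by (auto intro!: mono_onI)
qed

section \<open>The operators attached to the series\<close>

definition Yinv :: "nat \<Rightarrow> nat \<Rightarrow> nat \<Rightarrow> lop" where
  "Yinv N l a = (SOME B. pres N B \<and> Yop N l a * B = 1 \<and> B * Yop N l a = 1)"

lemma Yinv:
  assumes "a \<in> {1..N}"
  shows "pres N (Yinv N l a)" "Yop N l a * Yinv N l a = 1" "Yinv N l a * Yop N l a = 1"
proof -
  have "\<exists>B. pres N B \<and> Yop N l a * B = 1 \<and> B * Yop N l a = 1"
    using unit_pres_Yop[OF assms] unfolding unit_pres_def by blast
  from someI_ex[OF this] show "pres N (Yinv N l a)" "Yop N l a * Yinv N l a = 1" "Yinv N l a * Yop N l a = 1"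
    unfolding Yinv_def by blast+
qed

lemma commute_mult:
  fixes g :: "'a :: monoid_mult"
  assumes "g * x = x * g" "g * y = y * g"
  shows "g * (x * y) = x * y * g"
proof -
  have "g * (x * y) = x * (g * y)" by (simp only: mult.assoc[symmetric] assms(1))
  then show ?thesis by (simp only: assms(2) mult.assoc)
qed

lemma commute_scal: "g * x = x * g \<Longrightarrow> g * (scal c * x) = scal c * x * g"
  by (rule commute_mult[OF scal_commute[symmetric]])

lemma scal_mult_scal: "scal a * X * (scal b * Z) = scal (a * b) * (X * Z)"
proof -
  have "scal a * X * (scal b * Z) = scal a * (scal b * X) * Z"
    unfolding scal_commute[of b X] by (simp only: mult.assoc)
  then show ?thesis by (simp only: mult.assoc[symmetric] scal_simps)
qed

text \<open>The operator whose powers occur in the expansion of \<open>\<theta>\<^sub>m\<^sup>\<plusminus>(\<kappa> Y\<^sub>a z)\<close>.\<close>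

definition argop :: "nat \<Rightarrow> nat \<Rightarrow> sgn_pm \<Rightarrow> coef \<Rightarrow> nat \<Rightarrow> lop" where
  "argop N l \<epsilon> \<kappa> a = (case \<epsilon> of Minus \<Rightarrow> scal (\<kappa> * q_par powi (1 - int N)) * Yop N l a
     | Plus \<Rightarrow> scal (inverse (\<kappa> * q_par powi (1 - int N))) * Yinv N l a)"

text \<open>Replacing the action of series on series by multiplication of power series over the ring of operators turns the product of
the factors into an honest product.\<close>

definition opseries :: "coef fps \<Rightarrow> lop \<Rightarrow> lop fps" where
  "opseries \<phi> A = Abs_fps (\<lambda>k. scal (fps_nth \<phi> k) * A ^ k)"

lemma act_series_app:
  "act_series \<phi> (app A) (Abs_fps (\<lambda>n. app (fps_nth V n) h)) = Abs_fps (\<lambda>n. app (fps_nth (opseries \<phi> A * V) n) h)"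
  by (rule fps_ext)
    (simp add: act_series_def opseries_def fps_mult_nth app_sum_left app_power atLeast0AtMost)

lemma theta_Y_app:
  assumes "a \<in> {1..N}" "\<kappa> \<noteq> 0"
  shows "theta_Y N l \<epsilon> m \<kappa> a = act_series (theta \<epsilon> m) (app (argop N l \<epsilon> \<kappa> a))"
proof -
  let ?c = "\<kappa> * q_par powi (1 - int N)"
  have c: "?c \<noteq> 0" using assms(2) by simp
  have A: "(\<lambda>f. const_L \<kappa> * Y_op N l a f) = app (scal ?c * Yop N l a)"
    by (simp add: fun_eq_iff Y_op_def Y_N_eq const_L_mult mult.assoc)
  have 1: "scal ?c * Yop N l a * (scal (inverse ?c) * Yinv N l a) = 1"
    and 2: "scal (inverse ?c) * Yinv N l a * (scal ?c * Yop N l a) = 1"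
    unfolding scal_mult_scal Yinv(2,3)[OF assms(1)] using c by (simp_all only: right_inverse left_inverse not_False_eq_True) simp_all
  show ?thesis
    unfolding theta_Y_def Let_def A using inv_app[OF 1 2] by (cases \<epsilon>) (simp_all add: argop_def)
qed

definition block_series :: "nat \<Rightarrow> nat \<Rightarrow> sgn_pm \<Rightarrow> int \<Rightarrow> coef \<Rightarrow> nat list \<Rightarrow> lop fps \<Rightarrow> lop fps" where
  "block_series N l \<epsilon> m \<kappa> = fold (\<lambda>a V. opseries (theta \<epsilon> m) (argop N l \<epsilon> \<kappa> a) * V)"

lemma fold_theta_Y:
  assumes "set xs \<subseteq> {1..N}" "\<kappa> \<noteq> 0"
  shows "fold (theta_Y N l \<epsilon> m \<kappa>) xs (Abs_fps (\<lambda>n. app (fps_nth V n) h))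
    = Abs_fps (\<lambda>n. app (fps_nth (block_series N l \<epsilon> m \<kappa> xs V) n) h)"
  using assms(1)
proof (induction xs arbitrary: V)
  case (Cons a xs)
  then have "a \<in> {1..N}" "set xs \<subseteq> {1..N}" by auto
  then show ?case
    using Cons.IH by (simp add: theta_Y_app assms(2) act_series_app block_series_def del: One_nat_def)
qed (simp add: block_series_def)

definition K_op :: "nat \<Rightarrow> nat \<Rightarrow> nat \<Rightarrow> sgn_pm \<Rightarrow> (nat \<Rightarrow> nat) \<Rightarrow> lop fps" where
  "K_op N l i \<epsilon> j =
     block_series N l \<epsilon> (-1) (q_par ^ (l - i - 1) * r_par ^ (l - i)) (filter (\<lambda>b. j b = i) [1..<N + 1])
       (block_series N l \<epsilon> 1 (q_par ^ (l - i + 1) * r_par ^ (l - i)) (filter (\<lambda>a. j a = i - 1) [1..<N + 1]) 1)"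

lemma K_series_app: "fps_nth (K_series N l i \<epsilon> j h) n = app (fps_nth (K_op N l i \<epsilon> j) n) h"
proof -
  have 1: "fps_const h = Abs_fps (\<lambda>n. app (fps_nth 1 n) h)"
    by (rule fps_ext) simp
  have s: "set (filter P [1..<N + 1]) \<subseteq> {1..N}" for P by auto
  have k: "q_par ^ x * r_par ^ y \<noteq> 0" for x y by simp
  show ?thesis
    unfolding K_series_def K_op_def 1 fold_theta_Y[OF s k] by simp
qed

subsection \<open>Symmetry\<close>

definition commutes :: "lop \<Rightarrow> lop fps \<Rightarrow> bool" where
  "commutes g V \<longleftrightarrow> (\<forall>n. g * fps_nth V n = fps_nth V n * g)"

lemma commutes_1: "commutes g 1"
  by (simp add: commutes_def)

lemma commutes_mult:
  assumes "commutes g V" "commutes g W"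
  shows "commutes g (V * W)"
proof -
  have "g * (fps_nth V i * fps_nth W k) = fps_nth V i * fps_nth W k * g" for i k
    using assms unfolding commutes_def by (intro commute_mult) blast+
  then show ?thesis
    by (simp add: commutes_def fps_mult_nth sum_distrib_left sum_distrib_right)
qed

lemma commutes_opseries:
  assumes "g * A = A * g"
  shows "commutes g (opseries \<phi> A)"
proof -
  have "g * A ^ k = A ^ k * g" for k using assms by (metis power_commuting_commutes)
  then have "g * (scal c * A ^ k) = scal c * A ^ k * g" for c k
    by (rule commute_scal)
  then show ?thesis by (simp add: commutes_def opseries_def)
qed

lemma scal_half: "scal (1 / 2) * (F + F) = F"
proof (rule lop_eqI)
  fix x
  have "const_L (1 / 2) * (app F x + app F x) = (const_L (1 / 2) + const_L (1 / 2)) * app F x"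
    by (simp only: distrib_left distrib_right)
  also have "const_L (1 / 2) + const_L (1 / 2) = 1"
    using two_neq_0_coef unfolding const_L_add[symmetric] by (simp add: add_divide_distrib[symmetric])
  finally show "app (scal (1 / 2) * (F + F)) x = app F x" by simp
qed

text \<open>Each coefficient of the product is symmetric in \<open>A\<close> and \<open>B\<close>, hence half of a combination of symmetrized monomials.\<close>

lemma commutes_opseries_pair:
  assumes AB: "A * B = B * A" and sum: "g * (A + B) = (A + B) * g" and prod: "g * (A * B) = A * B * g"
  shows "commutes g (opseries \<phi> B * opseries \<phi> A)"
  unfolding commutes_def
proof
  fix n
  let ?c = "\<lambda>i. fps_nth \<phi> i * fps_nth \<phi> (n - i)"
  define S where "S = fps_nth (opseries \<phi> B * opseries \<phi> A) n"
  have "scal a * B ^ i * (scal b * A ^ k) = scal (a * b) * (A ^ k * B ^ i)" for a b i k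
  proof -
    have "B ^ i * A ^ k = A ^ k * B ^ i"
      using AB by (metis power_commuting_commutes)
    then show ?thesis by (simp only: scal_mult_scal)
  qed
  then have S: "S = (\<Sum>i=0..n. scal (?c i) * (A ^ (n - i) * B ^ i))"
    unfolding S_def by (simp add: fps_mult_nth opseries_def)
  also have "\<dots> = (\<Sum>i=0..n. scal (?c (n + 0 - i)) * (A ^ (n - (n + 0 - i)) * B ^ (n + 0 - i)))"
    by (rule sum.atLeastAtMost_rev)
  also have "\<dots> = (\<Sum>i=0..n. scal (?c i) * (A ^ i * B ^ (n - i)))"
    by (rule sum.cong) (simp_all add: mult.commute)
  finally have S': "S = (\<Sum>i=0..n. scal (?c i) * (A ^ i * B ^ (n - i)))" .
  (* adding the sum and its reversal symmetrizes each summand *)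
  have "S + S = (\<Sum>i=0..n. scal (?c i) * (A ^ i * B ^ (n - i) + A ^ (n - i) * B ^ i))"
    by (subst S, subst S') (simp add: sum.distrib[symmetric] distrib_left add.commute)
  moreover have "g * (scal c * (A ^ i * B ^ k + A ^ k * B ^ i)) = scal c * (A ^ i * B ^ k + A ^ k * B ^ i) * g" for c i k
    by (rule commute_scal[OF symmetrized_monomial_commute[OF AB sum prod]])
  ultimately have "g * (S + S) = (S + S) * g"
    by (simp add: sum_distrib_left sum_distrib_right)
  then have "g * (scal (1 / 2) * (S + S)) = scal (1 / 2) * (S + S) * g"
    by (rule commute_scal)
  then show "g * S = S * g" unfolding scal_half .
qed

lemma commute_inverse:
  fixes g :: "'a :: ring_1"
  assumes "A * Ai = 1" "Ai * A = 1" "g * A = A * g"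
  shows "g * Ai = Ai * g"
  using inverse_conj[OF assms(1,2) assms(1,2) assms(3)] by simp

lemma scal_pair:
  assumes "A * B = B * A" "g * (A + B) = (A + B) * g" "g * (A * B) = A * B * g"
  shows "(scal c * A) * (scal c * B) = (scal c * B) * (scal c * A)"
    "g * (scal c * A + scal c * B) = (scal c * A + scal c * B) * g"
    "g * ((scal c * A) * (scal c * B)) = (scal c * A) * (scal c * B) * g"
proof -
  show "(scal c * A) * (scal c * B) = (scal c * B) * (scal c * A)" unfolding scal_mult_scal assms(1) ..
  show "g * (scal c * A + scal c * B) = (scal c * A + scal c * B) * g"
    unfolding distrib_left[symmetric] by (rule commute_scal[OF assms(2)])
  show "g * ((scal c * A) * (scal c * B)) = (scal c * A) * (scal c * B) * g"
    unfolding scal_mult_scal by (rule commute_scal[OF assms(3)])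
qed

context
  fixes N l a :: nat
  assumes a: "1 \<le> a" "a < N"
begin

lemma hecke_N: "affine_hecke N (\<lambda>i. gg i) (\<lambda>i. gi i) (wop N l) (scal (q_par - inverse q_par)) (Yop N l)"
  using affine_hecke_cyclic.axioms(1)[OF hecke_interp] a by simp

lemma gg_Yop_pair:
  "Yop N l a * Yop N l (Suc a) = Yop N l (Suc a) * Yop N l a"
  "gg a * (Yop N l a + Yop N l (Suc a)) = (Yop N l a + Yop N l (Suc a)) * gg a"
  "gg a * (Yop N l a * Yop N l (Suc a)) = Yop N l a * Yop N l (Suc a) * gg a"
  using affine_hecke.Y_commute[OF hecke_N, of a "Suc a"] affine_hecke.G_Y_sum[OF hecke_N, of a]
    affine_hecke.G_Y_prod[OF hecke_N, of a] a by auto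

lemma gg_Yinv_pair:
  "Yinv N l a * Yinv N l (Suc a) = Yinv N l (Suc a) * Yinv N l a"
  "gg a * (Yinv N l a + Yinv N l (Suc a)) = (Yinv N l a + Yinv N l (Suc a)) * gg a"
  "gg a * (Yinv N l a * Yinv N l (Suc a)) = Yinv N l a * Yinv N l (Suc a) * gg a"
proof -
  define A B Ai Bi where "A = Yop N l a" and "B = Yop N l (Suc a)" and "Ai = Yinv N l a" and "Bi = Yinv N l (Suc a)"
  have i: "A * Ai = 1" "Ai * A = 1" "B * Bi = 1" "Bi * B = 1"
    unfolding A_def B_def Ai_def Bi_def using a by (auto intro!: Yinv)
  have AB: "A * B = B * A" and sum: "gg a * (A + B) = (A + B) * gg a" and prod: "gg a * (A * B) = A * B * gg a"
    using gg_Yop_pair unfolding A_def B_def by auto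
  have BAi: "B * Ai = Ai * B" using commute_inverse[OF i(1,2)] AB by metis
  have ABi: "A * Bi = Bi * A" using commute_inverse[OF i(3,4) AB] .
  show AiBi: "Ai * Bi = Bi * Ai" using commute_inverse[OF i(3,4)] BAi by metis
  have "A * B * (Bi * Ai) = A * (B * Bi) * Ai" "Bi * Ai * (A * B) = Bi * (Ai * A) * B" by (simp_all only: mult.assoc)
  then have P: "A * B * (Bi * Ai) = 1" "Bi * Ai * (A * B) = 1" using i by simp_all
  show p: "gg a * (Ai * Bi) = Ai * Bi * gg a" unfolding AiBi by (rule commute_inverse[OF P prod])
  have "(A + B) * (Ai * Bi) = (A * Ai) * Bi + (B * Ai) * Bi" by (simp only: distrib_right mult.assoc)
  also have "\<dots> = Bi + Ai * (B * Bi)" unfolding BAi i by (simp add: mult.assoc i)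
  finally have s: "Ai + Bi = (A + B) * (Ai * Bi)" unfolding i by (simp add: add.commute)
  show "gg a * (Ai + Bi) = (Ai + Bi) * gg a" unfolding s by (rule commute_mult[OF sum p])
qed

lemma commutes_block_pair: "commutes (gg a) (opseries \<phi> (argop N l \<epsilon> \<kappa> (Suc a)) * opseries \<phi> (argop N l \<epsilon> \<kappa> a))"
proof (cases \<epsilon>)
  case Plus
  show ?thesis unfolding Plus argop_def sgn_pm.case
    by (intro commutes_opseries_pair scal_pair[where g = "gg a"] gg_Yinv_pair)
next
  case Minus
  show ?thesis unfolding Minus argop_def sgn_pm.case
    by (intro commutes_opseries_pair scal_pair[where g = "gg a"] gg_Yop_pair)
qed

lemma commutes_block_other:
  assumes "b \<in> {1..N}" "b \<noteq> a" "b \<noteq> Suc a"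
  shows "commutes (gg a) (opseries \<phi> (argop N l \<epsilon> \<kappa> b))"
proof (rule commutes_opseries)
  have Y: "gg a * Yop N l b = Yop N l b * gg a"
    using affine_hecke.G_Y[OF hecke_N, of a b] assms a by auto
  have "gg a * Yinv N l b = Yinv N l b * gg a"
    by (rule commute_inverse[OF Yinv(2,3)[OF assms(1)] Y])
  then have "gg a * (scal c * Yop N l b) = scal c * Yop N l b * gg a" "gg a * (scal c * Yinv N l b) = scal c * Yinv N l b * gg a" for c
    using Y by (auto intro: commute_scal)
  then show "gg a * argop N l \<epsilon> \<kappa> b = argop N l \<epsilon> \<kappa> b * gg a"
    by (cases \<epsilon>) (simp_all add: argop_def)
qed

lemma commutes_block_list:
  assumes "set xs \<subseteq> {1..N} - {a, Suc a}" "commutes (gg a) V"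
  shows "commutes (gg a) (block_series N l \<epsilon> m \<kappa> xs V)"
  using assms
  by (induction xs arbitrary: V)
    (simp_all add: block_series_def commutes_mult[OF commutes_block_other] del: One_nat_def)

text \<open>If the letters at \<open>a\<close> and \<open>a + 1\<close> agree, then both or none of these indices occur, and they occur next to each other.\<close>

lemma commutes_block_series:
  assumes "P a = P (Suc a)" "commutes (gg a) V"
  shows "commutes (gg a) (block_series N l \<epsilon> m \<kappa> (filter P [1..<N + 1]) V)"
proof -
  have "[1..<N + 1] = [1..<a] @ [a..<N + 1]" using a upt_add_eq_append[of 1 a "N + 1 - a"] by simp
  moreover have "[a..<N + 1] = a # Suc a # [Suc (Suc a)..<N + 1]" using a by (simp add: upt_rec)
  ultimately have "[1..<N + 1] = [1..<a] @ [a, Suc a] @ [Suc (Suc a)..<N + 1]" by simp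
  then have f: "filter P [1..<N + 1] = filter P [1..<a] @ filter P [a, Suc a] @ filter P [Suc (Suc a)..<N + 1]"
    by (simp only: filter_append)
  have app: "block_series N l \<epsilon> m \<kappa> (xs @ ys) W = block_series N l \<epsilon> m \<kappa> ys (block_series N l \<epsilon> m \<kappa> xs W)" for xs ys W
    by (simp add: block_series_def)
  have pair: "commutes (gg a) (block_series N l \<epsilon> m \<kappa> (filter P [a, Suc a]) W)" if "commutes (gg a) W" for W
    using assms(1) that commutes_mult[OF commutes_block_pair that]
    by (auto simp: block_series_def mult.assoc)
  show ?thesis unfolding f app
    using a by (intro commutes_block_list pair assms(2)) auto
qed

lemma commutes_K_op: "j a = j (Suc a) \<Longrightarrow> commutes (gg a) (K_op N l i \<epsilon> j)"
  unfolding K_op_def by (intro commutes_block_series commutes_1) simp_all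

end

subsection \<open>Invariance and eigenvectors\<close>

text \<open>A property of operators that is closed under ring operations and holds for scalars and for the \<open>Y\<^sub>a\<close> and their inverses
holds for all coefficients of the series. It is used for invariance and for being diagonal on a vector.\<close>

locale op_class =
  fixes N l :: nat and P :: "lop \<Rightarrow> bool"
  assumes one: "P 1" and zero: "P 0" and add: "P F \<Longrightarrow> P G \<Longrightarrow> P (F + G)" and mult: "P F \<Longrightarrow> P G \<Longrightarrow> P (F * G)"
    and scal: "P (scal c)" and Y: "a \<in> {1..N} \<Longrightarrow> P (Yop N l a)" "a \<in> {1..N} \<Longrightarrow> P (Yinv N l a)"
begin

lemma power: "P F \<Longrightarrow> P (F ^ k)" by (induction k) (auto intro: one mult)

lemma sum: "(\<And>i. i \<in> A \<Longrightarrow> P (f i)) \<Longrightarrow> P (sum f A)"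
  by (induction A rule: infinite_finite_induct) (auto intro: zero add)

lemma block: "set xs \<subseteq> {1..N} \<Longrightarrow> \<forall>n. P (fps_nth V n) \<Longrightarrow> P (fps_nth (block_series N l \<epsilon> m \<kappa> xs V) n)"
proof (induction xs arbitrary: V n)
  case (Cons a xs)
  have "P (argop N l \<epsilon> \<kappa> a)" using Cons.prems by (cases \<epsilon>) (auto simp: argop_def intro!: mult scal Y)
  then have "\<forall>n. P (fps_nth (opseries (theta \<epsilon> m) (argop N l \<epsilon> \<kappa> a) * V) n)"
    using Cons.prems by (auto simp: fps_mult_nth opseries_def intro!: sum mult scal power)
  then show ?case using Cons by (simp add: block_series_def)
qed (simp add: block_series_def)

lemma K: "P (fps_nth (K_op N l i \<epsilon> j) n)"
proof -
  have "\<forall>n. P (fps_nth 1 n)" using one zero by simp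
  then show ?thesis unfolding K_op_def by (intro block allI) auto
qed

end

lemma pres_K_op: "pres N (fps_nth (K_op N l i \<epsilon> j) n)"
proof -
  interpret op_class N l "pres N"
    using unit_pres_Yop Yinv(1)
    by unfold_locales (auto simp: pres_def unit_pres_def intro: LP_add LP_const_mult)
  show ?thesis by (rule K)
qed

definition joint_eigen :: "nat \<Rightarrow> nat \<Rightarrow> laurent \<Rightarrow> bool" where
  "joint_eigen N l h \<longleftrightarrow> (\<forall>a\<in>{1..N}. \<exists>y. app (Yop N l a) h = const_L y * h)"

lemma eigen_K_op:
  assumes "joint_eigen N l h"
  shows "\<exists>y. app (fps_nth (K_op N l i \<epsilon> j) n) h = const_L y * h"
proof -
  interpret op_class N l "\<lambda>F. \<exists>y. app F h = const_L y * h"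
  proof
    show "\<exists>y. app 1 h = const_L y * h" by (intro exI[of _ 1]) simp
    show "\<exists>y. app 0 h = const_L y * h" by (intro exI[of _ 0]) simp
    show "\<exists>y. app (F + G) h = const_L y * h" if "\<exists>y. app F h = const_L y * h" "\<exists>y. app G h = const_L y * h" for F G
      using that by (auto simp: const_L_add distrib_right intro: exI[of _ "_ + _"] simp flip: distrib_right)
    show "\<exists>y. app (F * G) h = const_L y * h" if "\<exists>y. app F h = const_L y * h" "\<exists>y. app G h = const_L y * h" for F G
      using that by (auto simp flip: const_L_mult mult.assoc)
    show "\<exists>y. app (scal c) h = const_L y * h" for c by auto
    show "\<exists>y. app (Yop N l a) h = const_L y * h" if "a \<in> {1..N}" for a
      using that assms by (simp add: joint_eigen_def)
    show "\<exists>y. app (Yinv N l a) h = const_L y * h" if a: "a \<in> {1..N}" for a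
    proof -
      have "\<exists>y. app (Yop N l a) h = const_L y * h"
        using assms a unfolding joint_eigen_def by (rule bspec)
      then obtain y where y: "app (Yop N l a) h = const_L y * h" ..
      (* an eigenvalue 0 forces h = 0, and then every value is an eigenvalue *)
      define X where "X = app (Yinv N l a) h"
      have "app (Yinv N l a * Yop N l a) h = h" unfolding Yinv(3)[OF a] by simp
      then have e: "const_L y * X = h" by (simp add: y X_def)
      show ?thesis
      proof (cases "y = 0")
        case True
        then have "h = 0" using e by simp
        then show ?thesis by simp
      next
        case False
        then have "X = const_L (inverse y) * (const_L y * X)"
          by (simp flip: mult.assoc const_L_mult)
        then have "X = const_L (inverse y) * h" unfolding e .
        then show ?thesis unfolding X_def by blast
      qed
    qed
  qed
  show ?thesis by (rule K)
qed

section \<open>The operators K on the wedge space\<close>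

definition K_lift :: "nat \<Rightarrow> nat \<Rightarrow> nat \<Rightarrow> sgn_pm \<Rightarrow> nat \<Rightarrow> tensor \<Rightarrow> tensor" where
  "K_lift N l i \<epsilon> n = lin_ext (\<lambda>j h. single j (app (fps_nth (K_op N l i \<epsilon> j) n) h))"

lemma K_lift_single:
  "K_lift N l i \<epsilon> n (single j h) = single j (app (fps_nth (K_op N l i \<epsilon> j) n) h)"
  by (simp add: K_lift_def)

lemma lin_K_lift: "lin (K_lift N l i \<epsilon> n)"
  unfolding K_lift_def by (rule lin_lin_ext) (simp_all add: single_add)

text \<open>After straightening, relations are generated by symmetric coefficients, that is, by eigenvectors of \<open>G\<^sub>a\<close> for \<open>q\<close>. An
operator commuting with \<open>G\<^sub>a\<close> preserves them.\<close>

lemma stable_K: "stable N l (K_lift N l i \<epsilon> n \<circ> Straighten N)"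
  unfolding stable_def
proof (intro conjI ballI)
  show "lin (K_lift N l i \<epsilon> n \<circ> Straighten N)" by (intro lin_comp lin_K_lift lin_Str)
next
  fix x assume "x \<in> tensors N l"
  then have "Straighten N x \<in> tensors N l" using Str_tensors(1) by (auto simp: sorted_tensors_def)
  then have "K_lift N l i \<epsilon> n (Straighten N x) \<in> tensors N l"
    by (induction rule: tensors_induct)
      (auto simp: lin_0[OF lin_K_lift] lin_add[OF lin_K_lift] K_lift_single
        intro: tensors_add tensors_single presD[OF pres_K_op])
  then show "(K_lift N l i \<epsilon> n \<circ> Straighten N) x \<in> tensors N l" by simp
next
  fix x assume "x \<in> hecke_rel N l"
  then have "Straighten N x \<in> T.span (sorted_sym_rel N l)" by (rule Str_hecke)
  then have "K_lift N l i \<epsilon> n (Straighten N x) \<in> T.span (sorted_sym_rel N l)"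
  proof (rule lin_span[OF lin_K_lift, rotated])
    fix g assume "g \<in> sorted_sym_rel N l"
    then obtain j a f where g: "g = single j f" and j: "j \<in> letters N l" "\<forall>b. \<not> descent N j b" "1 \<le> a" "a < N"
      "j a = j (Suc a)" "f \<in> LP N" "app (sw a) f = f"
      unfolding sorted_sym_rel_def by blast
    let ?U = "fps_nth (K_op N l i \<epsilon> j) n"
    have "gg a * ?U = ?U * gg a"
      using commutes_K_op[OF j(3,4,5), of l i \<epsilon>] unfolding commutes_def by blast
    then have "app (gg a) (app ?U f) = app ?U (app (gg a) f)" by (metis app_times)
    also have "app (gg a) f = QL * f" using j by (intro gop_symmetric) auto
    finally have "app (sw a) (app ?U f) = app ?U f" by (intro symmetric_gop) auto
    moreover have "app ?U f \<in> LP N" using j by (intro presD[OF pres_K_op])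
    ultimately have "single j (app ?U f) \<in> sorted_sym_rel N l"
      unfolding sorted_sym_rel_def using j by blast
    then show "K_lift N l i \<epsilon> n g \<in> T.span (sorted_sym_rel N l)"
      unfolding g K_lift_single by (rule T.span_base)
  qed
  then show "(K_lift N l i \<epsilon> n \<circ> Straighten N) x \<in> hecke_rel N l" using sorted_sym_rel_hecke by auto
qed

lemma K_finite_eq: "K_finite N l i \<epsilon> n = induced N l (K_lift N l i \<epsilon> n \<circ> Straighten N)"
  unfolding K_finite_def
proof (rule the_equality)
  have val: "induced N l (K_lift N l i \<epsilon> n \<circ> Straighten N) (wtens N l h j) = wtens N l (fps_nth (K_series N l i \<epsilon> j h) n) j"
    if "j \<in> letters N l" "mono_on {1..N} j" "h \<in> LP N" for j h
  proof -
    have "\<And>a. \<not> descent N j a" using that(2) by (simp add: mono_iff_no_descent del: One_nat_def)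
    then show ?thesis
      using that by (simp add: wtens_letters induced_wcoset[OF stable_K] tensors_single Str_single str_sorted
          K_lift_single K_series_app)
  qed
  then show "wedge_endo N l (induced N l (K_lift N l i \<epsilon> n \<circ> Straighten N)) \<and>
    (\<forall>j\<in>letters N l. mono_on {1..N} j \<longrightarrow> (\<forall>h\<in>LP N.
       induced N l (K_lift N l i \<epsilon> n \<circ> Straighten N) (wtens N l h j) = wtens N l (fps_nth (K_series N l i \<epsilon> j h) n) j))"
    using induced_endo[OF stable_K] by blast
  fix F
  assume F: "wedge_endo N l F \<and>
    (\<forall>j\<in>letters N l. mono_on {1..N} j \<longrightarrow> (\<forall>h\<in>LP N. F (wtens N l h j) = wtens N l (fps_nth (K_series N l i \<epsilon> j h) n) j))"
  show "F = induced N l (K_lift N l i \<epsilon> n \<circ> Straighten N)"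
  proof (rule endo_eqI)
    fix j f assume j: "j \<in> letters N l" "\<And>a. \<not> descent N j a" "f \<in> LP N"
    then have "mono_on {1..N} j" unfolding mono_iff_no_descent by blast
    then show "F (wcoset N l (single j f)) = induced N l (K_lift N l i \<epsilon> n \<circ> Straighten N) (wcoset N l (single j f))"
      using F val[of j f] j unfolding wtens_letters[OF j(1), symmetric] by metis
  qed (use F induced_endo[OF stable_K] in auto)
qed

lemma K_finite_eigen:
  assumes "j \<in> letters N l" "\<And>a. \<not> descent N j a" "h \<in> LP N" "joint_eigen N l h"
  shows "\<exists>y. K_finite N l i \<epsilon> n (wcoset N l (single j h)) = scale_W N l y (wcoset N l (single j h))"
proof -
  obtain y where y: "app (fps_nth (K_op N l i \<epsilon> j) n) h = const_L y * h"
    using eigen_K_op[OF assms(4)] by blast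
  have "K_finite N l i \<epsilon> n (wcoset N l (single j h)) = wcoset N l (single j (const_L y * h))"
    using assms unfolding K_finite_eq
    by (simp add: induced_wcoset[OF stable_K] tensors_single Str_single str_sorted K_lift_single y)
  then show ?thesis by (auto simp: scale_W_wcoset)
qed

section \<open>Twisted shifts of the letters\<close>

definition zprod :: "nat \<Rightarrow> (nat \<Rightarrow> laurent) \<Rightarrow> (nat \<Rightarrow> bool) \<Rightarrow> (nat \<Rightarrow> nat) \<Rightarrow> laurent" where
  "zprod N v P j = (\<Prod>a\<in>{a\<in>{1..N}. P (j a)}. v a)"

text \<open>Applies \<open>s\<close> to every letter and multiplies by \<open>v a\<close> for each position \<open>a\<close> whose letter satisfies \<open>P\<close>. Both \<open>\<rho>\<close> and its
inverse have this form.\<close>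

definition relabel :: "nat \<Rightarrow> (nat \<Rightarrow> laurent) \<Rightarrow> (nat \<Rightarrow> bool) \<Rightarrow> (nat \<Rightarrow> nat) \<Rightarrow> tensor \<Rightarrow> tensor" where
  "relabel N v P s = lin_ext (\<lambda>j h. single (restrict (s \<circ> j) {1..N}) (zprod N v P j * h))"

lemma relabel_single:
  "relabel N v P s (single j h) = single (restrict (s \<circ> j) {1..N}) (zprod N v P j * h)"
  by (simp add: relabel_def)

lemma lin_relabel: "lin (relabel N v P s)"
  unfolding relabel_def by (rule lin_lin_ext) (simp_all add: distrib_left single_add mult.left_commute)

lemma alg_hom_prod: "alg_hom \<phi> \<Longrightarrow> app \<phi> (prod f A) = (\<Prod>i\<in>A. app \<phi> (f i))"
  by (induction A rule: infinite_finite_induct) (auto simp: alg_hom_def)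

lemma restrict_jsw:
  assumes "1 \<le> a" "a < N"
  shows "restrict (s \<circ> jsw j a) {1..N} = jsw (restrict (s \<circ> j) {1..N}) a"
  using assms by (auto simp: fun_eq_iff transpose_def)

text \<open>Conditions on \<open>s\<close> under which relabelling is compatible with the Hecke relations: it is monotone except that the letter in
\<open>P\<close> wraps around. The last two assumptions say that the factor attached to the wrapped letter turns \<open>G\<^sub>a\<^sup>-\<^sup>1\<close> into \<open>G\<^sub>a\<close>, as is
needed because the relabelled pair is in the opposite order.\<close>

locale letter_shift =
  fixes N l :: nat and v :: "nat \<Rightarrow> laurent" and P :: "nat \<Rightarrow> bool" and s :: "nat \<Rightarrow> nat"
  assumes v_swp: "app (swp a b) (v c) = v (transpose a b c)"
    and v_LP: "a \<in> {1..N} \<Longrightarrow> v a \<in> LP N"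
    and s_less: "x < l \<Longrightarrow> s x < l"
    and s_mono: "x < y \<Longrightarrow> y < l \<Longrightarrow> P x = P y \<Longrightarrow> \<not> P x \<and> s x < s y"
    and s_anti: "x < y \<Longrightarrow> y < l \<Longrightarrow> P x \<noteq> P y \<Longrightarrow> s y < s x"
    and v_low: "P x \<Longrightarrow> \<not> P y \<Longrightarrow> x < y \<Longrightarrow> y < l \<Longrightarrow> mulop (v a) * gi a = gg a * mulop (v (Suc a))"
    and v_high: "\<not> P x \<Longrightarrow> P y \<Longrightarrow> x < y \<Longrightarrow> y < l \<Longrightarrow> mulop (v (Suc a)) * gi a = gg a * mulop (v a)"
begin

lemma zprod_swp:
  assumes "1 \<le> a" "a < N"
  shows "app (sw a) (zprod N v P j) = zprod N v P (jsw j a)"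
proof -
  let ?t = "transpose a (Suc a)"
  have "?t b \<in> {1..N} \<longleftrightarrow> b \<in> {1..N}" for b using assms by (auto simp: transpose_def)
  then have "bij_betw ?t {b\<in>{1..N}. P (j b)} {b\<in>{1..N}. P (jsw j a b)}"
    by (intro bij_betwI[where g = ?t]) auto
  then have "(\<Prod>b\<in>{b\<in>{1..N}. P (j b)}. v (?t b)) = (\<Prod>b\<in>{b\<in>{1..N}. P (jsw j a b)}. v b)"
    by (rule prod.reindex_bij_betw)
  then show ?thesis by (simp only: zprod_def alg_hom_prod[OF alg_hom_swp] v_swp)
qed

lemma gi_mulop_commute: "app (sw a) h = h \<Longrightarrow> gi a * mulop h = mulop h * gi a"
  using gop_mulop_commute[of a "Suc a" h] scal_commute[of _ "mulop h"]
  by (simp add: gin_def left_diff_distrib right_diff_distrib)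

lemma zprod_twist:
  assumes a: "1 \<le> a" "a < N" and x: "x = a \<or> x = Suc a" and P: "P (j x)" "\<not> P (j (transpose a (Suc a) x))"
    and v: "mulop (v (transpose a (Suc a) x)) * gi a = gg a * mulop (v x)"
  shows "zprod N v P (jsw j a) * app (gi a) f = app (gg a) (zprod N v P j * f)"
proof -
  let ?t = "transpose a (Suc a)"
  define A where "A = {b\<in>{1..N}. P (j b)} - {a, Suc a}"
  define Z where "Z = prod v A"
  have "{b\<in>{1..N}. P (j b)} = insert x A"
    using a x P unfolding A_def by (auto simp: transpose_def split: if_splits)
  moreover have "x \<notin> A" "finite A" using x by (auto simp: A_def)
  ultimately have zj: "zprod N v P j = v x * Z" by (simp add: zprod_def Z_def)
  have "app (sw a) Z = (\<Prod>b\<in>A. v (?t b))"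
    by (simp add: Z_def alg_hom_prod[OF alg_hom_swp] v_swp)
  also have "\<dots> = Z" unfolding Z_def by (rule prod.cong) (auto simp: A_def transpose_def)
  finally have Z: "app (sw a) Z = Z" .
  have zj': "zprod N v P (jsw j a) = v (?t x) * Z"
    unfolding zprod_swp[OF a, symmetric] zj alg_hom_mult[OF alg_hom_swp] Z v_swp ..
  have "app (mulop (v (?t x)) * gi a) f = app (gg a * mulop (v x)) f" unfolding v ..
  then have "Z * (v (?t x) * app (gi a) f) = Z * app (gg a) (v x * f)" by simp
  also have "\<dots> = app (gg a) (Z * (v x * f))"
    using gop_mulop_commute[of a "Suc a" Z] Z by (metis app_mulop app_times n_not_Suc_n)
  finally show ?thesis unfolding zj zj' by (simp add: mult_ac)
qed

lemma relabel_letters: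
  assumes "j \<in> letters N l"
  shows "restrict (s \<circ> j) {1..N} \<in> letters N l"
proof -
  have "j a < l" if "a \<in> {1..N}" for a using assms that unfolding letters_def by auto
  then show ?thesis unfolding letters_def by (auto simp: s_less)
qed

lemma zprod_LP: "zprod N v P j \<in> LP N"
  unfolding zprod_def by (rule LP_prod) (auto intro!: v_LP)

lemma letters_less: "j \<in> letters N l \<Longrightarrow> a \<in> {1..N} \<Longrightarrow> j a < l"
  unfolding letters_def by auto

text \<open>Relations are mapped to relations of the same kind. If exactly one of the two exchanged letters wraps around, then the
descent becomes an ascent, and the image is the exchange relation for the swapped letters and the coefficient \<open>G\<^sub>a u\<close>.\<close>

lemma relabel_stable: "stable N l (relabel N v P s)"
  unfolding stable_def
proof (intro conjI ballI)
  show "lin (relabel N v P s)" by (rule lin_relabel)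
next
  fix x assume "x \<in> tensors N l"
  then show "relabel N v P s x \<in> tensors N l"
    by (induction rule: tensors_induct)
      (auto simp: lin_0[OF lin_relabel] lin_add[OF lin_relabel] relabel_single simp del: One_nat_def
        intro: tensors_add tensors_single relabel_letters LP_mult zprod_LP)
next
  fix x assume "x \<in> hecke_rel N l"
  then have "relabel N v P s x \<in> T.span (sym_rel N l \<union> swap_rel N l)"
  proof (rule lin_hecke[OF lin_relabel, rotated 2])
    fix g assume "g \<in> sym_rel N l"
    then obtain j a f where g: "g = single j f"
      and j: "j \<in> letters N l" "1 \<le> a" "a < N" "j a = j (Suc a)" "f \<in> LP N" "app (sw a) f = f"
      unfolding sym_rel_def by blast
    let ?j = "restrict (s \<circ> j) {1..N}"
    have "jsw j a = j" using j(4) by (auto simp: fun_eq_iff transpose_def)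
    then have "app (sw a) (zprod N v P j * f) = zprod N v P j * f"
      using zprod_swp[OF j(2,3), of j] j(6) by (simp add: alg_hom_mult[OF alg_hom_swp])
    moreover have "?j a = ?j (Suc a)" using j by simp
    moreover have "zprod N v P j * f \<in> LP N" using j zprod_LP by (intro LP_mult)
    ultimately have "relabel N v P s g \<in> sym_rel N l"
      unfolding g relabel_single sym_rel_def using j relabel_letters[OF j(1)] by blast
    then show "relabel N v P s g \<in> T.span (sym_rel N l \<union> swap_rel N l)" by (intro T.span_base) blast
  next
    fix g assume "g \<in> swap_rel N l"
    then obtain j a f where g: "g = single j f + single (jsw j a) (app (gi a) f)"
      and j: "j \<in> letters N l" "1 \<le> a" "a < N" "j (Suc a) < j a" "f \<in> LP N"
      unfolding swap_rel_def by blast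
    let ?j = "restrict (s \<circ> j) {1..N}" and ?u = "zprod N v P j * f"
    have jl: "j a < l" using j by (intro letters_less) auto
    have u: "?u \<in> LP N" using j zprod_LP by (intro LP_mult)
    have R: "relabel N v P s g = single ?j ?u + single (jsw ?j a) (zprod N v P (jsw j a) * app (gi a) f)"
      unfolding g lin_add[OF lin_relabel] relabel_single restrict_jsw[OF j(2,3)] ..
    have "relabel N v P s g \<in> swap_rel N l"
    proof (cases "P (j (Suc a)) = P (j a)")
      case True
      then have m: "\<not> P (j (Suc a))" "s (j (Suc a)) < s (j a)" using s_mono[OF j(4) jl] by auto
      have "{b\<in>{1..N}. P (jsw j a b)} = {b\<in>{1..N}. P (j b)}"
        using m(1) True by (auto simp: transpose_def)
      then have zz: "zprod N v P (jsw j a) = zprod N v P j" unfolding zprod_def by simp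
      then have "app (sw a) (zprod N v P j) = zprod N v P j" using zprod_swp[OF j(2,3)] by simp
      then have "zprod N v P (jsw j a) * app (gi a) f = app (gi a) ?u"
        using gi_mulop_commute[of a "zprod N v P j"] unfolding zz by (metis app_mulop app_times)
      moreover have "?j (Suc a) < ?j a" using m j by simp
      ultimately show ?thesis
        unfolding R swap_rel_def using j relabel_letters[OF j(1)] u by (intro CollectI exI[of _ ?j] exI[of _ a] exI[of _ ?u]) simp
    next
      case False
      have "zprod N v P (jsw j a) * app (gi a) f = app (gg a) ?u"
      proof (cases "P (j a)")
        case True
        then show ?thesis
          using False j v_high[OF _ _ j(4) jl] by (intro zprod_twist[where x = a]) auto
      next
        case nP: False
        then show ?thesis
          using False j v_low[OF _ _ j(4) jl] by (intro zprod_twist[where x = "Suc a"]) auto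
      qed
      moreover have "app (gi a) (app (gg a) ?u) = ?u"
        using gin_gop[of a "Suc a"] by (simp flip: app_times)
      ultimately have "relabel N v P s g = single (jsw ?j a) (app (gg a) ?u)
          + single (jsw (jsw ?j a) a) (app (gi a) (app (gg a) ?u))"
        unfolding R by (simp add: add.commute del: o_apply)
      moreover have "jsw ?j a (Suc a) < jsw ?j a a"
        using s_anti[OF j(4) jl False] j by simp
      moreover have "app (gg a) ?u \<in> LP N" using j u by (intro presD[OF gop_LP]) auto
      moreover have "jsw ?j a \<in> letters N l" using j by (intro letters_swap relabel_letters)
      ultimately show ?thesis
        unfolding swap_rel_def using j(2,3) by blast
    qed
    then show "relabel N v P s g \<in> T.span (sym_rel N l \<union> swap_rel N l)" by (intro T.span_base) blast
  qed
  then show "relabel N v P s x \<in> hecke_rel N l" unfolding hecke_rel_presentation .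
qed

end

definition s_down :: "nat \<Rightarrow> nat \<Rightarrow> nat" where "s_down l x = (if x = 0 then l - 1 else x - 1)"
definition s_up :: "nat \<Rightarrow> nat \<Rightarrow> nat" where "s_up l x = (if x = l - 1 then 0 else x + 1)"

definition rdown :: "nat \<Rightarrow> nat \<Rightarrow> tensor \<Rightarrow> tensor" where
  "rdown N l = relabel N var_z (\<lambda>x. x = 0) (s_down l)"
definition rup :: "nat \<Rightarrow> nat \<Rightarrow> tensor \<Rightarrow> tensor" where
  "rup N l = relabel N zinv (\<lambda>x. x = l - 1) (s_up l)"

lemma stable_rdown: "stable N l (rdown N l)"
  unfolding rdown_def
proof (rule letter_shift.relabel_stable, unfold_locales)
  show "mulop (var_z a) * gi a = gg a * mulop (var_z (Suc a))" for a
    by (rule gop_var[symmetric]) simp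
qed (auto simp: s_down_def LP_var)

lemma stable_rup: "stable N l (rup N l)"
  unfolding rup_def
proof (rule letter_shift.relabel_stable, unfold_locales)
  show "mulop (zinv (Suc a)) * gi a = gg a * mulop (zinv a)" for a
    by (rule gop_zinv[symmetric]) simp
qed (auto simp: s_up_def LP_var)

lemma down_up:
  assumes "x \<in> tensors N l" "l > 0"
  shows "rdown N l (rup N l x) = x" "rup N l (rdown N l x) = x"
proof -
  have lin: "lin (rdown N l)" "lin (rup N l)" unfolding rdown_def rup_def by (rule lin_relabel)+
  have zz: "zprod N var_z (\<lambda>x. x = 0) (restrict (s_up l \<circ> j) {1..N}) * zprod N zinv (\<lambda>x. x = l - 1) j = 1"
    "zprod N zinv (\<lambda>x. x = l - 1) (restrict (s_down l \<circ> j) {1..N}) * zprod N var_z (\<lambda>x. x = 0) j = 1"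
    "restrict (s_down l \<circ> restrict (s_up l \<circ> j) {1..N}) {1..N} = j"
    "restrict (s_up l \<circ> restrict (s_down l \<circ> j) {1..N}) {1..N} = j"
    if "j \<in> letters N l" for j
  proof -
    have jl: "j a < l" if "a \<in> {1..N}" for a using \<open>j \<in> letters N l\<close> that unfolding letters_def by auto
    have "{a\<in>{1..N}. restrict (s_up l \<circ> j) {1..N} a = 0} = {a\<in>{1..N}. j a = l - 1}"
      by (auto simp: s_up_def)
    then show "zprod N var_z (\<lambda>x. x = 0) (restrict (s_up l \<circ> j) {1..N}) * zprod N zinv (\<lambda>x. x = l - 1) j = 1"
      by (simp add: zprod_def flip: prod.distrib)
    have "(s_down l (j a) = l - 1) = (j a = 0)" if "a \<in> {1..N}" for a
      using jl[OF that] by (auto simp: s_down_def)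
    then have "{a\<in>{1..N}. restrict (s_down l \<circ> j) {1..N} a = l - 1} = {a\<in>{1..N}. j a = 0}"
      by auto
    then show "zprod N zinv (\<lambda>x. x = l - 1) (restrict (s_down l \<circ> j) {1..N}) * zprod N var_z (\<lambda>x. x = 0) j = 1"
      by (simp add: zprod_def flip: prod.distrib)
    have out: "j a = undefined" if "a \<notin> {1..N}" for a
      using \<open>j \<in> letters N l\<close> that unfolding letters_def by (rule PiE_arb)
    show "restrict (s_down l \<circ> restrict (s_up l \<circ> j) {1..N}) {1..N} = j"
      using jl out by (auto simp: fun_eq_iff s_down_def s_up_def restrict_def)
    have "s_up l (s_down l (j a)) = j a" if "a \<in> {1..N}" for a
      using jl[OF that] by (auto simp: s_down_def s_up_def)
    then show "restrict (s_up l \<circ> restrict (s_down l \<circ> j) {1..N}) {1..N} = j"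
      using out by (auto simp: fun_eq_iff restrict_def)
  qed
  have "rdown N l (rup N l x) = x \<and> rup N l (rdown N l x) = x"
    using assms(1)
  proof (induction rule: tensors_induct)
    case zero
    show ?case by (simp add: lin[THEN lin_0])
  next
    case (single j f)
    show ?case
      unfolding rdown_def rup_def relabel_single zz(3,4)[OF single(1)] mult.assoc[symmetric] zz(1,2)[OF single(1)] by simp
  next
    case (add x y)
    then show ?case by (simp add: lin[THEN lin_add])
  qed
  then show "rdown N l (rup N l x) = x" "rup N l (rdown N l x) = x" by auto
qed

section \<open>The automorphism rho\<close>

definition jpart_fun :: "nat \<Rightarrow> nat \<Rightarrow> (nat \<Rightarrow> int) \<Rightarrow> nat \<Rightarrow> nat" where
  "jpart_fun N l k = restrict (\<lambda>a. j_part l (k a)) {1..N}"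

lemma jpart_fun_letters: "l > 0 \<Longrightarrow> jpart_fun N l k \<in> letters N l"
  unfolding jpart_fun_def letters_def by (auto intro!: j_part_m_part)

lemma u_vec_eq: "u_vec N l k = wcoset N l (single (jpart_fun N l k) (z_monom N (\<lambda>a. m_part l (k a))))"
  by (simp add: u_vec_def wtens_def tens_v_basis jpart_fun_def)

lemma parts_unique:
  assumes "x < l" "k = int x - int l * (m + 1)"
  shows "j_part l k = x" "m_part l k = m"
proof -
  have k: "k = int x + int l * (- (m + 1))" using assms(2) by (simp add: algebra_simps)
  have "k mod int l = int x" unfolding k using assms(1) by simp
  then show "j_part l k = x" by (simp add: j_part_def)
  have "k div int l = - (m + 1)" unfolding k using assms(1) by (subst div_mult_self2) auto
  then show "m_part l k = m" by (simp add: m_part_def)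
qed

text \<open>Lowering \<open>k\<close> by one lowers its letter, and a letter \<open>0\<close> wraps around to \<open>l - 1\<close> at the expense of one more power of \<open>z\<close>.\<close>

lemma parts_pred:
  assumes "l > 0"
  shows "j_part l (k - 1) = s_down l (j_part l k)"
    and "m_part l (k - 1) = m_part l k + (if j_part l k = 0 then 1 else 0)"
proof -
  note jm = j_part_m_part[OF assms, of k]
  have "s_down l (j_part l k) < l" using jm(1) assms by (auto simp: s_down_def)
  moreover have "k - 1 = int (s_down l (j_part l k)) - int l * (m_part l k + (if j_part l k = 0 then 1 else 0) + 1)"
    using jm assms by (subst jm(2)) (auto simp: s_down_def algebra_simps of_nat_diff)
  ultimately show "j_part l (k - 1) = s_down l (j_part l k)" "m_part l (k - 1) = m_part l k + (if j_part l k = 0 then 1 else 0)"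
    using parts_unique by blast+
qed

lemma z_monom_cong: "(\<And>a. a \<in> {1..N} \<Longrightarrow> m a = n a) \<Longrightarrow> z_monom N m = z_monom N n"
  unfolding z_monom_def using exponent_eq_iff[of N m n] by simp

lemma z_monom_var:
  assumes "A \<subseteq> {1..N}"
  shows "prod var_z A * z_monom N m = z_monom N (\<lambda>a. m a + (if a \<in> A then 1 else 0))"
proof -
  have "finite A" using assms finite_subset by blast
  then have "prod var_z A = single (\<Sum>a\<in>A. single a 1) 1"
    by (induction A rule: finite_induct) (simp_all add: var_z_def mult_single)
  moreover have "(\<Sum>a\<in>A. single a 1) + exponent N m = exponent N (\<lambda>a. m a + (if a \<in> A then 1 else 0))"
    by (rule poly_mapping_eqI)
      (use assms \<open>finite A\<close> in \<open>auto simp: lookup_add lookup_sum lookup_single when_def sum.delta\<close>)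
  ultimately show ?thesis by (simp add: z_monom_def mult_single)
qed

lemma rdown_u:
  assumes "l > 0"
  shows "rdown N l (single (jpart_fun N l k) (z_monom N (\<lambda>a. m_part l (k a))))
    = single (jpart_fun N l (\<lambda>a. k a - 1)) (z_monom N (\<lambda>a. m_part l (k a - 1)))"
proof -
  have 1: "restrict (s_down l \<circ> jpart_fun N l k) {1..N} = jpart_fun N l (\<lambda>a. k a - 1)"
    by (auto simp: fun_eq_iff jpart_fun_def parts_pred[OF assms])
  have 2: "{a \<in> {1..N}. jpart_fun N l k a = 0} = {a \<in> {1..N}. j_part l (k a) = 0}"
    by (auto simp: jpart_fun_def)
  have 3: "zprod N var_z (\<lambda>x. x = 0) (jpart_fun N l k) * z_monom N (\<lambda>a. m_part l (k a)) = z_monom N (\<lambda>a. m_part l (k a - 1))"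
    unfolding zprod_def 2
    by (subst z_monom_var, blast, rule z_monom_cong) (simp add: parts_pred[OF assms])
  show ?thesis unfolding rdown_def relabel_single 1 3 ..
qed

text \<open>The vectors \<open>u\<^sub>k\<close> are all pure tensors of monomials and basis vectors, so that they determine an endomorphism.\<close>

lemma rho_eq:
  assumes l: "l > 0"
  shows "rho N l = induced N l (rdown N l)" "bij_betw (rho N l) (wedge N l) (wedge N l)"
proof -
  let ?R = "induced N l (rdown N l)"
  have bij: "bij_betw ?R (wedge N l) (wedge N l)"
  proof (rule bij_betwI[where g = "induced N l (rup N l)"])
    show "?R \<in> wedge N l \<rightarrow> wedge N l" "induced N l (rup N l) \<in> wedge N l \<rightarrow> wedge N l"
      using induced_endo[OF stable_rdown] induced_endo[OF stable_rup] unfolding wedge_endo_def by (auto simp: PiE_def)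
    fix X assume "X \<in> wedge N l"
    then obtain x where x: "x \<in> tensors N l" "X = wcoset N l x" by (auto simp: wedge_def)
    have t: "rdown N l x \<in> tensors N l" "rup N l x \<in> tensors N l"
      using stable_rdown stable_rup x(1) unfolding stable_def by auto
    show "induced N l (rup N l) (?R X) = X" "?R (induced N l (rup N l) X) = X"
      unfolding x(2) using x(1) t down_up[OF x(1) l]
      by (simp_all add: induced_wcoset[OF stable_rdown] induced_wcoset[OF stable_rup])
  qed
  have u: "?R (u_vec N l k) = u_vec N l (\<lambda>a. k a - 1)" for k
    unfolding u_vec_eq
    by (subst induced_wcoset[OF stable_rdown]) (simp_all add: tensors_single jpart_fun_letters[OF l] z_monom_LP rdown_u[OF l])
  show r: "rho N l = ?R"
    unfolding rho_def
  proof (rule the_equality)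
    show "wedge_endo N l ?R \<and> bij_betw ?R (wedge N l) (wedge N l) \<and> (\<forall>k. ?R (u_vec N l k) = u_vec N l (\<lambda>a. k a - 1))"
      using induced_endo[OF stable_rdown] bij u by blast
    fix F assume F: "wedge_endo N l F \<and> bij_betw F (wedge N l) (wedge N l) \<and> (\<forall>k. F (u_vec N l k) = u_vec N l (\<lambda>a. k a - 1))"
    show "F = ?R"
    proof (rule endo_eqI)
      show "wedge_endo N l F" using F by blast
      show "wedge_endo N l ?R" by (rule induced_endo[OF stable_rdown])
      fix j f assume j: "j \<in> letters N l" and f: "f \<in> LP N"
      have mon: "F (wcoset N l (single j (single e 1))) = ?R (wcoset N l (single j (single e 1)))"
        if e: "keys e \<subseteq> {1..N}" for e
      proof -
        (* the integer vector with letters j and exponents e *)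
        define k where "k a = int (j a) - int l * (lookup e a + 1)" for a
        have jl: "j a < l" if "a \<in> {1..N}" for a using j that unfolding letters_def by auto
        have pu: "j_part l (k a) = j a" "m_part l (k a) = lookup e a" if "a \<in> {1..N}" for a
          using parts_unique[OF jl[OF that], of "k a" "lookup e a"] by (simp_all add: k_def)
        have "jpart_fun N l k = j"
        proof
          fix a
          have "j a = undefined" if "a \<notin> {1..N}" using j that unfolding letters_def by (rule PiE_arb)
          then show "jpart_fun N l k a = j a" using pu(1)[of a] by (simp add: jpart_fun_def restrict_def)
        qed
        moreover have "exponent N (\<lambda>a. m_part l (k a)) = e"
        proof (rule poly_mapping_eqI)
          fix a
          have "lookup e a = 0" if "a \<notin> {1..N}"
            using e that by (metis in_keys_iff subsetD)
          then show "lookup (exponent N (\<lambda>a. m_part l (k a))) a = lookup e a"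
            using pu(2)[of a] by simp
        qed
        ultimately have "u_vec N l k = wcoset N l (single j (single e 1))"
          by (simp add: u_vec_eq z_monom_def)
        then show ?thesis using F u[of k] by metis
      qed
      define S where "S A = (\<Sum>e\<in>A. const_L (lookup f e) * single e 1)" for A
      have "F (wcoset N l (single j (S A))) = ?R (wcoset N l (single j (S A))) \<and> S A \<in> LP N"
        if "finite A" "A \<subseteq> keys f" for A
        using that
      proof (induction A rule: finite_induct)
        case empty
        show ?case using F endo_0[of N l F] endo_0[OF induced_endo[OF stable_rdown]] by (simp add: S_def wcoset_0)
      next
        case (insert e A)
        then have e: "keys e \<subseteq> {1..N}" using f unfolding laurent_polys_def by blast
        have ih: "F (wcoset N l (single j (S A))) = ?R (wcoset N l (single j (S A)))" "S A \<in> LP N"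
          using insert by auto
        have t: "single j (single e 1) \<in> tensors N l" "single j (S A) \<in> tensors N l"
          using insert e by (auto intro!: tensors_single j LP_single simp del: One_nat_def)
        have s: "S (insert e A) = const_L (lookup f e) * single e 1 + S A"
          using insert by (simp add: S_def)
        have eq: "single j (S (insert e A)) = scale_T (lookup f e) (single j (single e 1)) + single j (S A)"
          unfolding s by (simp add: single_add)
        have eF: "wedge_endo N l F" and eR: "wedge_endo N l ?R" using F induced_endo[OF stable_rdown] by blast+
        have "S (insert e A) \<in> LP N" unfolding s using insert e by (intro LP_add LP_const_mult LP_single) auto
        then show ?case
          using t unfolding eq
          by (simp only: ih endo_wcoset_add[OF eF tensors_scale] endo_wcoset_add[OF eR tensors_scale]
              endo_wcoset_scale[OF eF] endo_wcoset_scale[OF eR] mon[OF e] simp_thms)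
      qed
      from this[of "keys f"] show "F (wcoset N l (single j f)) = ?R (wcoset N l (single j f))"
        unfolding S_def sum_of_singles[of f, symmetric] by simp
    qed
  qed
  show "bij_betw (rho N l) (wedge N l) (wedge N l)" unfolding r by (rule bij)
qed

section \<open>Moving letters around\<close>

text \<open>Equality in the wedge space up to a nonzero scalar that is left implicit. Eigenvectors are insensitive to it, and each exchange or
action of a generator on equal letters contributes one.\<close>

definition cong_scaled :: "nat \<Rightarrow> nat \<Rightarrow> tensor \<Rightarrow> tensor \<Rightarrow> bool" where
  "cong_scaled N l x y \<longleftrightarrow> (\<exists>c. c \<noteq> 0 \<and> x - scale_T c y \<in> hecke_rel N l)"

lemma cong_scaled_refl: "cong_scaled N l x x"
  unfolding cong_scaled_def by (intro exI[of _ 1]) (simp add: hecke_0)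

lemma cong_scaled_trans:
  assumes "cong_scaled N l x y" "cong_scaled N l y z"
  shows "cong_scaled N l x z"
proof -
  obtain c d where c: "c \<noteq> 0" "x - scale_T c y \<in> hecke_rel N l" and d: "d \<noteq> 0" "y - scale_T d z \<in> hecke_rel N l"
    using assms unfolding cong_scaled_def by blast
  have "x - scale_T c y + scale_T c (y - scale_T d z) \<in> hecke_rel N l"
    using c d by (intro hecke_add hecke_scale)
  then have "x - scale_T (c * d) z \<in> hecke_rel N l"
    by (simp add: T.scale_right_diff_distrib)
  then show ?thesis unfolding cong_scaled_def using c(1) d(1) by (intro exI[of _ "c * d"]) simp
qed

lemma equal_letters:
  assumes J: "J \<in> letters N l" "1 \<le> a" "a < N" "J a = J (Suc a)" "h \<in> LP N"
  shows "cong_scaled N l (single J (app (gg a) h)) (single J h)"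
    and "cong_scaled N l (single J (app (gi a) h)) (single J h)"
proof -
  define k where "k = app (gg a) h + RL * h"
  have "app (gg a) h \<in> LP N" using J by (intro presD[OF gop_LP]) auto
  then have "k \<in> LP N" unfolding k_def using J by (intro LP_add LP_const_mult)
  moreover have "app (sw a) k = k" unfolding k_def by (rule gop_plus_symmetric) simp
  ultimately have "single J k \<in> sym_rel N l" unfolding sym_rel_def using J by blast
  then have H: "single J k \<in> hecke_rel N l" using sym_rel_hecke by blast
  have "single J (app (gg a) h) - scale_T (- inverse q_par) (single J h) = single J k"
    by (simp add: k_def const_L_uminus single_add single_uminus)
  then show "cong_scaled N l (single J (app (gg a) h)) (single J h)"
    unfolding cong_scaled_def using H by (intro exI[of _ "- inverse q_par"]) simp
  have "single J (app (gi a) h) - scale_T (- q_par) (single J h) = single J k"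
    unfolding scale_T_single single_diff[symmetric]
    by (simp add: k_def const_L_uminus gin_def const_L_diff algebra_simps)
  then show "cong_scaled N l (single J (app (gi a) h)) (single J h)"
    unfolding cong_scaled_def using H by (intro exI[of _ "- q_par"]) simp
qed

text \<open>Moving a larger letter to the right past a smaller or equal one absorbs one factor \<open>G\<^sub>a\<close> of the coefficient.\<close>

lemma exchange_letters:
  assumes J: "J \<in> letters N l" "1 \<le> a" "a < N" "J (Suc a) \<le> J a" "h \<in> LP N"
  shows "cong_scaled N l (single J (app (gg a) h)) (single (jsw J a) h)"
proof (cases "J (Suc a) = J a")
  case True
  then have "jsw J a = J" by (auto simp: fun_eq_iff transpose_def)
  then show ?thesis using equal_letters(1)[of J N l a h] J True by simp
next
  case False
  have "app (gg a) h \<in> LP N" using J by (intro presD[OF gop_LP]) auto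
  then have "single J (app (gg a) h) + single (jsw J a) (app (gi a) (app (gg a) h)) \<in> swap_rel N l"
    unfolding swap_rel_def using J False by (intro CollectI exI[of _ J] exI[of _ a] exI[of _ "app (gg a) h"]) auto
  moreover have "app (gi a) (app (gg a) h) = h"
    using gin_gop[of a "Suc a"] by (simp flip: app_times)
  ultimately have "single J (app (gg a) h) - scale_T (- 1) (single (jsw J a) h) \<in> hecke_rel N l"
    using swap_rel_hecke by (auto simp: const_L_uminus single_uminus)
  then show ?thesis unfolding cong_scaled_def by (intro exI[of _ "- 1"]) simp
qed

abbreviation "pg m n \<equiv> prod_list (map (\<lambda>i. gg i) [m..<n])"
abbreviation "pgi m n \<equiv> prod_list (map (\<lambda>i. gi i) [m..<n])"

lemma pg_LP: "1 \<le> m \<Longrightarrow> n \<le> N \<Longrightarrow> pres N (pg m n)" "1 \<le> m \<Longrightarrow> n \<le> N \<Longrightarrow> pres N (pgi m n)"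
proof -
  have "unit_pres N (gg i)" "unit_pres N (gi i)" if "1 \<le> i" "i < N" for i
    using unit_pres_basic(3,4)[of i N "Suc i"] that by auto
  then have "1 \<le> m \<Longrightarrow> n \<le> N \<Longrightarrow> unit_pres N (pg m n)" "1 \<le> m \<Longrightarrow> n \<le> N \<Longrightarrow> unit_pres N (pgi m n)"
    by (auto intro!: unit_pres_prod_list)
  then show "1 \<le> m \<Longrightarrow> n \<le> N \<Longrightarrow> pres N (pg m n)" "1 \<le> m \<Longrightarrow> n \<le> N \<Longrightarrow> pres N (pgi m n)"
    by (auto simp: unit_pres_def)
qed

definition to_end :: "nat \<Rightarrow> nat \<Rightarrow> (nat \<Rightarrow> nat) \<Rightarrow> nat \<Rightarrow> nat" where
  "to_end N k J a = (if a < k \<or> N < a then J a else if a = N then J k else J (Suc a))"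

lemma move_to_end:
  assumes "1 \<le> k" "k \<le> N" "J \<in> letters N l" "\<And>a. a \<in> {1..N} \<Longrightarrow> J a \<le> J k" "g \<in> LP N"
  shows "cong_scaled N l (single J (app (pg k N) g)) (single (to_end N k J) g)"
  using assms
proof (induction "N - k" arbitrary: k J)
  case 0
  then have "k = N" by simp
  then have "to_end N k J = J" by (auto simp: to_end_def fun_eq_iff)
  then show ?case using \<open>k = N\<close> by (simp add: cong_scaled_refl)
next
  case (Suc d)
  then have k: "k < N" by simp
  have e: "app (pg k N) g = app (gg k) (app (pg (Suc k) N) g)"
    using k by (simp add: upt_rec)
  have LP: "app (pg (Suc k) N) g \<in> LP N" using Suc by (intro presD[OF pg_LP(1)]) auto
  have 1: "cong_scaled N l (single J (app (pg k N) g)) (single (jsw J k) (app (pg (Suc k) N) g))"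
    unfolding e using Suc k LP by (intro exchange_letters) auto
  have "cong_scaled N l (single (jsw J k) (app (pg (Suc k) N) g)) (single (to_end N (Suc k) (jsw J k)) g)"
  proof (rule Suc.hyps(1))
    show "jsw J k a \<le> jsw J k (Suc k)" if "a \<in> {1..N}" for a
      using Suc.prems that k by (auto simp: transpose_def)
    show "jsw J k \<in> letters N l" using Suc.prems k by (intro letters_swap) auto
  qed (use Suc k in auto)
  moreover have "to_end N (Suc k) (jsw J k) = to_end N k J"
    using k by (auto simp: to_end_def fun_eq_iff transpose_def less_Suc_eq)
  ultimately show ?case using cong_scaled_trans[OF 1] by simp
qed

lemma equal_prefix:
  assumes "J \<in> letters N l" "i \<le> N" "\<And>a. 1 \<le> a \<Longrightarrow> a < i \<Longrightarrow> J a = J (Suc a)" "h \<in> LP N" "1 \<le> m" 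
  shows "cong_scaled N l (single J (app (pgi m i) h)) (single J h)"
  using assms
proof (induction "i - m" arbitrary: m)
  case 0 then show ?case by (simp add: cong_scaled_refl)
next
  case (Suc d)
  then have "[m..<i] = m # [Suc m..<i]" by (simp add: upt_rec)
  then have e: "app (pgi m i) h = app (gi m) (app (pgi (Suc m) i) h)" by simp
  have LP: "app (pgi (Suc m) i) h \<in> LP N" using Suc by (intro presD[OF pg_LP(2)]) auto
  have "cong_scaled N l (single J (app (pgi m i) h)) (single J (app (pgi (Suc m) i) h))"
    unfolding e using Suc LP by (intro equal_letters(2)) auto
  moreover have "cong_scaled N l (single J (app (pgi (Suc m) i) h)) (single J h)"
    using Suc by (intro Suc.hyps(1)) auto
  ultimately show ?case by (rule cong_scaled_trans)
qed

section \<open>The cyclic raising operator\<close>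

text \<open>The cyclic element \<open>z\<^sub>1\<^sup>-\<^sup>1 G\<^sub>1 \<dots> G\<^bsub>N-1\<^esub>\<close>.\<close>

definition cycop :: "nat \<Rightarrow> lop" where
  "cycop N = mulop (zinv 1) * pg 1 N"

lemma cycop_joint_eigen:
  assumes N: "1 \<le> N" and f: "joint_eigen N l f"
  shows "joint_eigen N l (app (cycop N) f)"
  unfolding joint_eigen_def
proof
  fix a assume a: "a \<in> {1..N}"
  note H = hecke_interp[OF N, of l]
  have cyc: "affine_hecke_cyclic.cyc N (\<lambda>i. gg i) (\<lambda>i. mulop (zinv i)) = cycop N"
    unfolding affine_hecke_cyclic.cyc_def[OF H] cycop_def ..
  show "\<exists>y. app (Yop N l a) (app (cycop N) f) = const_L y * app (cycop N) f"
  proof (cases "a = 1")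
    case True
    have "N \<in> {1..N}" using N by simp
    then obtain y where y: "app (Yop N l N) f = const_L y * f" using f unfolding joint_eigen_def by blast
    have "app (Yop N l 1 * cycop N) f = app (scal (inverse (p_par l)) * cycop N * Yop N l N) f"
      using affine_hecke_cyclic.Y_1_cyc[OF H N] unfolding cyc by simp
    then have "app (Yop N l 1) (app (cycop N) f) = const_L (inverse (p_par l) * y) * app (cycop N) f"
      by (simp add: y const_L_mult mult.assoc)
    then show ?thesis using True by blast
  next
    case False
    then obtain b where b: "a = Suc b" "1 \<le> b" "b < N" using a by (cases a) auto
    have "b \<in> {1..N}" using b by simp
    then obtain y where y: "app (Yop N l b) f = const_L y * f" using f unfolding joint_eigen_def by blast
    have "app (Yop N l a * cycop N) f = app (cycop N * Yop N l b) f"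
      using affine_hecke_cyclic.Y_cyc[OF H b(2,3)] unfolding cyc b(1) by simp
    then have "app (Yop N l a) (app (cycop N) f) = const_L y * app (cycop N) f" by (simp add: y)
    then show ?thesis by blast
  qed
qed

lemma cycop_LP: "1 \<le> N \<Longrightarrow> pres N (cycop N)"
  using pg_LP(1)[of 1 N N] unit_pres_basic(5)[of 1 N 1] unfolding cycop_def pres_def unit_pres_def by auto

definition zpre :: "nat \<Rightarrow> laurent" where "zpre i = (\<Prod>a\<in>{1..i}. var_z a)"

lemma zpre_Suc: "zpre (Suc i) = var_z (Suc i) * zpre i" and zpre_0: "zpre 0 = 1"
  by (simp_all add: zpre_def atLeastAtMostSuc_conv mult.commute)

lemma zpre_LP: "i \<le> N \<Longrightarrow> zpre i \<in> LP N"
  unfolding zpre_def by (rule LP_prod) (auto intro!: LP_var)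

text \<open>The factors \<open>z\<^sub>2, \<dots>, z\<^sub>i\<close> are moved to the right by \<open>z\<^bsub>a+1\<^esub> G\<^sub>a = G\<^sub>a\<^sup>-\<^sup>1 z\<^sub>a\<close>. The inverse generators on the left act on
positions with equal letters, where they are scalars in the wedge space.\<close>

lemma zpre_cycop:
  assumes "1 \<le> i" "i \<le> N"
  shows "mulop (zpre i) * cycop N = pgi 1 i * (pg i N * mulop (zpre (i - 1)))"
  using assms
proof (induction i rule: nat_induct_at_least)
  case base
  show ?case by (simp add: zpre_def cycop_def flip: mult.assoc)
next
  case (Suc i)
  have c1: "pgi 1 i * mulop (var_z (Suc i)) = mulop (var_z (Suc i)) * pgi 1 i"
  proof (rule prod_list_commute)
    fix x assume "x \<in> set (map (\<lambda>i. gi i) [1..<i])"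
    then obtain k where k: "x = gi k" "1 \<le> k" "k < i" by auto
    then have "gg k * mulop (var_z (Suc i)) = mulop (var_z (Suc i)) * gg k"
      by (intro gop_mulop_commute) (auto simp: transpose_def)
    then show "x * mulop (var_z (Suc i)) = mulop (var_z (Suc i)) * x"
      using scal_commute[of _ "mulop (var_z (Suc i))"] by (simp add: k gin_def left_diff_distrib right_diff_distrib)
  qed
  have c2: "pg (Suc i) N * mulop (var_z i) = mulop (var_z i) * pg (Suc i) N"
  proof (rule prod_list_commute)
    fix x assume "x \<in> set (map (\<lambda>i. gg i) [Suc i..<N])"
    then obtain k where k: "x = gg k" "i < k" "k < N" by auto
    then show "x * mulop (var_z i) = mulop (var_z i) * x"
      by (auto intro!: gop_mulop_commute simp: transpose_def)
  qed
  have pg: "pg i N = gg i * pg (Suc i) N" and pgi: "pgi 1 (Suc i) = pgi 1 i * gi i"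
    using Suc by (simp_all add: upt_rec[of i N])
  have z: "mulop (zpre i) = mulop (var_z i) * mulop (zpre (i - 1))"
    using Suc.hyps zpre_Suc[of "i - 1"] by (simp add: mulop_mult)
  have "mulop (zpre (Suc i)) * cycop N = mulop (var_z (Suc i)) * (mulop (zpre i) * cycop N)"
    by (simp add: zpre_Suc mulop_mult mult.assoc)
  also have "\<dots> = mulop (var_z (Suc i)) * (pgi 1 i * (pg i N * mulop (zpre (i - 1))))"
    using Suc by simp
  also have "\<dots> = (mulop (var_z (Suc i)) * pgi 1 i) * (pg i N * mulop (zpre (i - 1)))"
    by (simp only: mult.assoc)
  also have "\<dots> = pgi 1 i * (mulop (var_z (Suc i)) * gg i) * (pg (Suc i) N * mulop (zpre (i - 1)))"
    unfolding c1[symmetric] pg by (simp only: mult.assoc)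
  also have "mulop (var_z (Suc i)) * gg i = gi i * mulop (var_z i)"
    by (rule var_gop) simp
  also have "pgi 1 i * (gi i * mulop (var_z i)) * (pg (Suc i) N * mulop (zpre (i - 1)))
     = pgi 1 (Suc i) * ((mulop (var_z i) * pg (Suc i) N) * mulop (zpre (i - 1)))"
    unfolding pgi by (simp only: mult.assoc)
  also have "\<dots> = pgi 1 (Suc i) * (pg (Suc i) N * mulop (zpre i))"
    unfolding c2[symmetric] z by (simp only: mult.assoc)
  finally show ?case by simp
qed

text \<open>The letters after the last \<open>i\<close> of them, all equal to \<open>l - 1\<close>, have been moved to the front.\<close>

definition rotj :: "nat \<Rightarrow> nat \<Rightarrow> nat \<Rightarrow> (nat \<Rightarrow> nat) \<Rightarrow> nat \<Rightarrow> nat" where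
  "rotj N l i j a = (if a \<in> {1..N} then if a \<le> i then l - 1 else j (a - i) else j a)"

text \<open>The coefficient is rewritten by \<open>zpre_cycop\<close>. Its first part acts on the equal letters at the front by scalars, and the
factors \<open>G\<^bsub>i+1\<^esub>, \<dots>, G\<^bsub>N-1\<^esub>\<close> are absorbed when the last of these letters travels to the end.\<close>

lemma rotate_step:
  assumes j: "j \<in> letters N l" and i: "Suc i \<le> b" "b \<le> N" and b: "\<And>a. a \<in> {1..N} \<Longrightarrow> N - b < a \<Longrightarrow> j a = l - 1" and l: "l > 0"
    and f: "f \<in> LP N"
  shows "cong_scaled N l (single (rotj N l (Suc i) j) (zpre (Suc i) * app (cycop N) f))
    (single (rotj N l i j) (zpre i * f))"
proof -
  let ?J = "rotj N l (Suc i) j"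
  have jl: "j a < l" if "a \<in> {1..N}" for a using j that unfolding letters_def by auto
  have out: "j a = undefined" if "a \<notin> {1..N}" for a using j that unfolding letters_def by (rule PiE_arb)
  have J: "?J \<in> letters N l"
    unfolding letters_def
  proof (rule PiE_I)
    fix a assume "a \<in> {1..N}"
    then have "\<not> a \<le> Suc i \<Longrightarrow> a - Suc i \<in> {1..N}" by auto
    then show "?J a \<in> {..<l}" using jl[of "a - Suc i"] l \<open>a \<in> {1..N}\<close> by (auto simp: rotj_def)
  next
    fix a assume "a \<notin> {1..N}"
    then show "?J a = undefined" using out unfolding rotj_def by (simp only: if_False)
  qed
  have Jmax: "?J a \<le> l - 1" if "a \<in> {1..N}" for a
  proof -
    have "?J a < l" using J that unfolding letters_def by blast
    then show ?thesis by simp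
  qed
  have Jtop: "?J a = l - 1" if "1 \<le> a" "a \<le> Suc i" for a using that i by (simp add: rotj_def)
  define g where "g = zpre i * f"
  have g: "g \<in> LP N" unfolding g_def using i f by (intro LP_mult zpre_LP) auto
  have h: "app (pg (Suc i) N) g \<in> LP N" using i by (intro presD[OF pg_LP(1) g]) auto
  have "zpre (Suc i) * app (cycop N) f = app (mulop (zpre (Suc i)) * cycop N) f" by simp
  also have "\<dots> = app (pgi 1 (Suc i)) (app (pg (Suc i) N) g)"
    using zpre_cycop[of "Suc i" N] i by (simp add: g_def del: upt_Suc)
  finally have e: "zpre (Suc i) * app (cycop N) f = app (pgi 1 (Suc i)) (app (pg (Suc i) N) g)" .
  have c1: "cong_scaled N l (single ?J (app (pgi 1 (Suc i)) (app (pg (Suc i) N) g))) (single ?J (app (pg (Suc i) N) g))"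
    using i Jtop by (intro equal_prefix J h) auto
  have c2: "cong_scaled N l (single ?J (app (pg (Suc i) N) g)) (single (to_end N (Suc i) ?J) g)"
    using i Jtop[of "Suc i"] Jmax by (intro move_to_end J g) auto
  have r: "to_end N (Suc i) ?J = rotj N l i j"
  proof
    fix a
    have "j (N - i) = l - 1" if "N \<ge> 1" using i that by (intro b) auto
    then show "to_end N (Suc i) ?J a = rotj N l i j a"
      using i by (auto simp: to_end_def rotj_def)
  qed
  show ?thesis using cong_scaled_trans[OF c1 c2] unfolding e r unfolding g_def .
qed

lemma rotate:
  assumes j: "j \<in> letters N l" and b: "b \<le> N" "\<And>a. a \<in> {1..N} \<Longrightarrow> N - b < a \<Longrightarrow> j a = l - 1" and l: "l > 0"
    and f: "f \<in> LP N" and N: "1 \<le> N" and i: "i \<le> b"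
  shows "cong_scaled N l (single (rotj N l i j) (zpre i * app (cycop N ^ i) f)) (single j f)"
  using i
proof (induction i)
  case 0
  have "rotj N l 0 j = j" by (auto simp: rotj_def fun_eq_iff)
  then show ?case by (simp add: zpre_0 cong_scaled_refl)
next
  case (Suc i)
  have "app (cycop N ^ i) f \<in> LP N"
    using f by (induction i) (auto intro: presD[OF cycop_LP[OF N]])
  then have 1: "cong_scaled N l (single (rotj N l (Suc i) j) (zpre (Suc i) * app (cycop N) (app (cycop N ^ i) f)))
    (single (rotj N l i j) (zpre i * app (cycop N ^ i) f))"
    using Suc.prems b l by (intro rotate_step[where b = b] j) auto
  have 2: "cong_scaled N l (single (rotj N l i j) (zpre i * app (cycop N ^ i) f)) (single j f)"
    using Suc by simp
  show ?case unfolding power_Suc app_times by (rule cong_scaled_trans[OF 1 2])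
qed

lemma top_block:
  assumes "\<And>a. \<not> descent N j a" "j \<in> letters N l"
  obtains b where "b \<le> N" "\<And>a. a \<in> {1..N} \<Longrightarrow> N - b < a \<longleftrightarrow> j a = l - 1"
proof -
  have mono: "j a \<le> j c" if "1 \<le> a" "a \<le> c" "c \<le> N" for a c
    using assms(1) that mono_iff_no_descent[of N j] by (auto simp: mono_on_def monotone_on_def)
  have jl: "j a < l" if "a \<in> {1..N}" for a using assms(2) that unfolding letters_def by auto
  show ?thesis
  proof (cases "\<exists>a\<in>{1..N}. j a = l - 1")
    case False
    then show ?thesis using that[of 0] by auto
  next
    case True
    define a0 where "a0 = (LEAST a. a \<in> {1..N} \<and> j a = l - 1)"
    have "\<exists>a. a \<in> {1..N} \<and> j a = l - 1" using True by blast
    from LeastI_ex[OF this] have a0: "a0 \<in> {1..N}" "j a0 = l - 1" unfolding a0_def by blast+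
    show ?thesis
    proof (rule that[of "N + 1 - a0"])
      show "N + 1 - a0 \<le> N" using a0 by auto
      fix a assume a: "a \<in> {1..N}"
      have "a0 \<le> a \<longleftrightarrow> j a = l - 1"
      proof
        assume "a0 \<le> a"
        then have "l - 1 \<le> j a" using mono[of a0 a] a0 a by auto
        then show "j a = l - 1" using jl[OF a] by simp
      next
        assume "j a = l - 1"
        then show "a0 \<le> a" unfolding a0_def using a by (intro Least_le) blast
      qed
      then show "N - (N + 1 - a0) < a \<longleftrightarrow> j a = l - 1" using a0 a by auto
    qed
  qed
qed

text \<open>If the last \<open>b\<close> letters are \<open>l - 1\<close>, then the preimage has \<open>b\<close> letters \<open>0\<close> in front, the other letters raised by one, and
the \<open>b\<close>-th power of the cyclic element applied to the coefficient. Lowering its letters gives the rotated tensor of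
\<open>rotate\<close>.\<close>

lemma rho_preimage:
  assumes j: "j \<in> letters N l" "\<And>a. \<not> descent N j a" and f: "f \<in> LP N" "joint_eigen N l f" and N: "1 \<le> N" and l: "l > 0"
  obtains j' h where "j' \<in> letters N l" "\<And>a. \<not> descent N j' a" "h \<in> LP N" "joint_eigen N l h"
    "cong_scaled N l (rdown N l (single j' h)) (single j f)"
proof -
  obtain b where b: "b \<le> N" "\<And>a. a \<in> {1..N} \<Longrightarrow> N - b < a \<longleftrightarrow> j a = l - 1"
    using top_block[OF j(2,1)] by blast
  define j' where "j' = restrict (\<lambda>a. if a \<le> b then 0 else Suc (j (a - b))) {1..N}"
  define h where "h = app (cycop N ^ b) f"
  have jl: "j a < l" if "a \<in> {1..N}" for a using j(1) that unfolding letters_def by auto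
  have jl': "Suc (j (a - b)) < l" if "a \<in> {1..N}" "b < a" for a
  proof -
    have "a - b \<in> {1..N}" "\<not> N - b < a - b" using that by auto
    then show ?thesis using b(2)[of "a - b"] jl[of "a - b"] by auto
  qed
  have 1: "j' \<in> letters N l"
    unfolding letters_def j'_def using jl' l by (intro restrict_PiE[THEN iffD2]) auto
  have 2: "\<not> descent N j' a" for a
  proof
    assume d: "descent N j' a"
    then have a: "1 \<le> a" "a < N" by (auto simp: descent_def)
    have "b < a" using d by (auto simp: descent_def j'_def split: if_splits)
    then have "descent N j (a - b)" using d a by (auto simp: descent_def j'_def Suc_diff_le)
    then show False using j(2) by blast
  qed
  have 3: "h \<in> LP N \<and> joint_eigen N l h"
    unfolding h_def using f by (induction b) (auto intro: presD[OF cycop_LP[OF N]] cycop_joint_eigen[OF N])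
  have out: "j a = undefined" if "a \<notin> {1..N}" for a using j(1) that unfolding letters_def by (rule PiE_arb)
  have "restrict (s_down l \<circ> j') {1..N} = rotj N l b j"
  proof
    fix a
    show "restrict (s_down l \<circ> j') {1..N} a = rotj N l b j a"
    proof (cases "a \<in> {1..N}")
      case True
      then show ?thesis by (simp add: s_down_def j'_def rotj_def)
    next
      case False
      then show ?thesis using out[OF False] unfolding rotj_def restrict_def by (simp only: if_False)
    qed
  qed
  moreover have "{a \<in> {1..N}. j' a = 0} = {1..b}" using b(1) by (auto simp: j'_def)
  then have "zprod N var_z (\<lambda>x. x = 0) j' = zpre b" by (simp add: zprod_def zpre_def)
  ultimately have "rdown N l (single j' h) = single (rotj N l b j) (zpre b * h)"
    by (simp only: rdown_def relabel_single)
  then have "cong_scaled N l (rdown N l (single j' h)) (single j f)"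
    unfolding h_def using rotate[OF j(1) b(1) b(2)[THEN iffD1] l f(1) N le_refl] by (simp only:)
  then show ?thesis using that 1 2 3 by blast
qed

section \<open>The sorting permutation\<close>

text \<open>Sorting by letter and, for equal letters, by \<open>m\<close> is a strict total order on the positions, because equal pairs come from
equal entries of \<open>k\<close>. The sorting permutation is the inverse of the function \<open>r\<close> that counts predecessors.\<close>

lemma sort_perm:
  fixes k :: "nat \<Rightarrow> int"
  assumes l: "l > 0" and k: "\<And>a b. a \<in> {1..N} \<Longrightarrow> b \<in> {1..N} \<Longrightarrow> a < b \<Longrightarrow> k b < k a"
  defines "\<tau> \<equiv> sort_perm N l k"
  shows "\<tau> permutes {1..N}" "mono_on {1..N} (\<lambda>a. j_part l (k (\<tau> a)))"
    and "\<And>a b. a \<in> {1..N} \<Longrightarrow> b \<in> {1..N} \<Longrightarrow> a < b \<Longrightarrow> j_part l (k (\<tau> a)) = j_part l (k (\<tau> b)) \<Longrightarrow>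
        m_part l (k (\<tau> a)) < m_part l (k (\<tau> b))"
proof -
  define Lt where "Lt a b \<longleftrightarrow> j_part l (k a) < j_part l (k b) \<or> j_part l (k a) = j_part l (k b) \<and> m_part l (k a) < m_part l (k b)" for a b
  define good where "good \<tau> \<longleftrightarrow> \<tau> permutes {1..N} \<and> mono_on {1..N} (\<lambda>a. j_part l (k (\<tau> a))) \<and>
    (\<forall>a\<in>{1..N}. \<forall>b\<in>{1..N}. a < b \<and> j_part l (k (\<tau> a)) = j_part l (k (\<tau> b)) \<longrightarrow> m_part l (k (\<tau> a)) < m_part l (k (\<tau> b)))"
    for \<tau>
  have irrefl: "\<not> Lt a a" and trans: "Lt a b \<Longrightarrow> Lt b d \<Longrightarrow> Lt a d" for a b d
    by (auto simp: Lt_def)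
  have total: "Lt a b \<or> Lt b a" if "a \<in> {1..N}" "b \<in> {1..N}" "a \<noteq> b" for a b
  proof (rule ccontr)
    assume "\<not> (Lt a b \<or> Lt b a)"
    then have "j_part l (k a) = j_part l (k b)" "m_part l (k a) = m_part l (k b)" by (auto simp: Lt_def)
    then have "k a = k b" using j_part_m_part(2)[OF l, of "k a"] j_part_m_part(2)[OF l, of "k b"] by simp
    then show False using k[of a b] k[of b a] that by (cases "a < b") auto
  qed
  have good_iff: "good \<tau> \<longleftrightarrow> \<tau> permutes {1..N} \<and> (\<forall>a\<in>{1..N}. \<forall>b\<in>{1..N}. a < b \<longrightarrow> Lt (\<tau> a) (\<tau> b))" for \<tau>
  proof -
    have mono: "mono_on {1..N} f \<longleftrightarrow> (\<forall>a\<in>{1..N}. \<forall>b\<in>{1..N}. a < b \<longrightarrow> f a \<le> f b)" for f :: "nat \<Rightarrow> nat"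
      by (auto simp: mono_on_def monotone_on_def order_le_less)
    have pair: "(J \<le> J' \<and> (J = J' \<longrightarrow> M < M')) = (J < J' \<or> J = J' \<and> M < M')" for J J' :: nat and M M' :: int
      by auto
    show ?thesis
      unfolding good_def Lt_def mono pair[symmetric] by (simp only: imp_conjL ball_conj_distrib imp_conjR)
  qed
  define r where "r a = (if a \<in> {1..N} then card {b\<in>{1..N}. Lt b a} + 1 else a)" for a
  have r_less: "r a < r b" if "Lt a b" "a \<in> {1..N}" "b \<in> {1..N}" for a b
  proof -
    have "{c\<in>{1..N}. Lt c a} \<subset> {c\<in>{1..N}. Lt c b}" using that irrefl trans by blast
    then have "card {c\<in>{1..N}. Lt c a} < card {c\<in>{1..N}. Lt c b}" by (intro psubset_card_mono) auto
    then show ?thesis using that by (simp add: r_def)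
  qed
  have r_inj: "inj_on r {1..N}"
  proof (rule inj_onI)
    fix a b assume ab: "a \<in> {1..N}" "b \<in> {1..N}" "r a = r b"
    then show "a = b" using total[OF ab(1,2)] r_less[of a b] r_less[of b a] by auto
  qed
  have r_in: "r a \<in> {1..N}" if "a \<in> {1..N}" for a
  proof -
    have "{b\<in>{1..N}. Lt b a} \<subset> {1..N}" using that irrefl by blast
    then have "card {b\<in>{1..N}. Lt b a} < card {1..N}" by (intro psubset_card_mono) auto
    then show ?thesis using that by (simp add: r_def)
  qed
  have r_perm: "r permutes {1..N}"
  proof (rule bij_imp_permutes)
    have "r ` {1..N} = {1..N}" by (rule endo_inj_surj[OF _ _ r_inj]) (use r_in in auto)
    then show "bij_betw r {1..N} {1..N}" using r_inj by (simp add: bij_betw_def)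
  qed (auto simp: r_def)
  define \<tau>0 where "\<tau>0 = inv r"
  have \<tau>0: "\<tau>0 permutes {1..N}" "\<And>a. r (\<tau>0 a) = a" "\<And>a. \<tau>0 (r a) = a"
    unfolding \<tau>0_def using permutes_inv[OF r_perm] permutes_inverses[OF r_perm] by auto
  have good0: "good \<tau>0"
    unfolding good_iff
  proof (intro conjI ballI impI \<tau>0(1))
    fix a b assume ab: "a \<in> {1..N}" "b \<in> {1..N}" "a < b"
    then have in12: "\<tau>0 a \<in> {1..N}" "\<tau>0 b \<in> {1..N}" using permutes_in_image[OF \<tau>0(1)] by blast+
    have "\<tau>0 a \<noteq> \<tau>0 b" using ab \<tau>0(2) by (metis less_irrefl)
    then show "Lt (\<tau>0 a) (\<tau>0 b)" using total[OF in12] r_less[OF _ in12(2,1)] \<tau>0(2) ab by fastforce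
  qed
  have uniq: "\<sigma> = \<tau>0" if "good \<sigma>" for \<sigma>
  proof
    fix a
    have p: "\<sigma> permutes {1..N}" and lt: "\<And>a b. a \<in> {1..N} \<Longrightarrow> b \<in> {1..N} \<Longrightarrow> a < b \<Longrightarrow> Lt (\<sigma> a) (\<sigma> b)"
      using that unfolding good_iff by blast+
    show "\<sigma> a = \<tau>0 a"
    proof (cases "a \<in> {1..N}")
      case True
      have mem: "\<sigma> c \<in> {1..N} \<longleftrightarrow> c \<in> {1..N}" for c using permutes_in_image[OF p] .
      have "{b\<in>{1..N}. Lt b (\<sigma> a)} = \<sigma> ` {1..<a}"
      proof (intro subset_antisym subsetI)
        fix b assume b: "b \<in> {b\<in>{1..N}. Lt b (\<sigma> a)}"
        obtain c where c: "b = \<sigma> c" using p by (metis permutes_surj surjD)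
        then have "c \<in> {1..N}" using b mem by blast
        moreover have "\<not> a \<le> c" using b c lt[OF True \<open>c \<in> {1..N}\<close>] irrefl trans by (metis le_less mem_Collect_eq)
        ultimately show "b \<in> \<sigma> ` {1..<a}" using c by auto
      next
        fix b assume "b \<in> \<sigma> ` {1..<a}"
        then obtain c where c: "b = \<sigma> c" "1 \<le> c" "c < a" by auto
        then have "c \<in> {1..N}" using True by auto
        then show "b \<in> {b\<in>{1..N}. Lt b (\<sigma> a)}" using lt[OF _ True c(3)] mem c(1) by blast
      qed
      moreover have "card (\<sigma> ` {1..<a}) = a - 1"
        by (subst card_image[OF inj_on_subset[OF permutes_inj[OF p]]]) auto
      ultimately have "r (\<sigma> a) = a" using True mem[of a] by (simp add: r_def del: One_nat_def)
      then show ?thesis using \<tau>0(3) by metis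
    next
      case False
      then show ?thesis using permutes_not_in[OF p] permutes_not_in[OF \<tau>0(1)] by simp
    qed
  qed
  have "\<tau> = (THE \<tau>. good \<tau>)" unfolding \<tau>_def sort_perm_def good_def ..
  then have "\<tau> = \<tau>0" using good0 uniq by (metis the_equality)
  then have "good \<tau>" using good0 by simp
  then show "\<tau> permutes {1..N}" "mono_on {1..N} (\<lambda>a. j_part l (k (\<tau> a)))"
    "\<And>a b. a \<in> {1..N} \<Longrightarrow> b \<in> {1..N} \<Longrightarrow> a < b \<Longrightarrow> j_part l (k (\<tau> a)) = j_part l (k (\<tau> b)) \<Longrightarrow>
        m_part l (k (\<tau> a)) < m_part l (k (\<tau> b))"
    unfolding good_def by blast+
qed

section \<open>Sorted tensors with jointly diagonal coefficient\<close>

lemma scale_W_scale_W: "X \<in> wedge N l \<Longrightarrow> scale_W N l a (scale_W N l b X) = scale_W N l (a * b) X"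
  unfolding wedge_def by (auto simp: scale_W_wcoset)

lemma endo_scale_W: "wedge_endo N l F \<Longrightarrow> X \<in> wedge N l \<Longrightarrow> F (scale_W N l c X) = scale_W N l c (F X)"
  unfolding wedge_endo_def by blast

lemma joint_eigen_scale: "joint_eigen N l h \<Longrightarrow> joint_eigen N l (const_L c * h)"
  unfolding joint_eigen_def by (metis app_const mult.left_commute)

text \<open>For \<open>i = 0\<close>, the preimage under \<open>\<rho>\<close> is rescaled so that it is mapped to the given vector itself; the scalar by which
\<open>K\<^sub>1\<close> acts on it then carries over.\<close>

lemma sorted_eigen_K:
  assumes N: "1 \<le> N" and l: "l > 0"
    and j: "j \<in> letters N l" "\<And>a. \<not> descent N j a" and f: "f \<in> LP N" "joint_eigen N l f"
  shows "\<exists>y. K_coeff N l i \<epsilon> n (wcoset N l (single j f)) = scale_W N l y (wcoset N l (single j f))"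
proof (cases "i = 0")
  case False
  then show ?thesis using K_finite_eigen[OF j f] by (simp add: K_coeff_def)
next
  case True
  define X where "X = wcoset N l (single j f)"
  have X: "X \<in> wedge N l" unfolding X_def using j f by (intro wcoset_wedge tensors_single)
  have bij: "bij_betw (rho N l) (wedge N l) (wedge N l)" by (rule rho_eq(2)[OF l])
  have endo: "wedge_endo N l (rho N l)" unfolding rho_eq(1)[OF l] by (rule induced_endo[OF stable_rdown])
  obtain j' h where j': "j' \<in> letters N l" "\<And>a. \<not> descent N j' a" and h: "h \<in> LP N" "joint_eigen N l h"
    and cs: "cong_scaled N l (rdown N l (single j' h)) (single j f)"
    using rho_preimage[OF j f N l] by blast
  then obtain c where c: "c \<noteq> 0" "rdown N l (single j' h) - scale_T c (single j f) \<in> hecke_rel N l"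
    unfolding cong_scaled_def by blast
  (* rescaling makes the image under rho equal to X, so that it is the preimage of X *)
  define h' where "h' = const_L (inverse c) * h"
  define Z where "Z = wcoset N l (single j' h')"
  have h': "h' \<in> LP N" "joint_eigen N l h'"
    unfolding h'_def by (rule LP_const_mult[OF h(1)], rule joint_eigen_scale[OF h(2)])
  have t: "single j' h \<in> tensors N l" "single j' h' \<in> tensors N l"
    using tensors_single[OF j'(1) h(1)] tensors_single[OF j'(1) h'(1)] .
  have Z: "Z \<in> wedge N l" unfolding Z_def using t by (intro wcoset_wedge)
  have "rho N l (wcoset N l (single j' h)) = wcoset N l (scale_T c (single j f))"
    using c(2) unfolding rho_eq(1)[OF l] induced_wcoset[OF stable_rdown t(1)] wcoset_eq_iff .
  then have "rho N l (wcoset N l (single j' h)) = scale_W N l c X"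
    unfolding X_def scale_W_wcoset .
  moreover have "Z = scale_W N l (inverse c) (wcoset N l (single j' h))"
    by (simp add: Z_def h'_def scale_W_wcoset)
  ultimately have "rho N l Z = scale_W N l (inverse c) (scale_W N l c X)"
    using endo_scale_W[OF endo wcoset_wedge[OF t(1)]] by simp
  also have "\<dots> = X" using c(1) unfolding X_def by (simp add: scale_W_wcoset flip: mult.assoc const_L_mult)
  finally have rZ: "rho N l Z = X" .
  have inv: "inv_into (wedge N l) (rho N l) X = Z"
    using bij Z rZ by (intro inv_into_f_eq) (auto simp: bij_betw_def)
  obtain y where "K_finite N l 1 \<epsilon> n Z = scale_W N l y Z"
    unfolding Z_def using K_finite_eigen[OF j' h'] by blast
  then have "K_coeff N l 0 \<epsilon> n X = rho N l (scale_W N l ((q_par * r_par) powi (case \<epsilon> of Plus \<Rightarrow> - int n | Minus \<Rightarrow> int n)) (scale_W N l y Z))"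
    unfolding K_coeff_def inv by simp
  also have "\<dots> = scale_W N l ((q_par * r_par) powi (case \<epsilon> of Plus \<Rightarrow> - int n | Minus \<Rightarrow> int n) * y) X"
    unfolding scale_W_scale_W[OF Z] endo_scale_W[OF endo Z] rZ ..
  finally show ?thesis unfolding True X_def by blast
qed

theorem proposition6p2p6:
  fixes l N :: nat and c \<alpha> \<gamma> :: int and k :: "nat \<Rightarrow> int"
  assumes "l > 2"
    and "\<gamma> \<ge> 0"
    and "\<alpha> * int l + c > \<gamma> * int l"
    and "int N = \<alpha> * int l + c"
    and "k \<in> Z_plus N l c \<gamma>"
  shows "simultaneous_K_eigenvector N l (Psi N l k)"
proof -
  have l: "l > 0" using assms(1) by simp
  have "\<gamma> * int l \<ge> 0" using assms(2) by simp
  then have N: "1 \<le> N" using assms(3,4) by linarith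
  have dec: "\<And>a b. a \<in> {1..N} \<Longrightarrow> b \<in> {1..N} \<Longrightarrow> a < b \<Longrightarrow> k b < k a"
    using assms(5) unfolding Z_plus_def by blast
  define \<tau> where "\<tau> = sort_perm N l k"
  note \<tau> = sort_perm[of l N k, OF l dec, folded \<tau>_def]
  define m where "m = (\<lambda>a. m_part l (k (\<tau> a)))"
  define j where "j = jpart_fun N l (\<lambda>a. k (\<tau> a))"
  define f where "f = macdonald N l m"
  have Psi: "Psi N l k = wcoset N l (single j f)"
    by (simp add: Psi_def Let_def wtens_def tens_v_basis j_def jpart_fun_def f_def m_def \<tau>_def)
  have j: "j \<in> letters N l" unfolding j_def by (rule jpart_fun_letters[OF l])
  have jv: "j a = j_part l (k (\<tau> a))" if "a \<in> {1..N}" for a using that by (simp add: j_def jpart_fun_def)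
  have "mono_on {1..N} j"
    using \<tau>(2) jv by (auto simp: mono_on_def monotone_on_def)
  then have sorted: "\<And>a. \<not> descent N j a" unfolding mono_iff_no_descent by blast
  have inc: "\<And>a b. a \<in> {1..N} \<Longrightarrow> b \<in> {1..N} \<Longrightarrow> a < b \<Longrightarrow> j a = j b \<Longrightarrow> m a < m b"
    unfolding m_def using \<tau>(3) jv by metis
  note mac = macdonald[OF N l, where m = m, folded f_def]
  have eig: "joint_eigen N l f" unfolding joint_eigen_def using mac(3) by blast
  have "single j f \<notin> hecke_rel N l"
    by (rule sorted_not_hecke[where m = m, OF sorted _ mac(2)]) (rule inc)
  then have "wcoset N l (single j f) \<noteq> hecke_rel N l"
    unfolding wcoset_0[symmetric] wcoset_eq_iff by simp
  moreover have "wcoset N l (single j f) \<in> wedge N l"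
    using j mac(1) by (intro wcoset_wedge tensors_single)
  ultimately show ?thesis
    unfolding simultaneous_K_eigenvector_def Psi using sorted_eigen_K[OF N l j sorted mac(1) eig] by blast
qed

end
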